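(* Let $q>0$ and let $A$ and $B$ be independent Bernoulli random variables with success probability $\frac{q}{3+q}$. For each $n\in\mathbb{N}$ let $\Pi_n$ be a random permutation in $\mathcal{S}_n(123)$ distributed according to $\mathbb{P}_n^{q,123}$, i.e. $\mathbb{P}(\Pi_n=\sigma)=q^{\mathrm{fp}(\sigma)}/Z_n(q,123)$ for $\sigma\in\mathcal{S}_n(123)$, where $Z_n(q,123)=\sum_{\sigma\in\mathcal{S}_n(123)}q^{\mathrm{fp}(\sigma)}$. Then as $n\to\infty$, $\mathrm{fp}(\Pi_n)$ converges in distribution to $A+B$.
   Context: $\mathcal{S}_n$ denotes the set of permutations of $\{1,\dots,n\}$, written in one-line notation $\sigma=\sigma_1\cdots\sigma_n$. For $\sigma\in\mathcal{S}_n$, $\mathrm{fp}(\sigma)$ is the number of $i$ with $\sigma_i=i$. For $\tau\in\mathcal{S}_m$ with $2\le m\le n$, $\sigma$ contains the pattern $\tau$ if there are indices $1\le i_1<\cdots<i_m\le n$ such that for all $j,k$, $\sigma_{i_j}<\sigma_{i_k}$ iff $\tau_j<\tau_k$; otherwise $\sigma$ avoids $\tau$ (and if $m>n$ every $\sigma\in\mathcal{S}_n$ avoids $\tau$). $\mathcal{S}_n(\tau)$ is the set of $\sigma\in\mathcal{S}_n$ avoiding $\tau$. *)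

theory Defs
  imports "HOL-Probability.Probability" "HOL-Combinatorics.Permutations"
begin

definition Sn :: "nat \<Rightarrow> (nat \<Rightarrow> nat) set" where
  "Sn n = {\<sigma>. \<sigma> permutes {1..n}}"

definition fp :: "nat \<Rightarrow> (nat \<Rightarrow> nat) \<Rightarrow> nat" where
  "fp n \<sigma> = card {i \<in> {1..n}. \<sigma> i = i}"

definition contains :: "nat \<Rightarrow> (nat \<Rightarrow> nat) \<Rightarrow> nat \<Rightarrow> (nat \<Rightarrow> nat) \<Rightarrow> bool" where
  "contains n \<sigma> m \<tau> \<longleftrightarrow>
     (\<exists>ix :: nat \<Rightarrow> nat. strict_mono_on {1..m} ix \<and> ix ` {1..m} \<subseteq> {1..n} \<and>
        (\<forall>j\<in>{1..m}. \<forall>k\<in>{1..m}. \<sigma> (ix j) < \<sigma> (ix k) \<longleftrightarrow> \<tau> j < \<tau> k))"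

definition avoiders :: "nat \<Rightarrow> nat \<Rightarrow> (nat \<Rightarrow> nat) \<Rightarrow> (nat \<Rightarrow> nat) set" where
  "avoiders n m \<tau> = {\<sigma> \<in> Sn n. \<not> contains n \<sigma> m \<tau>}"

definition pat123 :: "nat \<Rightarrow> nat" where
  "pat123 = id"

definition Zn :: "real \<Rightarrow> nat \<Rightarrow> real" where
  "Zn q n = (\<Sum>\<sigma>\<in>avoiders n 3 pat123. q ^ fp n \<sigma>)"

definition Pq123 :: "real \<Rightarrow> nat \<Rightarrow> (nat \<Rightarrow> nat) pmf" where
  "Pq123 q n = embed_pmf (\<lambda>\<sigma>. if \<sigma> \<in> avoiders n 3 pat123 then q ^ fp n \<sigma> / Zn q n else 0)"

end

theory Submission
  imports Defs
begin

text \<open>A 123-avoiding permutation is the union of two decreasing sequences, its left-to-right minima and the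
  remaining points, so it has at most one fixed point of each kind. It is determined by the positions and
  values of its left-to-right minima, which interleave to a Dyck path of semilength \<open>n\<close>. In this encoding
  the permutations with a fixed left-to-right minimum are counted by pairs of nonnegative walks with \<open>n - 1\<close>
  steps and a common end point, that is by the Catalan number \<open>C\<^sub>n\<^sub>-\<^sub>1 \<sim> C\<^sub>n / 4\<close>; reverse-complement gives the
  same for the other kind up to a negligible error. It remains to see that \<open>C\<^sub>n / 16\<close> permutations,
  asymptotically, have two fixed points, because then \<open>9 : 6 q : q\<^sup>2\<close> are the weights of 0, 1 and 2 fixed points.

  With \<open>N = n - 2\<close>, the permutations with two fixed points correspond to Dyck paths of semilength \<open>N\<close> with
  a marked \<open>b\<close> such that the \<open>2 b\<close> middle steps contain as many down-steps as the height at which they start.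
  As \<open>b\<close> grows, the difference of these two numbers is a monotone walk with increments 0, 1 and 2. It leaves
  the negative numbers exactly once if the path has positive height in the middle, and summing over all paths
  expresses \<open>C\<^sub>N\<close> through the numbers \<open>v\<^sub>N\<close> and
  \<open>v\<^sub>N\<^sub>-\<^sub>1\<close> of marked paths and a remainder. Hence asymptotically sharp upper bounds for \<open>v\<^sub>N\<close> and the
  remainder suffice for \<open>v\<^sub>N \<sim> C\<^sub>N\<close>, and these follow from termwise comparison with
  \<open>C\<^sub>N = \<Sum>h. w\<^sub>N(h)\<^sup>2\<close>, where \<open>w\<^sub>N(h)\<close> counts the nonnegative walks from 0 to \<open>h\<close>.\<close>

text \<open>With v_N the number of marked paths and r_N the remainder, the identity reads 2 C_N =
  v_N + 2 v_(N-1) + w_N(0)^2 + r_N. As C_(N-1) / C_N tends to 1/4, limsup v_N / C_N \<le> 1 and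
  limsup r_N / C_N \<le> 1/2 yield liminf v_N / C_N \<ge> 2 - 2/4 - 1/2 = 1. These constants leave
  no slack. The detour avoids a local limit theorem that is uniform in the height: one-sided
  termwise inequalities are enough.

  The constants 1 and 1/2 are parity effects. For each b the products of walks, multiplied by 4^b,
  have a common bound of the size of w_N(h)^2 with h close to b. Since w_N(h) vanishes unless h has
  the parity of N, while b runs over all integers, these bounds add up to about 2 C_N. The parity of
  N also selects every second coefficient in a row of Pascal's triangle, which is half of the row
  sum; this turns 2 C_N into C_N for v_N, and into C_N / 2 for r_N, whose weights carry another
  factor 1/2.\<close>

fun walks :: "nat \<Rightarrow> int \<Rightarrow> nat" where
  "walks 0 h = of_bool (h = 0)"
| "walks (Suc m) h = (if h < 0 then 0 else walks m (h - 1) + walks m (h + 1))"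

lemma walks_zero: "h < 0 \<or> int m < h \<or> odd (int m - h) \<Longrightarrow> walks m h = 0"
proof (induction m arbitrary: h)
  case (Suc m)
  then show ?case
  proof (cases "h < 0")
    case False
    then have "walks m (h - 1) = 0" "walks m (h + 1) = 0"
      using Suc.prems by (auto intro!: Suc.IH)
    then show ?thesis by simp
  qed simp
qed auto

text \<open>Here \<open>x\<close> and \<open>y\<close> are the numbers of left-to-right minima strictly between the two fixed points, by
  value and by position; \<open>b\<close> is the number of integers between the fixed points.\<close>

definition two_fixed :: "nat \<Rightarrow> nat" where
  "two_fixed N = (\<Sum>b\<le>N. \<Sum>x\<le>b. \<Sum>y\<le>b. (b choose x) * (b choose y) *
     walks (N - b) (int b + int x - int y) * walks (N - b) (int b - int x + int y))"

section \<open>Left-to-right minima of 123-avoiding permutations\<close>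

lemma avoiders_123_iff:
  "\<sigma> \<in> avoiders n 3 pat123 \<longleftrightarrow> \<sigma> permutes {1..n} \<and>
     (\<forall>i\<in>{1..n}. \<forall>j\<in>{1..n}. \<forall>k\<in>{1..n}. i < j \<longrightarrow> j < k \<longrightarrow> \<sigma> i < \<sigma> j \<longrightarrow> \<not> \<sigma> j < \<sigma> k)"
proof -
  have three: "{1..3::nat} = {1,2,3}" by auto
  have "contains n \<sigma> 3 pat123 \<longleftrightarrow>
     (\<exists>i\<in>{1..n}. \<exists>j\<in>{1..n}. \<exists>k\<in>{1..n}. i < j \<and> j < k \<and> \<sigma> i < \<sigma> j \<and> \<sigma> j < \<sigma> k)"
    (is "_ \<longleftrightarrow> ?R")
  proof
    assume "contains n \<sigma> 3 pat123"
    then obtain ix where ix: "strict_mono_on {1..3::nat} ix" "ix ` {1..3::nat} \<subseteq> {1..n}"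
      "\<forall>j\<in>{1..3::nat}. \<forall>k\<in>{1..3}. \<sigma> (ix j) < \<sigma> (ix k) \<longleftrightarrow> j < k"
      by (auto simp: contains_def pat123_def)
    have "ix 1 < ix 2" "ix 2 < ix 3"
      using ix(1) by (auto simp: strict_mono_on_def)
    moreover have "ix 1 \<in> {1..n}" "ix 2 \<in> {1..n}" "ix 3 \<in> {1..n}"
      using ix(2) unfolding three by simp_all
    moreover have "\<sigma> (ix 1) < \<sigma> (ix 2)" "\<sigma> (ix 2) < \<sigma> (ix 3)"
      using ix(3) unfolding three by simp_all
    ultimately show ?R by blast
  next
    assume ?R
    then obtain i j k where *: "i \<in> {1..n}" "j \<in> {1..n}" "k \<in> {1..n}" "i < j" "j < k"
      "\<sigma> i < \<sigma> j" "\<sigma> j < \<sigma> k" by blast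
    show "contains n \<sigma> 3 pat123" unfolding contains_def
      by (rule exI[of _ "\<lambda>t. if t = 1 then i else if t = 2 then j else k"])
         (use * in \<open>unfold three, auto simp: monotone_on_def pat123_def\<close>)
  qed
  then show ?thesis by (auto simp: avoiders_def Sn_def)
qed

section \<open>Ranks in decreasing sequences\<close>

lemma strict_antimono_on_rank:
  fixes f :: "'a::linorder \<Rightarrow> 'b::linorder"
  assumes "strict_antimono_on X f" "x \<in> X"
  shows "card {y \<in> X. y \<le> x} = card {v \<in> f ` X. f x \<le> v}"
proof -
  have less: "f v < f u \<longleftrightarrow> u < v" if "u \<in> X" "v \<in> X" for u v
    using monotone_onD[OF assms(1)] that by (metis less_asym' neqE)
  have "{v \<in> f ` X. f x \<le> v} = f ` {y \<in> X. y \<le> x}"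
    using less assms(2) by (fastforce simp: not_less[symmetric])
  moreover have "inj_on f {y \<in> X. y \<le> x}"
    using less by (auto simp: inj_on_def) (metis less_irrefl neqE)
  ultimately show ?thesis by (simp add: card_image)
qed

lemma upper_rank_inj:
  fixes u v :: "'a::linorder"
  assumes "finite Y" "u \<in> Y" "v \<in> Y" "card {y \<in> Y. u \<le> y} = card {y \<in> Y. v \<le> y}"
  shows "u = v"
proof -
  have "card {y \<in> Y. v \<le> y} < card {y \<in> Y. u \<le> y}" if "u < v" "u \<in> Y" for u v
  proof (rule psubset_card_mono)
    have "u \<in> {y \<in> Y. u \<le> y}" "u \<notin> {y \<in> Y. v \<le> y}" using that by auto
    moreover have "{y \<in> Y. v \<le> y} \<subseteq> {y \<in> Y. u \<le> y}" using that by auto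
    ultimately show "{y \<in> Y. v \<le> y} \<subset> {y \<in> Y. u \<le> y}" by blast
  qed (use assms(1) in auto)
  from this[of u v] this[of v u] show ?thesis
    using assms by (cases u v rule: linorder_cases) auto
qed

lemma strict_antimono_on_unique:
  fixes f g :: "'a::linorder \<Rightarrow> 'b::linorder"
  assumes "strict_antimono_on X f" "strict_antimono_on X g" "f ` X = g ` X" "finite X" "x \<in> X"
  shows "f x = g x"
proof (rule upper_rank_inj[of "f ` X"])
  show "card {y \<in> f ` X. f x \<le> y} = card {y \<in> f ` X. g x \<le> y}"
    using strict_antimono_on_rank[OF assms(1,5)] strict_antimono_on_rank[OF assms(2,5)] assms(3)
    by simp
qed (use assms in auto)

text \<open>The right-hand side mentions only the domain and the image of \<open>f\<close>, not its
  values. Fixed points can therefore be read off the pair of sets that encodes a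
  permutation.\<close>

lemma strict_antimono_on_fixed_iff:
  fixes f :: "'a::linorder \<Rightarrow> 'a"
  assumes "strict_antimono_on X f" "finite X" "x \<in> X"
  shows "f x = x \<longleftrightarrow> x \<in> f ` X \<and> card {y \<in> X. y \<le> x} = card {v \<in> f ` X. x \<le> v}"
proof (intro iffI conjI)
  assume *: "f x = x"
  then show "x \<in> f ` X" using assms(3) by force
  show "card {y \<in> X. y \<le> x} = card {v \<in> f ` X. x \<le> v}"
    using strict_antimono_on_rank[OF assms(1,3)] * by simp
next
  assume *: "x \<in> f ` X \<and> card {y \<in> X. y \<le> x} = card {v \<in> f ` X. x \<le> v}"
  show "f x = x"
    by (rule upper_rank_inj[of "f ` X"])
       (use * assms strict_antimono_on_rank[OF assms(1,3)] in auto)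
qed

text \<open>The largest point receives the smallest value, and induction matches the rest.\<close>

lemma strict_antimono_on_exists:
  fixes X :: "'a::linorder set" and Y :: "'b::linorder set"
  assumes "finite X" "finite Y" "card X = card Y"
  shows "\<exists>f. strict_antimono_on X f \<and> f ` X = Y"
  using assms
proof (induction X arbitrary: Y rule: finite_linorder_max_induct)
  case empty
  then show ?case by (auto simp: monotone_on_def)
next
  case (insert b A)
  then have "Y \<noteq> {}" by auto
  define m where "m = Min Y"
  have m: "m \<in> Y" "\<And>y. y \<in> Y \<Longrightarrow> m \<le> y"
    using insert.prems \<open>Y \<noteq> {}\<close> by (auto simp: m_def)
  have "b \<notin> A" using insert.hyps by auto
  then have "card A = card (Y - {m})" "finite (Y - {m})"
    using insert m by auto
  from insert.IH[OF this(2,1)] obtain f where f: "strict_antimono_on A f" "f ` A = Y - {m}"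
    by blast
  have "strict_antimono_on (insert b A) (f(b := m))"
  proof (rule monotone_onI)
    fix x y assume xy: "x \<in> insert b A" "y \<in> insert b A" "x < y"
    have "x \<noteq> b" using xy insert.hyps by auto
    then have "x \<in> A" using xy by auto
    then have "f x \<in> Y - {m}" using f by auto
    then have "m < f x" using m(2)[of "f x"] by (auto simp: less_le)
    then show "(f(b := m)) x > (f(b := m)) y"
      using xy \<open>x \<noteq> b\<close> monotone_onD[OF f(1)] \<open>x \<in> A\<close> by auto
  qed
  moreover have "f(b := m) ` insert b A = Y"
    using f(2) m(1) \<open>b \<notin> A\<close> by (auto simp: image_iff) 
  ultimately show ?case by blast
qed

section \<open>Positions and values of the left-to-right minima\<close>

definition lrmin :: "nat \<Rightarrow> (nat \<Rightarrow> nat) \<Rightarrow> nat set" where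
  "lrmin n \<sigma> = {i \<in> {1..n}. \<forall>k\<in>{1..<i}. \<sigma> i < \<sigma> k}"

text \<open>The condition for \<open>t\<close> says that, when the first \<open>t\<close> positions are filled, the current minimum is small
  enough to leave \<open>t\<close> values that are not below it.\<close>

definition minpairs :: "nat \<Rightarrow> (nat set \<times> nat set) set" where
  "minpairs n = {(P, V). P \<subseteq> {1..n} \<and> V \<subseteq> {1..n} \<and> card P = card V \<and>
     (\<forall>t\<in>{1..n}. card {v \<in> V. n + 2 \<le> v + t} < card {p \<in> P. p \<le> t})}"

lemma lrmin_subset: "lrmin n \<sigma> \<subseteq> {1..n}"
  by (auto simp: lrmin_def)

lemma lrmin_antimono: "strict_antimono_on (lrmin n \<sigma>) \<sigma>"
  by (auto simp: lrmin_def monotone_on_def)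

lemma avoiders_123_not_lrmin:
  assumes "\<sigma> \<in> avoiders n 3 pat123" "j \<in> {1..n} - lrmin n \<sigma>"
  obtains k where "k \<in> {1..<j}" "\<sigma> k < \<sigma> j"
proof -
  have perm: "\<sigma> permutes {1..n}" using assms(1) avoiders_123_iff by blast
  obtain k where k: "k \<in> {1..<j}" "\<not> \<sigma> j < \<sigma> k"
    using assms(2) by (auto simp: lrmin_def)
  moreover have "\<sigma> k \<noteq> \<sigma> j"
    using k permutes_inj[OF perm] by (auto simp: inj_def)
  ultimately show ?thesis using that by force
qed

text \<open>A point that is not a minimum has a smaller entry before it, so a larger entry after it
  would complete a 123.\<close>

lemma avoiders_123_rest_antimono:
  assumes "\<sigma> \<in> avoiders n 3 pat123"
  shows "strict_antimono_on ({1..n} - lrmin n \<sigma>) \<sigma>"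
proof (rule monotone_onI)
  fix i j assume ij: "i \<in> {1..n} - lrmin n \<sigma>" "j \<in> {1..n} - lrmin n \<sigma>" "i < j"
  obtain k where k: "k \<in> {1..<i}" "\<sigma> k < \<sigma> i"
    using avoiders_123_not_lrmin[OF assms ij(1)] .
  have perm: "\<sigma> permutes {1..n}" using assms avoiders_123_iff by blast
  have "\<sigma> i \<noteq> \<sigma> j"
    using ij permutes_inj[OF perm] by (auto simp: inj_def)
  moreover have "\<not> \<sigma> i < \<sigma> j"
  proof -
    have "k \<in> {1..n}" "k < i" "i \<in> {1..n}" "j \<in> {1..n}" using k(1) ij by auto
    then show ?thesis using assms k(2) ij(3) unfolding avoiders_123_iff by blast
  qed
  ultimately show "\<sigma> i > \<sigma> j" by simp
qed

lemma image_lrmin_compl: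
  assumes "\<sigma> permutes {1..n}" "P \<subseteq> {1..n}"
  shows "\<sigma> ` ({1..n} - P) = {1..n} - \<sigma> ` P"
  using permutes_image[OF assms(1)] permutes_inj[OF assms(1)] 
  by (simp add: image_set_diff)

text \<open>Let \<open>m\<close> be where the minimum over the first \<open>t\<close> positions is
  attained; it is a left-to-right minimum. The \<open>t\<close> values seen so far are at least
  \<open>\<sigma> m\<close>, so \<open>\<sigma> m \<le> n + 1 - t\<close>. Minima with values from
  \<open>n + 2 - t\<close> upwards are larger and hence lie before \<open>m\<close>; as
  \<open>m\<close> is not one of them, the inequality is strict.\<close>

lemma lrmin_minpairs:
  assumes "\<sigma> permutes {1..n}"
  shows "(lrmin n \<sigma>, \<sigma> ` lrmin n \<sigma>) \<in> minpairs n"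
proof -
  let ?P = "lrmin n \<sigma>"
  have inj: "inj_on \<sigma> A" for A
    using permutes_inj[OF assms] by (rule inj_on_subset) auto
  have im: "\<sigma> ` {1..n} = {1..n}" using permutes_image[OF assms] .
  have "card {v \<in> \<sigma> ` ?P. n + 2 \<le> v + t} < card {p \<in> ?P. p \<le> t}" if t: "t \<in> {1..n}" for t
  proof -
    obtain m where m: "m \<in> {1..t}" "\<And>k. k \<in> {1..t} \<Longrightarrow> \<sigma> m \<le> \<sigma> k"
      using ex_is_arg_min_if_finite[of "{1..t}" \<sigma>] t by (auto simp: is_arg_min_linorder)
    have mP: "m \<in> ?P"
    proof -
      have "\<sigma> m < \<sigma> k" if "k \<in> {1..<m}" for k
      proof -
        have "\<sigma> m \<noteq> \<sigma> k" using inj_onD[OF inj[of UNIV], of m k] that by auto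
        then show ?thesis using m(2)[of k] that m(1) by force
      qed
      then show ?thesis using m(1) t by (auto simp: lrmin_def)
    qed
    have "\<sigma> ` {1..t} \<subseteq> {\<sigma> m..n}"
    proof
      fix v assume "v \<in> \<sigma> ` {1..t}"
      then obtain k where k: "k \<in> {1..t}" "v = \<sigma> k" by auto
      have "v \<in> {1..n}" using k t im by force
      then show "v \<in> {\<sigma> m..n}" using k m by auto
    qed
    from card_mono[OF _ this] have "t \<le> n + 1 - \<sigma> m"
      by (simp add: card_image[OF inj])
    then have sm: "\<sigma> m + t \<le> n + 1" using t by auto
    have "{v \<in> \<sigma> ` ?P. n + 2 \<le> v + t} \<subseteq> \<sigma> ` ({p \<in> ?P. p \<le> t} - {m})"
    proof safe
      fix q assume q: "q \<in> ?P" "n + 2 \<le> \<sigma> q + t"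
      have "\<sigma> m < \<sigma> q" using q sm by linarith
      then have "\<not> m < q" using q(1) m(1) by (auto simp: lrmin_def dest!: bspec[of _ _ m])
      moreover have "q \<noteq> m" using \<open>\<sigma> m < \<sigma> q\<close> by auto
      ultimately have "q < m" by simp
      then show "\<sigma> q \<in> \<sigma> ` ({p \<in> ?P. p \<le> t} - {m})" using q m(1) by auto
    qed
    then have "card {v \<in> \<sigma> ` ?P. n + 2 \<le> v + t} \<le> card (\<sigma> ` ({p \<in> ?P. p \<le> t} - {m}))"
      by (intro card_mono) auto
    also have "\<dots> = card ({p \<in> ?P. p \<le> t} - {m})" by (rule card_image[OF inj])
    also have "\<dots> < card {p \<in> ?P. p \<le> t}"
      using mP m(1) by (intro psubset_card_mono) auto
    finally show ?thesis .
  qed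
  moreover have "\<sigma> ` ?P \<subseteq> {1..n}" using im lrmin_subset by blast
  ultimately show ?thesis
    using lrmin_subset[of n \<sigma>] card_image[OF inj, of ?P] by (auto simp: minpairs_def)
qed

lemma avoiders_123_eqI:
  assumes "\<sigma> \<in> avoiders n 3 pat123" "\<tau> \<in> avoiders n 3 pat123"
    and P: "lrmin n \<sigma> = lrmin n \<tau>" and V: "\<sigma> ` lrmin n \<sigma> = \<tau> ` lrmin n \<tau>"
  shows "\<sigma> = \<tau>"
proof
  fix x
  have p: "\<sigma> permutes {1..n}" "\<tau> permutes {1..n}" using assms avoiders_123_iff by auto
  have fin: "finite (lrmin n \<tau>)" "finite ({1..n} - lrmin n \<tau>)"
    by (auto intro: finite_subset[OF lrmin_subset])
  consider "x \<in> lrmin n \<tau>" | "x \<in> {1..n} - lrmin n \<tau>" | "x \<notin> {1..n}" by blast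
  then show "\<sigma> x = \<tau> x"
  proof cases
    case 1
    then show ?thesis
      using strict_antimono_on_unique[OF _ lrmin_antimono _ fin(1)] lrmin_antimono[of n \<sigma>] P V by metis
  next
    case 2
    have "\<sigma> ` ({1..n} - lrmin n \<tau>) = \<tau> ` ({1..n} - lrmin n \<tau>)"
      using image_lrmin_compl[OF p(1) lrmin_subset] image_lrmin_compl[OF p(2) lrmin_subset] P V
      by metis
    then show ?thesis
      using strict_antimono_on_unique[OF _ _ _ fin(2) 2] avoiders_123_rest_antimono assms P by metis
  next
    case 3
    then show ?thesis using p by (auto simp: permutes_def)
  qed
qed

text \<open>The only candidate joins the decreasing bijection from \<open>P\<close> to
  \<open>V\<close> with the one between the complements. The condition on \<open>(P, V)\<close>
  enters in showing that its left-to-right minima are exactly \<open>P\<close>.\<close>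

lemma minpairs_surj:
  assumes "(P, V) \<in> minpairs n"
  obtains \<sigma> where "\<sigma> \<in> avoiders n 3 pat123" "lrmin n \<sigma> = P" "\<sigma> ` P = V"
proof -
  have PV: "P \<subseteq> {1..n}" "V \<subseteq> {1..n}" "card P = card V"
    and dom: "\<And>t. t \<in> {1..n} \<Longrightarrow> card {v \<in> V. n + 2 \<le> v + t} < card {p \<in> P. p \<le> t}"
    using assms by (auto simp: minpairs_def)
  have fin: "finite P" "finite V" using PV finite_subset by blast+
  let ?P' = "{1..n} - P" and ?V' = "{1..n} - V"
  have "card ?P' = card ?V'" using PV fin by (simp add: card_Diff_subset)
  obtain f where f: "strict_antimono_on P f" "f ` P = V"
    using strict_antimono_on_exists[OF fin PV(3)] by blast
  obtain g where g: "strict_antimono_on ?P' g" "g ` ?P' = ?V'"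
    using strict_antimono_on_exists[OF _ _ \<open>card ?P' = card ?V'\<close>] by blast
  define \<sigma> where "\<sigma> x = (if x \<in> P then f x else if x \<in> {1..n} then g x else x)" for x
  have anti: "strict_antimono_on P \<sigma>" "strict_antimono_on ?P' \<sigma>"
    using f(1) g(1) by (auto simp: \<sigma>_def monotone_on_def)
  have imP: "\<sigma> ` P = V" using f(2) by (simp add: \<sigma>_def)
  have imP': "\<sigma> ` ?P' = ?V'" using g(2) by (auto simp: \<sigma>_def image_iff)
  have "\<sigma> ` {1..n} = {1..n}"
    using imP imP' PV by (metis Un_Diff_cancel2 image_Un sup.absorb1)
  then have perm: "\<sigma> permutes {1..n}"
    by (intro bij_imp_permutes) (auto simp: \<sigma>_def bij_betw_def eq_card_imp_inj_on dest: PV(1)[THEN subsetD])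
  have inj: "inj_on \<sigma> A" for A
    using permutes_inj[OF perm] by (rule inj_on_subset) auto
  \<comment> \<open>Only \<open>card {v \<in> V. \<sigma> q < v}\<close> values in \<open>V\<close>
    exceed \<open>\<sigma> q\<close>, so the inequality forces a point of \<open>P\<close> with a
    smaller value before \<open>q\<close>. Hence \<open>q\<close> is not a minimum, and it cannot
    spoil a later minimum in \<open>P\<close> either.\<close>
  have key: "card {v \<in> V. \<sigma> q < v} < card {p \<in> P. p \<le> q}" if q: "q \<in> ?P'" for q
  proof (rule ccontr)
    assume "\<not> ?thesis"
    then have le: "card {p \<in> P. p \<le> q} \<le> card {v \<in> V. \<sigma> q < v}" by simp
    define r where "r = card {y \<in> ?P'. y \<le> q}"
    have sq: "\<sigma> q \<in> ?V'" using imP' q by blast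
    have r: "r = card {v \<in> ?V'. \<sigma> q \<le> v}"
      using strict_antimono_on_rank[OF anti(2) q] imP' by (simp add: r_def)
    \<comment> \<open>\<open>t\<close> counts the values from \<open>\<sigma> q\<close> upwards. If
      the claim failed, then \<open>q \<le> t\<close>, and the condition at \<open>t\<close> would
      find more than \<open>t\<close> positions among the first \<open>t\<close>.\<close>
    define t where "t = n + 1 - \<sigma> q"
    have t: "t \<in> {1..n}" "\<sigma> q + t = n + 1" using sq by (auto simp: t_def)
    have split: "card {p \<in> P. p \<le> m} + card {y \<in> ?P'. y \<le> m} = m" if "m \<le> n" for m
    proof -
      have "{1..m} = {p \<in> P. p \<le> m} \<union> {y \<in> ?P'. y \<le> m}" using PV(1) that by auto
      then have "card {1..m} = card {p \<in> P. p \<le> m} + card {y \<in> ?P'. y \<le> m}"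
        using fin by (simp add: card_Un_disjoint disjoint_iff)
      then show ?thesis by simp
    qed
    have "{\<sigma> q..n} = {v \<in> V. \<sigma> q < v} \<union> {v \<in> ?V'. \<sigma> q \<le> v}"
    proof (intro equalityI subsetI)
      fix v assume "v \<in> {\<sigma> q..n}"
      then show "v \<in> {v \<in> V. \<sigma> q < v} \<union> {v \<in> ?V'. \<sigma> q \<le> v}"
        using sq by (cases "v = \<sigma> q") auto
    next
      fix v assume "v \<in> {v \<in> V. \<sigma> q < v} \<union> {v \<in> ?V'. \<sigma> q \<le> v}"
      then show "v \<in> {\<sigma> q..n}" using PV(2) by auto
    qed
    then have "card {\<sigma> q..n} = card {v \<in> V. \<sigma> q < v} + r"
      using fin unfolding r by (simp add: card_Un_disjoint disjoint_iff)
    then have up: "card {v \<in> V. \<sigma> q < v} + r = t" by (simp add: t_def)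
    have "card {p \<in> P. p \<le> q} + r = q" using split[of q] q by (simp add: r_def)
    then have "q \<le> t" using up le by linarith
    have "{v \<in> V. \<sigma> q < v} = {v \<in> V. n + 2 \<le> v + t}" using t(2) by auto
    then have "card {v \<in> V. \<sigma> q < v} < card {p \<in> P. p \<le> t}" using dom[OF t(1)] by simp
    moreover have "r \<le> card {y \<in> ?P'. y \<le> t}"
      unfolding r_def using \<open>q \<le> t\<close> by (intro card_mono) auto
    ultimately show False using up split[of t] t(1) by auto
  qed
  have "lrmin n \<sigma> = P"
  proof (intro equalityI subsetI)
    fix q assume q: "q \<in> lrmin n \<sigma>"
    show "q \<in> P"
    proof (rule ccontr)
      assume "q \<notin> P"
      with q have q': "q \<in> ?P'" by (auto simp: lrmin_def)
      have "\<sigma> ` {p \<in> P. p \<le> q} \<subseteq> {v \<in> V. \<sigma> q < v}"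
      proof safe
        fix p assume p: "p \<in> P" "p \<le> q"
        show "\<sigma> p \<in> V" using p imP by blast
        have "p \<noteq> q" using p \<open>q \<notin> P\<close> by auto
        then show "\<sigma> q < \<sigma> p" using p q PV(1) by (auto simp: lrmin_def)
      qed
      then have "card (\<sigma> ` {p \<in> P. p \<le> q}) \<le> card {v \<in> V. \<sigma> q < v}"
        using fin by (intro card_mono) auto
      then show False using key[OF q'] by (simp add: card_image[OF inj])
    qed
  next
    fix p assume p: "p \<in> P"
    have "\<sigma> p < \<sigma> k" if k: "k \<in> {1..<p}" for k
    proof (rule ccontr)
      assume *: "\<not> \<sigma> p < \<sigma> k"
      have kn: "k \<in> {1..n}" using k p PV(1) by force
      have "k \<notin> P" using monotone_onD[OF anti(1), of k p] * k p by auto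
      then have k': "k \<in> ?P'" using kn by simp
      have "\<sigma> ` {y \<in> P. y \<le> k} \<subseteq> {v \<in> V. \<sigma> k < v}"
      proof safe
        fix y assume y: "y \<in> P" "y \<le> k"
        show "\<sigma> y \<in> V" using y imP by blast
        have "\<sigma> p < \<sigma> y" using monotone_onD[OF anti(1), of y p] y p k by auto
        then show "\<sigma> k < \<sigma> y" using * by simp
      qed
      then have "card (\<sigma> ` {y \<in> P. y \<le> k}) \<le> card {v \<in> V. \<sigma> k < v}"
        using fin by (intro card_mono) auto
      then show False using key[OF k'] by (simp add: card_image[OF inj])
    qed
    then show "p \<in> lrmin n \<sigma>" using p PV(1) by (auto simp: lrmin_def)
  qed
  moreover have "\<sigma> \<in> avoiders n 3 pat123"
    unfolding avoiders_123_iff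
  proof (intro conjI ballI impI perm)
    fix i j k assume *: "i \<in> {1..n}" "j \<in> {1..n}" "k \<in> {1..n}" "i < j" "j < k" "\<sigma> i < \<sigma> j"
    show "\<not> \<sigma> j < \<sigma> k"
    proof
      assume "\<sigma> j < \<sigma> k"
      with * have "\<sigma> i < \<sigma> k" by simp
      \<comment> \<open>Of three points, two belong to the same decreasing class, but here all three
        pairs ascend.\<close>
      have same: "\<not> (x \<in> P \<longleftrightarrow> y \<in> P)" if "x \<in> {1..n}" "y \<in> {1..n}" "x < y" "\<sigma> x < \<sigma> y" for x y
        using that monotone_onD[OF anti(1), of x y] monotone_onD[OF anti(2), of x y] by auto
      show False
        using same[of i j] same[of j k] same[of i k] * \<open>\<sigma> j < \<sigma> k\<close> \<open>\<sigma> i < \<sigma> k\<close> by auto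
    qed
  qed
  ultimately show ?thesis using that imP by blast
qed

section \<open>Encoding by ballot sequences\<close>

text \<open>Dyck paths of semilength \<open>n\<close> in disguise: if the entries of
  \<open>X\<close> and the negated entries of \<open>Y\<close> are taken alternately as steps, the
  condition at \<open>t\<close> says that the height after \<open>2 * t + 1\<close> steps is
  positive.\<close>

definition ballot_pairs :: "nat \<Rightarrow> (bool list \<times> bool list) set" where
  "ballot_pairs n = {(X, Y). length X = n \<and> length Y = n \<and> count_list X True = count_list Y True \<and>
     (\<forall>t<n. count_list (take t Y) True < count_list (take (Suc t) X) True)}"

text \<open>Positions are read upwards and values downwards, and list index \<open>i\<close> stands for position \<open>i + 1\<close> and for
  value \<open>n - i\<close>.\<close>

definition code123 :: "nat \<Rightarrow> (nat \<Rightarrow> nat) \<Rightarrow> bool list \<times> bool list" where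
  "code123 n \<sigma> = (map (\<lambda>i. Suc i \<in> lrmin n \<sigma>) [0..<n], map (\<lambda>i. n - i \<in> \<sigma> ` lrmin n \<sigma>) [0..<n])"

text \<open>A point of a decreasing sequence lies on the diagonal iff its position and its value have the same rank;
  \<open>c\<close> selects the sequence (\<open>True\<close> for the left-to-right minima) and \<open>a + 1\<close> is the fixed point.\<close>

definition fixat :: "bool \<Rightarrow> bool list \<times> bool list \<Rightarrow> nat \<Rightarrow> bool" where
  "fixat c XY a = (case XY of (X, Y) \<Rightarrow> X ! a = c \<and> Y ! (length X - 1 - a) = c \<and>
     count_list (take a X) c = count_list (take (length X - 1 - a) Y) c)"

lemma count_list_take_map_upt:
  "t \<le> n \<Longrightarrow> count_list (take t (map f [0..<n])) b = card {i. i < t \<and> f i = b}"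
proof (induction t)
  case (Suc t)
  have *: "{i. i < Suc t \<and> f i = b} = {i. i < t \<and> f i = b} \<union> (if f t = b then {t} else {})"
    by (auto simp: less_Suc_eq)
  show ?case
    using Suc by (subst *) (auto simp: take_Suc_conv_app_nth)
qed auto

lemma count_list_take_positions:
  assumes "P \<subseteq> {1..n}" "t \<le> n"
  shows "count_list (take t (map (\<lambda>i. Suc i \<in> P) [0..<n])) c =
         card {p \<in> (if c then P else {1..n} - P). p \<le> t}"
proof -
  have "{p \<in> (if c then P else {1..n} - P). p \<le> t} = Suc ` {i. i < t \<and> (Suc i \<in> P) = c}"
    (is "?L = ?R")
  proof
    show "?R \<subseteq> ?L" using assms by auto
    show "?L \<subseteq> ?R"
    proof
      fix p assume "p \<in> ?L"
      then have "p - 1 < t" "(Suc (p - 1) \<in> P) = c" "p = Suc (p - 1)"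
        using assms by (auto split: if_splits)
      then show "p \<in> ?R" by blast
    qed
  qed
  then show ?thesis using assms(2) by (simp add: count_list_take_map_upt card_image)
qed

lemma count_list_take_values:
  assumes "V \<subseteq> {1..n}" "t \<le> n"
  shows "count_list (take t (map (\<lambda>i. n - i \<in> V) [0..<n])) c =
         card {v \<in> (if c then V else {1..n} - V). n + 1 \<le> v + t}"
proof -
  have "{v \<in> (if c then V else {1..n} - V). n + 1 \<le> v + t} = (\<lambda>i. n - i) ` {i. i < t \<and> (n - i \<in> V) = c}"
    (is "?L = ?R")
  proof
    show "?R \<subseteq> ?L" using assms by auto
    show "?L \<subseteq> ?R"
    proof
      fix v assume "v \<in> ?L"
      then have "n - v < t" "(n - (n - v) \<in> V) = c" "v = n - (n - v)"
        using assms by (auto split: if_splits)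
      then show "v \<in> ?R" by blast
    qed
  qed
  moreover have "inj_on (\<lambda>i. n - i) {i. i < t \<and> (n - i \<in> V) = c}"
    using assms(2) by (auto simp: inj_on_def)
  ultimately show ?thesis using assms(2) by (simp add: count_list_take_map_upt card_image)
qed

lemma lrmin_image_subset:
  assumes "\<sigma> permutes {1..n}" shows "\<sigma> ` lrmin n \<sigma> \<subseteq> {1..n}"
  using image_mono[OF lrmin_subset[of n \<sigma>], of \<sigma>] permutes_image[OF assms] by simp

lemma minpairs_iff_ballot:
  assumes "P \<subseteq> {1..n}" "V \<subseteq> {1..n}"
  shows "(P, V) \<in> minpairs n \<longleftrightarrow>
    (map (\<lambda>i. Suc i \<in> P) [0..<n], map (\<lambda>i. n - i \<in> V) [0..<n]) \<in> ballot_pairs n"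
proof -
  let ?X = "map (\<lambda>i. Suc i \<in> P) [0..<n]" and ?Y = "map (\<lambda>i. n - i \<in> V) [0..<n]"
  have "{p \<in> P. p \<le> n} = P" "{v \<in> V. n + 1 \<le> v + n} = V" using assms by auto
  then have tot: "count_list ?X True = card P" "count_list ?Y True = card V"
    using count_list_take_positions[OF assms(1), of n True] count_list_take_values[OF assms(2), of n True]
    by simp_all
  have "(\<forall>t\<in>{1..n}. card {v \<in> V. n + 2 \<le> v + t} < card {p \<in> P. p \<le> t}) \<longleftrightarrow>
        (\<forall>t<n. card {v \<in> V. n + 2 \<le> v + Suc t} < card {p \<in> P. p \<le> Suc t})"
    (is "?A \<longleftrightarrow> ?B")
  proof
    assume B: ?B
    show ?A
    proof
      fix t assume "t \<in> {1..n}"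
      then have "Suc (t - 1) = t" "t - 1 < n" by auto
      then show "card {v \<in> V. n + 2 \<le> v + t} < card {p \<in> P. p \<le> t}"
        using B by metis
    qed
  next
    assume A: ?A
    show ?B
    proof (intro allI impI)
      fix t assume "t < n"
      then have "Suc t \<in> {1..n}" by auto
      then show "card {v \<in> V. n + 2 \<le> v + Suc t} < card {p \<in> P. p \<le> Suc t}" using A by blast
    qed
  qed
  \<comment> \<open>In \<open>ballot_pairs\<close> the values lag one index behind the positions;
    this accounts for \<open>n + 2\<close> where \<open>t\<close> values would give
    \<open>n + 1\<close>.\<close>
  moreover have "count_list (take t ?Y) True = card {v \<in> V. n + 2 \<le> v + Suc t}"
    "count_list (take (Suc t) ?X) True = card {p \<in> P. p \<le> Suc t}" if "t < n" for t
    using count_list_take_positions[OF assms(1), of "Suc t" True]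
      count_list_take_values[OF assms(2), of t True] that by simp_all
  ultimately show ?thesis
    using tot assms by (auto simp: minpairs_def ballot_pairs_def)
qed

lemma code123_bij: "bij_betw (code123 n) (avoiders n 3 pat123) (ballot_pairs n)"
  unfolding bij_betw_def
proof
  have perm: "\<sigma> permutes {1..n}" if "\<sigma> \<in> avoiders n 3 pat123" for \<sigma>
    using that avoiders_123_iff by blast
  show "inj_on (code123 n) (avoiders n 3 pat123)"
  proof (rule inj_onI)
    fix \<sigma> \<tau> assume st: "\<sigma> \<in> avoiders n 3 pat123" "\<tau> \<in> avoiders n 3 pat123"
      and eq: "code123 n \<sigma> = code123 n \<tau>"
    have P: "Suc i \<in> lrmin n \<sigma> \<longleftrightarrow> Suc i \<in> lrmin n \<tau>"
      and V: "n - i \<in> \<sigma> ` lrmin n \<sigma> \<longleftrightarrow> n - i \<in> \<tau> ` lrmin n \<tau>" if "i < n" for i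
      using eq that by (auto simp: code123_def map_eq_conv)
    have "lrmin n \<sigma> = lrmin n \<tau>"
    proof (rule set_eqI)
      fix x show "x \<in> lrmin n \<sigma> \<longleftrightarrow> x \<in> lrmin n \<tau>"
        using P[of "x - 1"] lrmin_subset[of n \<sigma>] lrmin_subset[of n \<tau>] by (cases "x \<in> {1..n}") auto
    qed
    moreover have "\<sigma> ` lrmin n \<sigma> = \<tau> ` lrmin n \<tau>"
    proof (rule set_eqI)
      fix x show "x \<in> \<sigma> ` lrmin n \<sigma> \<longleftrightarrow> x \<in> \<tau> ` lrmin n \<tau>"
        using V[of "n - x"] lrmin_image_subset[OF perm[OF st(1)]] lrmin_image_subset[OF perm[OF st(2)]]
        by (cases "x \<in> {1..n}") auto
    qed
    ultimately show "\<sigma> = \<tau>" using st avoiders_123_eqI by blast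
  qed
  show "code123 n ` avoiders n 3 pat123 = ballot_pairs n"
  proof (intro equalityI subsetI)
    fix XY assume "XY \<in> code123 n ` avoiders n 3 pat123"
    then obtain \<sigma> where s: "\<sigma> \<in> avoiders n 3 pat123" "XY = code123 n \<sigma>" by blast
    then show "XY \<in> ballot_pairs n"
      using lrmin_minpairs[OF perm[OF s(1)]]
        minpairs_iff_ballot[OF lrmin_subset lrmin_image_subset[OF perm[OF s(1)]]]
      by (simp add: code123_def)
  next
    fix XY assume *: "XY \<in> ballot_pairs n"
    obtain X Y where XY: "XY = (X, Y)" by fastforce
    have len: "length X = n" "length Y = n" using * by (auto simp: XY ballot_pairs_def)
    define P where "P = {p \<in> {1..n}. X ! (p - 1)}"
    define V where "V = {v \<in> {1..n}. Y ! (n - v)}"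
    have sub: "P \<subseteq> {1..n}" "V \<subseteq> {1..n}" by (auto simp: P_def V_def)
    have X: "map (\<lambda>i. Suc i \<in> P) [0..<n] = X"
      by (rule nth_equalityI) (auto simp: len P_def)
    have Y: "map (\<lambda>i. n - i \<in> V) [0..<n] = Y"
      by (rule nth_equalityI) (auto simp: len V_def)
    have "(P, V) \<in> minpairs n" using * minpairs_iff_ballot[OF sub] by (simp add: X Y XY)
    then obtain \<sigma> where "\<sigma> \<in> avoiders n 3 pat123" "lrmin n \<sigma> = P" "\<sigma> ` P = V"
      using minpairs_surj by metis
    then show "XY \<in> code123 n ` avoiders n 3 pat123"
      by (intro image_eqI[of _ _ \<sigma>]) (auto simp: code123_def X Y XY)
  qed
qed

section \<open>Fixed points of the two decreasing sequences\<close>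

definition lrclass :: "nat \<Rightarrow> bool \<Rightarrow> (nat \<Rightarrow> nat) \<Rightarrow> nat set" where
  "lrclass n c \<sigma> = (if c then lrmin n \<sigma> else {1..n} - lrmin n \<sigma>)"

definition fixclass :: "nat \<Rightarrow> bool \<Rightarrow> (nat \<Rightarrow> nat) \<Rightarrow> nat set" where
  "fixclass n c \<sigma> = {i \<in> lrclass n c \<sigma>. \<sigma> i = i}"

lemma lrclass_antimono:
  "\<sigma> \<in> avoiders n 3 pat123 \<Longrightarrow> strict_antimono_on (lrclass n c \<sigma>) \<sigma>"
  using avoiders_123_rest_antimono[of \<sigma> n] by (simp add: lrclass_def lrmin_antimono)

lemma lrclass_subset: "lrclass n c \<sigma> \<subseteq> {1..n}"
  using lrmin_subset[of n \<sigma>] by (auto simp: lrclass_def)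

lemma fixclass_iff_fixat:
  assumes "\<sigma> \<in> avoiders n 3 pat123" "a < n"
  shows "Suc a \<in> fixclass n c \<sigma> \<longleftrightarrow> fixat c (code123 n \<sigma>) a"
proof -
  have perm: "\<sigma> permutes {1..n}" using assms avoiders_123_iff by blast
  let ?P = "lrmin n \<sigma>" and ?V = "\<sigma> ` lrmin n \<sigma>"
  let ?X = "map (\<lambda>i. Suc i \<in> ?P) [0..<n]" and ?Y = "map (\<lambda>i. n - i \<in> ?V) [0..<n]"
  have im: "\<sigma> ` lrclass n c \<sigma> = (if c then ?V else {1..n} - ?V)"
    using image_lrmin_compl[OF perm lrmin_subset] by (simp add: lrclass_def)
  have a1: "Suc a \<in> lrclass n c \<sigma> \<longleftrightarrow> ?X ! a = c"
    using assms(2) by (auto simp: lrclass_def)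
  have a2: "Suc a \<in> \<sigma> ` lrclass n c \<sigma> \<longleftrightarrow> ?Y ! (n - 1 - a) = c"
    unfolding im using assms(2) by (auto simp: Suc_diff_Suc)
  have cX: "count_list (take (Suc a) ?X) c = card {y \<in> lrclass n c \<sigma>. y \<le> Suc a}"
    using count_list_take_positions[OF lrmin_subset[of n \<sigma>], of "Suc a" c] assms(2)
    by (simp add: lrclass_def)
  have cY: "count_list (take (Suc (n - 1 - a)) ?Y) c = card {v \<in> \<sigma> ` lrclass n c \<sigma>. Suc a \<le> v}"
  proof -
    have "n + 1 \<le> v + Suc (n - 1 - a) \<longleftrightarrow> Suc a \<le> v" for v using assms(2) by auto
    then show ?thesis
      using count_list_take_values[OF lrmin_image_subset[OF perm], of "Suc (n - 1 - a)" c] assms(2)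
      by (simp add: im)
  qed
  have lt: "a < length ?X" "n - 1 - a < length ?Y" using assms(2) by auto
  have "Suc a \<in> fixclass n c \<sigma> \<longleftrightarrow> Suc a \<in> lrclass n c \<sigma> \<and> Suc a \<in> \<sigma> ` lrclass n c \<sigma> \<and>
     card {y \<in> lrclass n c \<sigma>. y \<le> Suc a} = card {v \<in> \<sigma> ` lrclass n c \<sigma>. Suc a \<le> v}"
    using strict_antimono_on_fixed_iff[OF lrclass_antimono[OF assms(1)]]
      finite_subset[OF lrclass_subset] by (auto simp: fixclass_def)
  \<comment> \<open>The ranks include the point itself, whereas \<open>fixat\<close> counts strictly
    before it; both ranks drop by one because both entries equal \<open>c\<close>.\<close>
  also have "\<dots> \<longleftrightarrow> fixat c (?X, ?Y) a"
    unfolding a1 a2 cX[symmetric] cY[symmetric] fixat_def take_Suc_conv_app_nth[OF lt(1)]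
      take_Suc_conv_app_nth[OF lt(2)] by (auto simp del: nth_map)
  finally show ?thesis by (simp add: code123_def)
qed

lemma fixclass_unique:
  assumes "\<sigma> \<in> avoiders n 3 pat123" "i \<in> fixclass n c \<sigma>" "j \<in> fixclass n c \<sigma>"
  shows "i = j"
proof -
  have "\<not> x < y" if "x \<in> fixclass n c \<sigma>" "y \<in> fixclass n c \<sigma>" for x y
    using that monotone_onD[OF lrclass_antimono[OF assms(1), of c], of x y]
    by (auto simp: fixclass_def)
  then show ?thesis using assms(2,3) by (meson linorder_neqE_nat)
qed

lemma finite_fixclass: "finite (fixclass n c \<sigma>)"
  by (rule finite_subset[of _ "{1..n}"]) (use lrclass_subset[of n c \<sigma>] in \<open>auto simp: fixclass_def\<close>)

lemma card_fixclass_le: 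
  assumes "\<sigma> \<in> avoiders n 3 pat123" shows "card (fixclass n c \<sigma>) \<le> 1"
  using fixclass_unique[OF assms] card_le_Suc0_iff_eq[OF finite_fixclass] by auto

lemma fp_eq_fixclass: "fp n \<sigma> = card (fixclass n True \<sigma>) + card (fixclass n False \<sigma>)"
proof -
  have "{i \<in> {1..n}. \<sigma> i = i} = fixclass n True \<sigma> \<union> fixclass n False \<sigma>"
    using lrmin_subset[of n \<sigma>] by (auto simp: fixclass_def lrclass_def)
  moreover have "fixclass n True \<sigma> \<inter> fixclass n False \<sigma> = {}"
    by (auto simp: fixclass_def lrclass_def)
  moreover have "finite (fixclass n c \<sigma>)" for c
    by (rule finite_subset[of _ "{1..n}"]) (use lrclass_subset[of n c \<sigma>] in \<open>auto simp: fixclass_def\<close>)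
  ultimately show ?thesis by (simp add: fp_def card_Un_disjoint)
qed

text \<open>If \<open>j\<close> came first, the left-to-right minimum at \<open>i\<close> would need
  \<open>\<sigma> i < \<sigma> j\<close>, that is \<open>i < j\<close>. So in a double sum over both
  fixed points only one order of the indices survives.\<close>

lemma fixclass_order:
  assumes "i \<in> fixclass n True \<sigma>" "j \<in> fixclass n False \<sigma>"
  shows "i < j"
proof (rule ccontr)
  assume "\<not> i < j"
  then have "j < i" using assms by (cases "i = j") (auto simp: fixclass_def lrclass_def)
  moreover have "j \<in> {1..<i}" using calculation assms(2) lrclass_subset[of n False \<sigma>]
    by (auto simp: fixclass_def)
  moreover have "\<forall>k\<in>{1..<i}. \<sigma> i < \<sigma> k" "\<sigma> i = i" "\<sigma> j = j"
    using assms by (auto simp: fixclass_def lrclass_def lrmin_def)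
  ultimately show False by fastforce
qed

lemma finite_avoiders: "finite (avoiders n m \<tau>)"
  by (rule finite_subset[OF _ finite_permutations[of "{1..n}"]]) (auto simp: avoiders_def Sn_def)

lemma fixclass_as_image: "fixclass n c \<sigma> = Suc ` {a. a < n \<and> Suc a \<in> fixclass n c \<sigma>}"
proof (intro equalityI subsetI)
  fix x assume x: "x \<in> fixclass n c \<sigma>"
  then have "x \<in> {1..n}" using lrclass_subset[of n c \<sigma>] by (auto simp: fixclass_def)
  then have "x = Suc (x - 1)" "x - 1 < n" by auto
  then show "x \<in> Suc ` {a. a < n \<and> Suc a \<in> fixclass n c \<sigma>}" using x
    by (metis (mono_tags, lifting) image_eqI mem_Collect_eq)
qed auto

lemma card_fixclass_sum: "card (fixclass n c \<sigma>) = (\<Sum>a<n. of_bool (Suc a \<in> fixclass n c \<sigma>))"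
proof -
  have "card (fixclass n c \<sigma>) = card {a. a < n \<and> Suc a \<in> fixclass n c \<sigma>}"
    by (subst fixclass_as_image) (simp add: card_image)
  also have "{a. a < n \<and> Suc a \<in> fixclass n c \<sigma>} = {..<n} \<inter> {a. Suc a \<in> fixclass n c \<sigma>}" by auto
  finally show ?thesis by (simp add: sum_of_bool_eq)
qed

lemma card_avoiders_ballot:
  "card {\<sigma> \<in> avoiders n 3 pat123. Q (code123 n \<sigma>)} = card {XY \<in> ballot_pairs n. Q XY}"
proof -
  have "code123 n ` {\<sigma> \<in> avoiders n 3 pat123. Q (code123 n \<sigma>)} =
        {XY \<in> code123 n ` avoiders n 3 pat123. Q XY}" by blast
  also have "code123 n ` avoiders n 3 pat123 = ballot_pairs n"
    using code123_bij[of n] by (simp add: bij_betw_def)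
  finally have "code123 n ` {\<sigma> \<in> avoiders n 3 pat123. Q (code123 n \<sigma>)} = {XY \<in> ballot_pairs n. Q XY}" .
  moreover have "inj_on (code123 n) {\<sigma> \<in> avoiders n 3 pat123. Q (code123 n \<sigma>)}"
    using code123_bij[of n] by (auto simp: bij_betw_def intro: inj_on_subset)
  ultimately show ?thesis using card_image by fastforce
qed

lemma sum_of_bool_card:
  "finite A \<Longrightarrow> (\<Sum>x\<in>A. of_bool (Q x)) = card {x \<in> A. Q x}"
  by (simp add: sum_of_bool_eq Int_def)

lemma sum_card_fixclass:
  "(\<Sum>\<sigma>\<in>avoiders n 3 pat123. card (fixclass n c \<sigma>)) =
   (\<Sum>a<n. card {XY \<in> ballot_pairs n. fixat c XY a})"
proof -
  have "(\<Sum>\<sigma>\<in>avoiders n 3 pat123. card (fixclass n c \<sigma>)) =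
        (\<Sum>a<n. \<Sum>\<sigma>\<in>avoiders n 3 pat123. of_bool (Suc a \<in> fixclass n c \<sigma>))"
    unfolding card_fixclass_sum by (rule sum.swap)
  also have "\<dots> = (\<Sum>a<n. \<Sum>\<sigma>\<in>avoiders n 3 pat123. of_bool (fixat c (code123 n \<sigma>) a))"
    by (intro sum.cong refl) (simp add: fixclass_iff_fixat)
  also have "\<dots> = (\<Sum>a<n. card {XY \<in> ballot_pairs n. fixat c XY a})"
    by (simp only: sum_of_bool_card[OF finite_avoiders]
        card_avoiders_ballot[where Q = "\<lambda>XY. fixat c XY _"])
  finally show ?thesis .
qed

lemma sum_card_fixclass_mult:
  "(\<Sum>\<sigma>\<in>avoiders n 3 pat123. card (fixclass n True \<sigma>) * card (fixclass n False \<sigma>)) =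
   (\<Sum>a<n. \<Sum>j\<in>{a<..<n}. card {XY \<in> ballot_pairs n. fixat True XY a \<and> fixat False XY j})"
proof -
  have "card (fixclass n True \<sigma>) * card (fixclass n False \<sigma>) =
      (\<Sum>a<n. \<Sum>j\<in>{a<..<n}. of_bool (fixat True (code123 n \<sigma>) a \<and> fixat False (code123 n \<sigma>) j))"
    if s: "\<sigma> \<in> avoiders n 3 pat123" for \<sigma>
  proof -
    have "card (fixclass n True \<sigma>) * card (fixclass n False \<sigma>) =
      (\<Sum>a<n. \<Sum>j<n. of_bool (Suc a \<in> fixclass n True \<sigma> \<and> Suc j \<in> fixclass n False \<sigma>))"
      unfolding card_fixclass_sum sum_product by (simp add: of_bool_conj)
    also have "\<dots> = (\<Sum>a<n. \<Sum>j\<in>{a<..<n}.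
        of_bool (Suc a \<in> fixclass n True \<sigma> \<and> Suc j \<in> fixclass n False \<sigma>))"
    proof (rule sum.cong[OF refl], rule sum.mono_neutral_right)
      fix a assume "a \<in> {..<n}"
      show "\<forall>j\<in>{..<n} - {a<..<n}.
          of_bool (Suc a \<in> fixclass n True \<sigma> \<and> Suc j \<in> fixclass n False \<sigma>) = 0"
        using fixclass_order[of "Suc a" n \<sigma>] by fastforce
    qed auto
    also have "\<dots> = (\<Sum>a<n. \<Sum>j\<in>{a<..<n}.
        of_bool (fixat True (code123 n \<sigma>) a \<and> fixat False (code123 n \<sigma>) j))"
      by (intro sum.cong refl) (simp add: fixclass_iff_fixat[OF s])
    finally show ?thesis .
  qed
  then have "(\<Sum>\<sigma>\<in>avoiders n 3 pat123. card (fixclass n True \<sigma>) * card (fixclass n False \<sigma>)) =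
    (\<Sum>\<sigma>\<in>avoiders n 3 pat123. \<Sum>a<n. \<Sum>j\<in>{a<..<n}.
       of_bool (fixat True (code123 n \<sigma>) a \<and> fixat False (code123 n \<sigma>) j))"
    by (intro sum.cong refl)
  also have "\<dots> = (\<Sum>a<n. \<Sum>\<sigma>\<in>avoiders n 3 pat123. \<Sum>j\<in>{a<..<n}.
       of_bool (fixat True (code123 n \<sigma>) a \<and> fixat False (code123 n \<sigma>) j))"
    by (rule sum.swap)
  also have "\<dots> = (\<Sum>a<n. \<Sum>j\<in>{a<..<n}. \<Sum>\<sigma>\<in>avoiders n 3 pat123.
       of_bool (fixat True (code123 n \<sigma>) a \<and> fixat False (code123 n \<sigma>) j))"
    by (intro sum.cong refl sum.swap)
  also have "\<dots> = (\<Sum>a<n. \<Sum>j\<in>{a<..<n}. card {XY \<in> ballot_pairs n. fixat True XY a \<and> fixat False XY j})"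
    by (simp only: sum_of_bool_card[OF finite_avoiders]
        card_avoiders_ballot[where Q = "\<lambda>XY. fixat True XY _ \<and> fixat False XY _"])
  finally show ?thesis .
qed

section \<open>Reverse-complement symmetry\<close>

definition revcomp :: "nat \<Rightarrow> (nat \<Rightarrow> nat) \<Rightarrow> nat \<Rightarrow> nat" where
  "revcomp n \<sigma> i = (if i \<in> {1..n} then n + 1 - \<sigma> (n + 1 - i) else i)"

text \<open>These fixed right-to-left maxima are what reverse-complement makes of fixed
  left-to-right minima. They are almost \<open>fixclass n False\<close>; the two differ when a point
  is both a minimum and a maximum.\<close>

definition fixmax :: "nat \<Rightarrow> (nat \<Rightarrow> nat) \<Rightarrow> nat set" where
  "fixmax n \<sigma> = {i \<in> {1..n}. \<sigma> i = i \<and> (\<forall>k\<in>{i<..n}. \<sigma> k < i)}"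

lemma revcomp_involution: "\<sigma> permutes {1..n} \<Longrightarrow> revcomp n (revcomp n \<sigma>) = \<sigma>"
proof
  fix i assume s: "\<sigma> permutes {1..n}"
  show "revcomp n (revcomp n \<sigma>) i = \<sigma> i"
  proof (cases "i \<in> {1..n}")
    case True
    then have "\<sigma> i \<in> {1..n}" using permutes_in_image[OF s] by blast
    then show ?thesis using True by (auto simp: revcomp_def)
  qed (use s in \<open>auto simp: revcomp_def permutes_def\<close>)
qed

lemma revcomp_permutes:
  assumes "\<sigma> permutes {1..n}" shows "revcomp n \<sigma> permutes {1..n}"
proof (rule bij_imp_permutes)
  have in_range: "\<sigma> i \<in> {1..n}" if "i \<in> {1..n}" for i using permutes_in_image[OF assms] that by blast
  have "inj_on (revcomp n \<sigma>) {1..n}"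
  proof (rule inj_onI)
    fix i j assume ij: "i \<in> {1..n}" "j \<in> {1..n}" "revcomp n \<sigma> i = revcomp n \<sigma> j"
    have "\<sigma> (n + 1 - i) = \<sigma> (n + 1 - j)"
    proof -
      have "n + 1 - i \<in> {1..n}" "n + 1 - j \<in> {1..n}" using ij by auto
      then have "\<sigma> (n + 1 - i) \<le> n" "\<sigma> (n + 1 - j) \<le> n" using in_range by auto
      then show ?thesis using ij unfolding revcomp_def by simp
    qed
    then have "n + 1 - i = n + 1 - j" using permutes_inj[OF assms] by (auto simp: inj_def)
    then show "i = j" using ij by auto
  qed
  moreover have "revcomp n \<sigma> ` {1..n} \<subseteq> {1..n}"
  proof
    fix v assume "v \<in> revcomp n \<sigma> ` {1..n}"
    then obtain i where "i \<in> {1..n}" "v = revcomp n \<sigma> i" by auto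
    moreover from this have "n + 1 - i \<in> {1..n}" by auto
    then have "\<sigma> (n + 1 - i) \<in> {1..n}" by (rule in_range)
    ultimately show "v \<in> {1..n}" by (auto simp: revcomp_def)
  qed
  ultimately show "bij_betw (revcomp n \<sigma>) {1..n} {1..n}"
    by (simp add: bij_betw_def endo_inj_surj)
qed (auto simp: revcomp_def)

lemma revcomp_avoiders:
  assumes "\<sigma> \<in> avoiders n 3 pat123" shows "revcomp n \<sigma> \<in> avoiders n 3 pat123"
proof -
  have s: "\<sigma> permutes {1..n}" using assms avoiders_123_iff by blast
  have "\<not> revcomp n \<sigma> j < revcomp n \<sigma> k"
    if "i \<in> {1..n}" "j \<in> {1..n}" "k \<in> {1..n}" "i < j" "j < k" "revcomp n \<sigma> i < revcomp n \<sigma> j" for i j k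
  proof
    assume less: "revcomp n \<sigma> j < revcomp n \<sigma> k"
    have "n + 1 - k \<in> {1..n}" "n + 1 - j \<in> {1..n}" "n + 1 - i \<in> {1..n}"
      "n + 1 - k < n + 1 - j" "n + 1 - j < n + 1 - i" using that by auto
    moreover have "\<sigma> (n + 1 - k) < \<sigma> (n + 1 - j)" "\<sigma> (n + 1 - j) < \<sigma> (n + 1 - i)"
    proof -
      have "\<sigma> (n + 1 - k) \<le> n" "\<sigma> (n + 1 - j) \<le> n" "\<sigma> (n + 1 - i) \<le> n"
        using permutes_in_image[OF s] \<open>n + 1 - k \<in> _\<close> \<open>n + 1 - j \<in> _\<close> \<open>n + 1 - i \<in> _\<close>
        by (meson atLeastAtMost_iff)+
      moreover have "n + 1 - \<sigma> (n + 1 - i) < n + 1 - \<sigma> (n + 1 - j)"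
        "n + 1 - \<sigma> (n + 1 - j) < n + 1 - \<sigma> (n + 1 - k)"
        using that less by (simp_all add: revcomp_def)
      ultimately show "\<sigma> (n + 1 - k) < \<sigma> (n + 1 - j)" "\<sigma> (n + 1 - j) < \<sigma> (n + 1 - i)"
        by linarith+
    qed
    ultimately show False using assms unfolding avoiders_123_iff by blast
  qed
  then show ?thesis unfolding avoiders_123_iff using revcomp_permutes[OF s] by blast
qed

lemma fixmax_revcomp:
  assumes "\<sigma> \<in> avoiders n 3 pat123"
  shows "fixmax n (revcomp n \<sigma>) = (\<lambda>i. n + 1 - i) ` fixclass n True \<sigma>"
proof -
  have s: "\<sigma> permutes {1..n}" using assms avoiders_123_iff by blast
  have in_range: "\<sigma> i \<in> {1..n}" if "i \<in> {1..n}" for i using permutes_in_image[OF s] that by blast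
  have "n + 1 - i \<in> fixmax n (revcomp n \<sigma>) \<longleftrightarrow> i \<in> fixclass n True \<sigma>" if i: "i \<in> {1..n}" for i
  proof -
    have "revcomp n \<sigma> (n + 1 - i) = n + 1 - i \<longleftrightarrow> \<sigma> i = i"
      using i in_range[OF i] by (auto simp: revcomp_def)
    moreover have "(\<forall>k\<in>{n + 1 - i<..n}. revcomp n \<sigma> k < n + 1 - i) \<longleftrightarrow> (\<forall>k\<in>{1..<i}. i < \<sigma> k)"
      (is "?A \<longleftrightarrow> ?B")
    proof
      assume A: ?A
      show ?B
      proof
        fix k assume k: "k \<in> {1..<i}"
        then have "n + 1 - k \<in> {n + 1 - i<..n}" using i by auto
        then have "revcomp n \<sigma> (n + 1 - k) < n + 1 - i" using A by blast
        moreover have "n + 1 - k \<in> {1..n}" "n + 1 - (n + 1 - k) = k" using k i by auto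
        ultimately have "n + 1 - \<sigma> k < n + 1 - i" by (simp only: revcomp_def if_True)
        then show "i < \<sigma> k" by linarith
      qed
    next
      assume B: ?B
      show ?A
      proof
        fix k assume k: "k \<in> {n + 1 - i<..n}"
        then have "n + 1 - k \<in> {1..<i}" using i by auto
        then have "i < \<sigma> (n + 1 - k)" using B by blast
        then show "revcomp n \<sigma> k < n + 1 - i" using k i in_range[of "n + 1 - k"] by (auto simp: revcomp_def)
      qed
    qed
    ultimately show ?thesis using i by (auto simp: fixmax_def fixclass_def lrclass_def lrmin_def)
  qed
  note * = this
  show ?thesis
  proof (intro equalityI subsetI)
    fix j assume j: "j \<in> fixmax n (revcomp n \<sigma>)"
    then have jn: "j \<in> {1..n}" by (auto simp: fixmax_def)
    then have "n + 1 - j \<in> {1..n}" "j = n + 1 - (n + 1 - j)" by auto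
    then show "j \<in> (\<lambda>i. n + 1 - i) ` fixclass n True \<sigma>" using *[of "n + 1 - j"] j by (metis imageI)
  next
    fix j assume "j \<in> (\<lambda>i. n + 1 - i) ` fixclass n True \<sigma>"
    then obtain i where i: "i \<in> fixclass n True \<sigma>" "j = n + 1 - i" by auto
    then have "i \<in> {1..n}" using lrclass_subset[of n True \<sigma>] by (auto simp: fixclass_def)
    then show "j \<in> fixmax n (revcomp n \<sigma>)" using *[of i] i by simp
  qed
qed

lemma sum_card_fixmax:
  "(\<Sum>\<sigma>\<in>avoiders n 3 pat123. card (fixmax n \<sigma>)) = (\<Sum>\<sigma>\<in>avoiders n 3 pat123. card (fixclass n True \<sigma>))"
proof (rule sum.reindex_bij_witness[of _ "revcomp n" "revcomp n"])
  fix \<sigma> assume *: "\<sigma> \<in> avoiders n 3 pat123"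
  then have "\<sigma> permutes {1..n}" using avoiders_123_iff by blast
  then show r: "revcomp n (revcomp n \<sigma>) = \<sigma>" by (rule revcomp_involution)
  then show "revcomp n (revcomp n \<sigma>) = \<sigma>" .
  show "revcomp n \<sigma> \<in> avoiders n 3 pat123" using revcomp_avoiders[OF *] .
  then show "revcomp n \<sigma> \<in> avoiders n 3 pat123" .
  have "inj_on (\<lambda>i. n + 1 - i) (fixclass n True (revcomp n \<sigma>))"
    using lrclass_subset[of n True "revcomp n \<sigma>"] by (force simp: inj_on_def fixclass_def)
  then show "card (fixclass n True (revcomp n \<sigma>)) = card (fixmax n \<sigma>)"
    using fixmax_revcomp[OF revcomp_avoiders[OF *]] by (simp add: r card_image)
qed

text \<open>A point outside the minima has a smaller entry before it, so avoidance leaves only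
  smaller entries after it.\<close>

lemma fixclass_False_subset_fixmax:
  assumes "\<sigma> \<in> avoiders n 3 pat123" shows "fixclass n False \<sigma> \<subseteq> fixmax n \<sigma>"
proof
  fix j assume j: "j \<in> fixclass n False \<sigma>"
  then have jn: "j \<in> {1..n} - lrmin n \<sigma>" "\<sigma> j = j" by (auto simp: fixclass_def lrclass_def)
  obtain k where k: "k \<in> {1..<j}" "\<sigma> k < \<sigma> j" using avoiders_123_not_lrmin[OF assms jn(1)] .
  have s: "\<sigma> permutes {1..n}" using assms avoiders_123_iff by blast
  have "\<sigma> l < j" if l: "l \<in> {j<..n}" for l
  proof -
    have "k \<in> {1..n}" "j \<in> {1..n}" "l \<in> {1..n}" "k < j" "j < l" using k jn l by auto
    then have "\<not> \<sigma> j < \<sigma> l" using assms k(2) unfolding avoiders_123_iff by blast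
    moreover have "\<sigma> l \<noteq> \<sigma> j" using l permutes_inj[OF s] by (auto simp: inj_def)
    ultimately show ?thesis using jn(2) by simp
  qed
  then show "j \<in> fixmax n \<sigma>" using jn by (auto simp: fixmax_def)
qed

text \<open>Such a point is a record from both sides: earlier positions take larger values and later
  positions smaller ones. Comparing cardinalities both ways gives i - 1 = n - i.\<close>

lemma fixmax_diff_centre:
  assumes "\<sigma> \<in> avoiders n 3 pat123" "i \<in> fixmax n \<sigma>" "i \<notin> fixclass n False \<sigma>"
  shows "n = 2 * i - 1" "i \<in> fixclass n True \<sigma>"
proof -
  have s: "\<sigma> permutes {1..n}" using assms avoiders_123_iff by blast
  have in_range: "\<sigma> i \<in> {1..n}" if "i \<in> {1..n}" for i using permutes_in_image[OF s] that by blast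
  have inj: "inj_on \<sigma> A" for A
    using permutes_inj[OF s] by (rule inj_on_subset) auto
  have i: "i \<in> lrmin n \<sigma>" "\<sigma> i = i" "i \<in> {1..n}" "\<And>k. k \<in> {i<..n} \<Longrightarrow> \<sigma> k < i"
    using assms by (auto simp: fixmax_def fixclass_def lrclass_def)
  then show "i \<in> fixclass n True \<sigma>" by (simp add: fixclass_def lrclass_def)
  have "\<sigma> ` {1..<i} \<subseteq> {i<..n}"
  proof
    fix v assume "v \<in> \<sigma> ` {1..<i}"
    then obtain k where "k \<in> {1..<i}" "v = \<sigma> k" by auto
    then show "v \<in> {i<..n}" using i in_range[of k] by (auto simp: lrmin_def)
  qed
  from card_mono[OF _ this] have "i - 1 \<le> n - i" by (simp add: card_image[OF inj])
  moreover have "\<sigma> ` {i<..n} \<subseteq> {1..<i}"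
  proof
    fix v assume "v \<in> \<sigma> ` {i<..n}"
    then obtain k where "k \<in> {i<..n}" "v = \<sigma> k" by auto
    then show "v \<in> {1..<i}" using i(4)[of k] in_range[of k] by auto
  qed
  from card_mono[OF _ this] have "n - i \<le> i - 1" by (simp add: card_image[OF inj])
  ultimately show "n = 2 * i - 1" using i(3) by auto
qed

text \<open>Summed over all avoiders, \<open>fixmax\<close> and \<open>fixclass n True\<close> have
  equal size by symmetry. A permutation contributes at most one to the difference between
  \<open>fixmax\<close> and \<open>fixclass n False\<close>, and only when its middle entry is a
  fixed left-to-right minimum.\<close>

lemma sum_card_fixclass_False_bounds:
  fixes n :: nat
  defines "S \<equiv> \<lambda>c. \<Sum>\<sigma>\<in>avoiders n 3 pat123. card (fixclass n c \<sigma>)"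
  shows "S False \<le> S True"
    "S True \<le> S False + card {XY \<in> ballot_pairs n. odd n \<and> fixat True XY ((n - 1) div 2)}"
proof -
  let ?A = "avoiders n 3 pat123"
  have fin: "finite (fixmax n \<sigma>)" for \<sigma> by (auto simp: fixmax_def)
  have "S False \<le> (\<Sum>\<sigma>\<in>?A. card (fixmax n \<sigma>))"
    unfolding S_def by (intro sum_mono card_mono fin fixclass_False_subset_fixmax)
  then show "S False \<le> S True" by (simp add: S_def sum_card_fixmax)
  have "card (fixmax n \<sigma>) \<le> card (fixclass n False \<sigma>) +
      of_bool (odd n \<and> fixat True (code123 n \<sigma>) ((n - 1) div 2))" if s: "\<sigma> \<in> ?A" for \<sigma>
  proof (cases "fixmax n \<sigma> \<subseteq> fixclass n False \<sigma>")
    case True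
    then show ?thesis using card_mono[OF finite_fixclass True] by simp
  next
    case False
    then obtain i where i: "i \<in> fixmax n \<sigma>" "i \<notin> fixclass n False \<sigma>" by blast
    have n: "n = 2 * i - 1" and iT: "i \<in> fixclass n True \<sigma>" using fixmax_diff_centre[OF s i] .
    have "i \<ge> 1" using i by (auto simp: fixmax_def)
    then have ev: "odd n" "i = Suc ((n - 1) div 2)" "(n - 1) div 2 < n" unfolding n by auto
    then have "fixat True (code123 n \<sigma>) ((n - 1) div 2)"
      using fixclass_iff_fixat[OF s ev(3), of True] iT by simp
    moreover have "fixmax n \<sigma> \<subseteq> insert i (fixclass n False \<sigma>)"
    proof
      fix j assume "j \<in> fixmax n \<sigma>"
      then show "j \<in> insert i (fixclass n False \<sigma>)"
        using fixmax_diff_centre(2)[OF s, of j] fixclass_unique[OF s iT] by blast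
    qed
    then have "card (fixmax n \<sigma>) \<le> card (fixclass n False \<sigma>) + 1"
      using card_mono[of "insert i (fixclass n False \<sigma>)" "fixmax n \<sigma>"] finite_fixclass[of n False \<sigma>]
      by (simp add: card_insert_if split: if_splits)
    ultimately show ?thesis using ev by simp
  qed
  then have "(\<Sum>\<sigma>\<in>?A. card (fixmax n \<sigma>)) \<le> (\<Sum>\<sigma>\<in>?A. card (fixclass n False \<sigma>) +
      of_bool (odd n \<and> fixat True (code123 n \<sigma>) ((n - 1) div 2)))"
    by (intro sum_mono)
  also have "\<dots> = S False + card {XY \<in> ballot_pairs n. odd n \<and> fixat True XY ((n - 1) div 2)}"
    by (simp only: S_def sum.distrib sum_of_bool_card[OF finite_avoiders]
        card_avoiders_ballot[where Q = "\<lambda>XY. odd n \<and> fixat True XY ((n - 1) div 2)"])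
  finally show "S True \<le> S False + card {XY \<in> ballot_pairs n. odd n \<and> fixat True XY ((n - 1) div 2)}"
    by (simp add: S_def sum_card_fixmax)
qed

section \<open>Counting with nonnegative walks\<close>

definition path_height :: "bool list \<Rightarrow> int" where
  "path_height xs = int (count_list xs True) - int (count_list xs False)"

definition nonneg_path :: "bool list \<Rightarrow> bool" where
  "nonneg_path xs \<longleftrightarrow> (\<forall>s\<le>length xs. 0 \<le> path_height (take s xs))"

lemma path_height_simps [simp]:
  "path_height [] = 0" "path_height (x # xs) = (if x then 1 else -1) + path_height xs"
  "path_height (xs @ ys) = path_height xs + path_height ys"
  by (auto simp: path_height_def)

lemma path_height_map_Not [simp]: "path_height (map Not xs) = - path_height xs"
  by (induction xs) auto

lemma count_True_False: "count_list xs True + count_list xs False = length xs"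
  by (induction xs) auto

lemma path_height_count: "path_height xs = 2 * int (count_list xs True) - int (length xs)"
  using count_True_False[of xs] by (simp add: path_height_def)

lemma nonneg_path_snoc:
  "nonneg_path (xs @ [x]) \<longleftrightarrow> nonneg_path xs \<and> 0 \<le> path_height xs + (if x then 1 else -1)"
  by (auto simp: nonneg_path_def le_Suc_eq)

lemma finite_bool_lists: "finite {xs :: bool list. length xs = m \<and> Q xs}"
  by (rule finite_subset[OF _ finite_lists_length_eq[of UNIV m]]) auto

lemma card_nonneg_paths:
  "card {xs. length xs = m \<and> nonneg_path xs \<and> path_height xs = h} = walks m h"
proof (induction m arbitrary: h)
  case 0
  have "{xs. length xs = 0 \<and> nonneg_path xs \<and> path_height xs = h} = (if h = 0 then {[]} else {})"
    by (auto simp: nonneg_path_def)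
  then show ?case by simp
next
  case (Suc m)
  let ?S = "\<lambda>m h. {xs. length xs = m \<and> nonneg_path xs \<and> path_height xs = h}"
  show ?case
  proof (cases "h < 0")
    case True
    have "nonneg_path xs \<Longrightarrow> 0 \<le> path_height xs" for xs
      by (force simp: nonneg_path_def)
    then have empty: "?S (Suc m) h = {}" using True by force
    show ?thesis unfolding empty using True by simp
  next
    case False
    have "?S (Suc m) h = (\<lambda>xs. xs @ [True]) ` ?S m (h - 1) \<union> (\<lambda>xs. xs @ [False]) ` ?S m (h + 1)"
      (is "_ = ?R")
    proof (intro equalityI subsetI)
      fix xs assume xs: "xs \<in> ?S (Suc m) h"
      then obtain ys y where "xs = ys @ [y]" by (cases xs rule: rev_cases) auto
      then show "xs \<in> ?R" using xs by (cases y) (auto simp: nonneg_path_snoc image_iff)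
    next
      fix xs assume "xs \<in> ?R"
      then show "xs \<in> ?S (Suc m) h" using False by (auto simp: nonneg_path_snoc)
    qed
    moreover have "card ?R = card (?S m (h - 1)) + card (?S m (h + 1))"
      by (subst card_Un_disjoint) (auto simp: card_image inj_on_def finite_bool_lists)
    ultimately show ?thesis using Suc False by simp
  qed
qed

section \<open>Alternating two sequences of steps\<close>

function interleave :: "'a list \<Rightarrow> 'a list \<Rightarrow> 'a list" where
  "interleave [] ys = ys"
| "interleave (x # xs) ys = x # interleave ys xs"
  by pat_completeness auto
termination by (relation "Wellfounded.measure (\<lambda>(xs, ys). length xs + length ys)") auto

lemma length_interleave [simp]: "length (interleave xs ys) = length xs + length ys"
  by (induction xs ys rule: interleave.induct) auto

lemma path_height_interleave [simp]: "path_height (interleave xs ys) = path_height xs + path_height ys"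
  by (induction xs ys rule: interleave.induct) auto

lemma interleave_inj:
  "interleave xs ys = interleave xs' ys' \<Longrightarrow> length xs = length xs' \<Longrightarrow> length ys = length ys' \<Longrightarrow>
   xs = xs' \<and> ys = ys'"
proof (induction xs ys arbitrary: xs' ys' rule: interleave.induct)
  case (2 x xs ys)
  then show ?case by (cases xs') auto
qed auto

lemma interleave_surj:
  "length zs = a + c \<Longrightarrow> \<exists>xs ys. length xs = a \<and> length ys = c \<and> zs = interleave xs ys"
proof (induction zs arbitrary: a c)
  case Nil
  then show ?case by auto
next
  case (Cons z zs)
  show ?case
  proof (cases a)
    case 0
    then show ?thesis using Cons.prems by (intro exI[of _ "[]"] exI[of _ "z # zs"]) auto
  next
    case (Suc a')
    then have "length zs = c + a'" using Cons.prems by simp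
    from Cons.IH[OF this] obtain xs ys where "length xs = c" "length ys = a'" "zs = interleave xs ys"
      by blast
    then show ?thesis using Suc by (intro exI[of _ "z # ys"] exI[of _ xs]) auto
  qed
qed

lemma take_interleave_odd:
  "t < length xs \<Longrightarrow> t \<le> length ys \<Longrightarrow>
   take (Suc (2 * t)) (interleave xs ys) = interleave (take (Suc t) xs) (take t ys)"
proof (induction t arbitrary: xs ys)
  case 0
  then show ?case by (cases xs) auto
next
  case (Suc t)
  then obtain x xs' y ys' where "xs = x # xs'" "ys = y # ys'"
    by (cases xs; cases ys) auto
  then show ?case using Suc by simp
qed

definition ballot_at :: "bool list \<Rightarrow> bool list \<Rightarrow> nat \<Rightarrow> bool" where
  "ballot_at X Y t \<longleftrightarrow> count_list (take t Y) True < count_list (take (Suc t) X) True"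

text \<open>An outer block left after cutting at the fixed points: \<open>X\<close> holds the
  positions to the left of them, \<open>Y\<close> the values above them. The opposite block, values
  below and positions to the right, takes the same form when read backwards. The surplus
  \<open>x\<close> is made up for by minima between two fixed points.\<close>

definition partial_ballots :: "nat \<Rightarrow> nat \<Rightarrow> nat \<Rightarrow> (bool list \<times> bool list) set" where
  "partial_ballots a c x = {(X, Y). length X = a \<and> length Y = c \<and>
     count_list X True = count_list Y True + x \<and> (\<forall>t<min a c. ballot_at X Y t)}"

lemma path_height_ge_drop: "path_height xs \<le> path_height (take s xs) + int (length xs - s)"
proof -
  have "path_height zs \<le> int (length zs)" for zs
    using count_True_False[of zs] by (simp add: path_height_def)
  from this[of "drop s xs"] show ?thesis
    by (metis append_take_drop_id add_left_mono path_height_simps(3) length_drop)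
qed

text \<open>While the lists alternate, odd prefixes have height twice the surplus minus one, and the
  next even prefix is at most one lower. After the shorter list is used up,
  \<open>a \<le> c + x\<close> makes the final height at least the number of remaining steps, so the
  path cannot have been negative there.\<close>

lemma nonneg_interleave_iff:
  assumes len: "length X = a" "length Y = c" and ones: "count_list X True = count_list Y True + x"
    and "a \<le> c + x"
  shows "nonneg_path (interleave X (map Not Y)) \<longleftrightarrow> (\<forall>t<min a c. ballot_at X Y t)"
proof -
  let ?Z = "interleave X (map Not Y)"
  have odd: "path_height (take (Suc (2 * t)) ?Z) =
      2 * (int (count_list (take (Suc t) X) True) - int (count_list (take t Y) True)) - 1"
    if "t < min a c" for t
    using that len by (simp add: take_interleave_odd take_map) (simp add: path_height_count)
  have even: "path_height (take (2 * Suc t) ?Z) \<ge> path_height (take (Suc (2 * t)) ?Z) - 1"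
    if "t < min a c" for t
  proof -
    have "take (Suc (Suc (2 * t))) ?Z = take (Suc (2 * t)) ?Z @ [?Z ! Suc (2 * t)]"
      using that len by (intro take_Suc_conv_app_nth) auto
    then show ?thesis by simp
  qed
  have fin: "path_height ?Z = int c - int a + 2 * int x"
    using len ones path_height_count[of X] path_height_count[of Y] by simp
  show ?thesis
  proof
    assume nn: "nonneg_path ?Z"
    show "\<forall>t<min a c. ballot_at X Y t"
    proof (intro allI impI)
      fix t assume t: "t < min a c"
      have "0 \<le> path_height (take (Suc (2 * t)) ?Z)"
        using nn t len by (auto simp: nonneg_path_def)
      moreover have "q < p" if "0 \<le> 2 * (p - q) - 1" for p q :: int
        using that by presburger
      ultimately show "ballot_at X Y t" unfolding odd[OF t] ballot_at_def by (metis of_nat_less_iff)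
    qed
  next
    assume dom: "\<forall>t<min a c. ballot_at X Y t"
    show "nonneg_path ?Z" unfolding nonneg_path_def
    proof (intro allI impI)
      fix s assume s: "s \<le> length ?Z"
      have odd1: "path_height (take (Suc (2 * t)) ?Z) \<ge> 1" if "t < min a c" for t
        using dom that unfolding odd[OF that] ballot_at_def by auto
      consider "s = 0" | t where "t < min a c" "s = Suc (2 * t)" | t where "t < min a c" "s = 2 * Suc t"
        | "2 * min a c < s"
      proof -
        have "s = 0 \<or> 2 * m < s \<or> (\<exists>t<m. s = Suc (2 * t)) \<or> (\<exists>t<m. s = 2 * Suc t)" for m :: nat
          by presburger
        then show ?thesis using that by blast
      qed
      then show "0 \<le> path_height (take s ?Z)"
      proof cases
        case 4
        then have "int (length ?Z - s) \<le> int c - int a + 2 * int x"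
          using s len \<open>a \<le> c + x\<close> by (auto simp: min_def split: if_splits)
        then show ?thesis using path_height_ge_drop[of ?Z s] fin by linarith
      qed (use odd1 even in \<open>force+\<close>)
    qed
  qed
qed

lemma card_partial_ballots:
  assumes "a \<le> c + x"
  shows "card (partial_ballots a c x) = walks (a + c) (int c - int a + 2 * int x)"
proof -
  let ?f = "\<lambda>(X, Y). interleave X (map Not Y)"
  have "?f ` partial_ballots a c x =
        {zs. length zs = a + c \<and> nonneg_path zs \<and> path_height zs = int c - int a + 2 * int x}"
    (is "?L = ?R")
  proof (intro equalityI subsetI)
    fix zs assume "zs \<in> ?L"
    then obtain X Y where XY: "(X, Y) \<in> partial_ballots a c x" "zs = interleave X (map Not Y)" by auto
    then show "zs \<in> ?R"
      using nonneg_interleave_iff[of X a Y c x] assms path_height_count[of X] path_height_count[of Y]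
      by (auto simp: partial_ballots_def)
  next
    fix zs assume zs: "zs \<in> ?R"
    then obtain X Z where XZ: "length X = a" "length Z = c" "zs = interleave X Z"
      using interleave_surj[of zs a c] by auto
    define Y where "Y = map Not Z"
    have Z: "Z = map Not Y" by (simp add: Y_def o_def)
    have "length Y = c" using XZ by (simp add: Y_def)
    moreover have "count_list X True = count_list Y True + x"
      using zs XZ \<open>length Y = c\<close> path_height_count[of X] path_height_count[of Y] by (simp add: Z)
    ultimately have "(X, Y) \<in> partial_ballots a c x"
      using nonneg_interleave_iff[of X a Y c x] assms zs XZ by (auto simp: partial_ballots_def Z)
    then show "zs \<in> ?L" using XZ(3) Z by force
  qed
  moreover have "inj_on ?f (partial_ballots a c x)"
  proof (rule inj_onI, clarify)
    fix X Y X' Y' assume "(X, Y) \<in> partial_ballots a c x" "(X', Y') \<in> partial_ballots a c x"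
      "interleave X (map Not Y) = interleave X' (map Not Y')"
    then have "X = X' \<and> map Not Y = map Not Y'"
      by (intro interleave_inj) (auto simp: partial_ballots_def)
    then show "X = X' \<and> Y = Y'" by (auto dest: map_injective simp: inj_def)
  qed
  ultimately have "card (partial_ballots a c x) =
      card {zs. length zs = a + c \<and> nonneg_path zs \<and> path_height zs = int c - int a + 2 * int x}"
    by (metis card_image)
  then show ?thesis by (simp only: card_nonneg_paths)
qed

section \<open>Cutting ballot pairs at fixed points\<close>

lemma ballot_pairs_iff:
  "(X, Y) \<in> ballot_pairs n \<longleftrightarrow> length X = n \<and> length Y = n \<and>
     count_list X True = count_list Y True \<and> (\<forall>t<n. ballot_at X Y t)"
  by (simp add: ballot_pairs_def ballot_at_def)

lemma card_ballot_pairs: "card (ballot_pairs n) = walks (2 * n) 0"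
proof -
  have "ballot_pairs n = partial_ballots n n 0"
    by (auto simp: ballot_pairs_iff partial_ballots_def)
  then show ?thesis using card_partial_ballots[of n n 0] by (simp add: mult_2)
qed

text \<open>Passing from \<open>(X, Y)\<close> to \<open>(rev Y, rev X)\<close> reads the Dyck path
  backwards. As the totals agree, the surplus of a prefix is determined by that of the complementary
  suffix.\<close>

lemma ballot_at_rev:
  assumes "length X = n" "length Y = n" "count_list X True = count_list Y True" "t < n"
  shows "ballot_at (rev Y) (rev X) (n - 1 - t) \<longleftrightarrow> ballot_at X Y t"
proof -
  have X: "count_list X True = count_list (take (Suc t) X) True + count_list (drop (Suc t) X) True"
    and Y: "count_list Y True = count_list (take t Y) True + count_list (drop t Y) True"
    by (metis append_take_drop_id count_list_append)+
  have "take (n - 1 - t) (rev X) = rev (drop (Suc t) X)" "take (Suc (n - 1 - t)) (rev Y) = rev (drop t Y)"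
    using assms by (simp_all add: take_rev Suc_diff_Suc)
  then show ?thesis using X Y assms(3) by (auto simp: ballot_at_def)
qed

text \<open>Once the middle conditions are known to hold, the remaining ones separate into two
  families on opposite ends of the path. This is why the counts below factorize.\<close>

lemma ballot_split:
  assumes len: "length X = n" "length Y = n" and eq: "count_list X True = count_list Y True"
    and mid: "\<And>t. m \<le> t \<Longrightarrow> t < n - m \<Longrightarrow> ballot_at X Y t"
    and "m \<le> n"
  shows "(X, Y) \<in> ballot_pairs n \<longleftrightarrow>
    (\<forall>t<m. ballot_at X Y t) \<and> (\<forall>t<m. ballot_at (rev Y) (rev X) t)"
proof
  assume *: "(X, Y) \<in> ballot_pairs n"
  have "ballot_at (rev Y) (rev X) t" if "t < m" for t
    using ballot_at_rev[OF len eq, of "n - 1 - t"] * that \<open>m \<le> n\<close> by (simp add: ballot_pairs_iff)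
  then show "(\<forall>t<m. ballot_at X Y t) \<and> (\<forall>t<m. ballot_at (rev Y) (rev X) t)"
    using * \<open>m \<le> n\<close> by (auto simp: ballot_pairs_iff)
next
  assume *: "(\<forall>t<m. ballot_at X Y t) \<and> (\<forall>t<m. ballot_at (rev Y) (rev X) t)"
  have "ballot_at X Y t" if "t < n" for t
  proof -
    consider "t < m" | "m \<le> t" "t < n - m" | "n - m \<le> t" by linarith
    then show ?thesis
    proof cases
      case 3
      then have "n - 1 - t < m" using that by linarith
      then show ?thesis using * ballot_at_rev[OF len eq that] by simp
    qed (use * mid in auto)
  qed
  then show "(X, Y) \<in> ballot_pairs n" using len eq by (simp add: ballot_pairs_iff)
qed

lemma ballot_at_append:
  "t < length A \<Longrightarrow> t \<le> length B \<Longrightarrow> ballot_at (A @ X) (B @ Y) t \<longleftrightarrow> ballot_at A B t"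
  by (simp add: ballot_at_def)

lemma count_list_take_mono: "s \<le> t \<Longrightarrow> count_list (take s xs) c \<le> count_list (take t xs) c"
  using take_add[of s "t - s" xs] by simp

lemma card_bool_lists_count:
  "card {M. length M = b \<and> count_list M True = y} = b choose y"
proof (induction b arbitrary: y)
  case 0
  have "{M. length M = 0 \<and> count_list M True = y} = (if y = 0 then {[]} else {})" by auto
  then show ?case by simp
next
  case (Suc b)
  let ?S = "\<lambda>b y. {M. length M = b \<and> count_list M True = y}"
  have split: "?S (Suc b) y = (if y = 0 then {} else Cons True ` ?S b (y - 1)) \<union> Cons False ` ?S b y"
    (is "_ = ?R")
  proof (intro equalityI subsetI)
    fix M assume M: "M \<in> ?S (Suc b) y"
    then obtain x M' where "M = x # M'" by (cases M) auto
    then show "M \<in> ?R" using M by (cases x) (auto simp: image_iff)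
  qed (auto split: if_splits)
  have "card ?R = (if y = 0 then 0 else card (?S b (y - 1))) + card (?S b y)"
    by (subst card_Un_disjoint) (auto simp: card_image finite_bool_lists)
  then show ?case using Suc split by (cases y) auto
qed

lemma sum_bool_lists_count:
  "(\<Sum>M\<in>{M. length M = b}. f (count_list M True)) = (\<Sum>y\<le>b. (b choose y) * f y)" for f :: "nat \<Rightarrow> nat"
proof -
  have fin: "finite {M :: bool list. length M = b}"
    using finite_bool_lists[of b "\<lambda>_. True"] by simp
  have "(\<Sum>M\<in>{M. length M = b}. f (count_list M True)) =
    (\<Sum>y\<le>b. \<Sum>M\<in>{M \<in> {M. length M = b}. count_list M True = y}. f (count_list M True))"
    by (rule sum.group[symmetric]) (auto simp: fin count_le_length)
  also have "\<dots> = (\<Sum>y\<le>b. card {M. length M = b \<and> count_list M True = y} * f y)"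
    by (intro sum.cong refl) simp
  finally show ?thesis by (simp add: card_bool_lists_count)
qed

text \<open>The marked entry supplies the strict inequality in the middle: for
  \<open>a \<le> t \<le> c\<close> the prefix of the second list lies in \<open>B\<close>, which has
  as many Trues as \<open>A\<close>, while the prefix of the first contains \<open>A\<close> and the
  marked True.\<close>

lemma ballot_one_fixed_iff:
  assumes len: "length A = a" "length C = a" "length B = c" "length D = c" and "a \<le> c"
  shows "(A @ True # rev D, B @ True # rev C) \<in> ballot_pairs (a + c + 1) \<and>
      count_list A True = count_list B True \<longleftrightarrow>
    (A, B) \<in> partial_ballots a c 0 \<and> (C, D) \<in> partial_ballots a c 0"
proof (cases "count_list A True = count_list B True \<and> count_list C True = count_list D True")
  case True
  let ?X = "A @ True # rev D" and ?Y = "B @ True # rev C"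
  have "(?X, ?Y) \<in> ballot_pairs (a + c + 1) \<longleftrightarrow>
    (\<forall>t<a. ballot_at ?X ?Y t) \<and> (\<forall>t<a. ballot_at (rev ?Y) (rev ?X) t)"
  proof (rule ballot_split)
    fix t assume t: "a \<le> t" "t < a + c + 1 - a"
    have "count_list (take t ?Y) True \<le> count_list B True"
      using t count_list_take_mono[of t c B True] len by simp
    also have "\<dots> < count_list (take (Suc a) ?X) True" using True len by simp
    also have "\<dots> \<le> count_list (take (Suc t) ?X) True"
      using t by (intro count_list_take_mono) simp
    finally show "ballot_at ?X ?Y t" by (simp add: ballot_at_def)
  qed (use len True in \<open>auto simp: count_list_rev\<close>)
  also have "(\<forall>t<a. ballot_at ?X ?Y t) \<longleftrightarrow> (\<forall>t<a. ballot_at A B t)"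
    using len \<open>a \<le> c\<close> by (simp add: ballot_at_append)
  also have "(\<forall>t<a. ballot_at (rev ?Y) (rev ?X) t) \<longleftrightarrow> (\<forall>t<a. ballot_at C D t)"
    using len \<open>a \<le> c\<close> by (simp add: ballot_at_append)
  finally show ?thesis using True len \<open>a \<le> c\<close> by (auto simp: partial_ballots_def min_def)
next
  case False
  then show ?thesis by (auto simp: partial_ballots_def ballot_pairs_iff count_list_rev)
qed

lemma split_at_nth:
  assumes "a < length X" shows "X = take a X @ X ! a # drop (Suc a) X"
  using id_take_nth_drop[OF assms] .

lemma finite_partial_ballots: "finite (partial_ballots a c x)"
  by (rule finite_subset[of _ "{X. length X = a} \<times> {Y. length Y = c}"])
     (use finite_lists_length_eq[of "UNIV :: bool set"] in \<open>auto simp: partial_ballots_def\<close>)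

lemma partial_ballots_lengths: "partial_ballots a c x \<subseteq> {X. length X = a} \<times> {Y. length Y = c}"
  by (auto simp: partial_ballots_def)

text \<open>Cutting at the marked entries leaves two independent blocks with the same lengths and
  surplus 0, hence the square.\<close>

lemma card_one_fixed:
  assumes "a < n"
  shows "card {XY \<in> ballot_pairs n. fixat True XY a} =
    (if 2 * a + 1 \<le> n then walks (n - 1) (int n - 1 - 2 * int a) ^ 2 else 0)"
proof -
  define c where "c = n - 1 - a"
  have n: "n = a + c + 1" using assms by (simp add: c_def)
  let ?S = "{XY \<in> ballot_pairs n. fixat True XY a}"
  let ?U = "partial_ballots a c 0"
  let ?f = "\<lambda>((A, B), (C, D)). (A @ True # rev D, B @ True # rev C)"
  have decomp: "\<exists>A B C D. X = A @ True # rev D \<and> Y = B @ True # rev C \<and> length A = a \<and>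
      length C = a \<and> length B = c \<and> length D = c \<and> count_list A True = count_list B True"
    if "(X, Y) \<in> ?S" for X Y
  proof -
    have len: "length X = n" "length Y = n" using that by (auto simp: ballot_pairs_iff)
    have fx: "X ! a" "Y ! c" "count_list (take a X) True = count_list (take c Y) True"
      using that len by (auto simp: fixat_def c_def)
    have "X = take a X @ True # rev (rev (drop (Suc a) X))"
      using split_at_nth[of a X] fx len n by simp
    moreover have "Y = take c Y @ True # rev (rev (drop (Suc c) Y))"
      using split_at_nth[of c Y] fx len n by simp
    ultimately show ?thesis using fx len n
      by (intro exI[of _ "take a X"] exI[of _ "take c Y"] exI[of _ "rev (drop (Suc c) Y)"]
          exI[of _ "rev (drop (Suc a) X)"]) simp
  qed
  have fixf: "fixat True (A @ True # rev D, B @ True # rev C) a \<longleftrightarrow> count_list A True = count_list B True"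
    if "length A = a" "length C = a" "length B = c" "length D = c" for A B C D
    using that by (simp add: fixat_def nth_append)
  show ?thesis
  proof (cases "a \<le> c")
    case True
    have "?S = ?f ` (?U \<times> ?U)"
    proof (intro equalityI subsetI)
      fix XY assume XY: "XY \<in> ?S"
      obtain X Y where "XY = (X, Y)" by fastforce
      with decomp[of X Y] XY obtain A B C D where *: "XY = (A @ True # rev D, B @ True # rev C)"
        "length A = a" "length C = a" "length B = c" "length D = c" "count_list A True = count_list B True"
        by auto
      then have "(A, B) \<in> ?U \<and> (C, D) \<in> ?U"
        using ballot_one_fixed_iff[OF *(2,3,4,5) True] XY n by simp
      then show "XY \<in> ?f ` (?U \<times> ?U)" using *(1) by force
    next
      fix XY assume "XY \<in> ?f ` (?U \<times> ?U)"
      then obtain A B C D where *: "(A, B) \<in> ?U" "(C, D) \<in> ?U" 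
        "XY = (A @ True # rev D, B @ True # rev C)" by auto
      then have len: "length A = a" "length C = a" "length B = c" "length D = c"
        by (auto simp: partial_ballots_def)
      show "XY \<in> ?S" using ballot_one_fixed_iff[OF len True] fixf[OF len] * n by auto
    qed
    moreover have "inj_on ?f (?U \<times> ?U)"
    proof (rule inj_on_subset)
      let ?B = "{X :: bool list. length X = a} \<times> {Y :: bool list. length Y = c}"
      show "inj_on ?f (?B \<times> ?B)"
        by (rule inj_on_inverseI[where g = "\<lambda>(X, Y).
              ((take a X, take c Y), (rev (drop (Suc c) Y), rev (drop (Suc a) X)))"]) auto
      show "?U \<times> ?U \<subseteq> ?B \<times> ?B" using partial_ballots_lengths by (intro Sigma_mono) auto
    qed
    ultimately have "card ?S = card ?U * card ?U"
      by (simp add: card_image card_cartesian_product)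
    moreover have "2 * a + 1 \<le> n" using True n by simp
    moreover have "card ?U = walks (n - 1) (int n - 1 - 2 * int a)"
      using card_partial_ballots[of a c 0] True n by simp
    ultimately show ?thesis by (simp add: power2_eq_square)
  next
    case False
    \<comment> \<open>For \<open>a > c\<close> the condition at \<open>c\<close> would compare
      \<open>B\<close> with a prefix of \<open>A\<close>, although \<open>A\<close> and
      \<open>B\<close> contain equally many Trues.\<close>
    have empty: "?S = {}"
    proof (rule ccontr)
      assume "?S \<noteq> {}"
      then obtain X Y where XY: "(X, Y) \<in> ?S" by auto
      with decomp obtain A B C D where *: "X = A @ True # rev D" "Y = B @ True # rev C"
        "length A = a" "length C = a" "length B = c" "length D = c" "count_list A True = count_list B True"
        by blast
      have "ballot_at X Y c" using XY n by (auto simp: ballot_pairs_iff)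
      moreover have "count_list (take (Suc c) X) True \<le> count_list (take a X) True"
        using False by (intro count_list_take_mono) simp
      ultimately show False using * by (simp add: ballot_at_def)
    qed
    show ?thesis unfolding empty using False n by simp
  qed
qed

text \<open>The ballot conditions between the outer blocks hold automatically: for \<open>a \<le> c\<close> because the first fixed
  point separates the left-to-right minima, otherwise because the second one separates the other points.\<close>

lemma ballot_two_fixed_iff:
  assumes len: "length A = a" "length C = a" "length B = c" "length D = c" "length M = b" "length M' = b"
    and n: "n = a + b + c + 2"
  shows "(A @ True # M @ False # rev D, B @ False # M' @ True # rev C) \<in> ballot_pairs n \<and>
      count_list A True = count_list B True + count_list M' True \<and>
      count_list A False + count_list M False = count_list B False \<longleftrightarrow>
    a + b = c + count_list M True + count_list M' True \<and>
    (A, B) \<in> partial_ballots a c (count_list M' True) \<and> (C, D) \<in> partial_ballots a c (count_list M True)"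
proof -
  have F: "count_list xs False = length xs - count_list xs True" "count_list xs True \<le> length xs" for xs :: "bool list"
    using count_True_False[of xs] by auto
  let ?X = "A @ True # M @ False # rev D" and ?Y = "B @ False # M' @ True # rev C"
  let ?x = "count_list M' True" and ?y = "count_list M True"
  define Q where "Q \<longleftrightarrow> count_list A True = count_list B True + ?x \<and>
    a + b = c + ?y + ?x \<and> count_list C True = count_list D True + ?y"
  have z: "count_list A False + count_list M False = count_list B False \<longleftrightarrow> a + b = c + ?y + ?x"
    if "count_list A True = count_list B True + ?x"
    using that len F(2)[of A] F(2)[of B] F(2)[of M] by (auto simp: F(1))
  have eqT: "count_list ?X True = count_list ?Y True \<longleftrightarrow> count_list C True = count_list D True + ?y"
    if "count_list A True = count_list B True + ?x"
    using that by (auto simp: count_list_rev)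
  show ?thesis
  proof (cases Q)
    case True
    let ?m = "min a c"
    have zz: "count_list A False + count_list M False = count_list B False"
      using z True by (simp add: Q_def)
    have "(?X, ?Y) \<in> ballot_pairs n \<longleftrightarrow>
      (\<forall>t<?m. ballot_at ?X ?Y t) \<and> (\<forall>t<?m. ballot_at (rev ?Y) (rev ?X) t)"
    proof (rule ballot_split)
      fix t assume t: "?m \<le> t" "t < n - ?m"
      show "ballot_at ?X ?Y t"
      proof (cases "a \<le> c")
        case True
        have "count_list (take t ?Y) True \<le> count_list (take (b + c + 1) ?Y) True"
          using t n True by (intro count_list_take_mono) simp
        also have "\<dots> = count_list A True" using len \<open>Q\<close> by (simp add: Q_def)
        also have "\<dots> < count_list (take (Suc a) ?X) True" using len by simp
        also have "\<dots> \<le> count_list (take (Suc t) ?X) True"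
          using t True by (intro count_list_take_mono) simp
        finally show ?thesis by (simp add: ballot_at_def)
      next
        case False
        \<comment> \<open>For \<open>a > c\<close> it is easier to count False: the prefix of the
          first list is one entry longer, so if it has no more Falses, it has strictly more
          Trues.\<close>
        have less: "count_list (take (Suc t) ?X) False \<le> count_list (take t ?Y) False"
        proof (cases "t \<le> a + b")
          case True
          have "count_list (take (Suc t) ?X) False \<le> count_list (take (Suc (a + b)) ?X) False"
            using True by (intro count_list_take_mono) simp
          also have "\<dots> = count_list B False" using len zz by simp
          also have "\<dots> = count_list (take c ?Y) False" using len by simp
          also have "\<dots> \<le> count_list (take t ?Y) False"
            using t False by (intro count_list_take_mono) simp
          finally show ?thesis .
        next
          case True: False
          have "t = a + b + 1" using True t n False by simp
          then have "count_list (take (Suc t) ?X) False = count_list B False + 1" using len zz by simp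
          also have "\<dots> = count_list (take (Suc c) ?Y) False" using len by simp
          also have "\<dots> \<le> count_list (take t ?Y) False"
            using \<open>t = a + b + 1\<close> False by (intro count_list_take_mono) simp
          finally show ?thesis .
        qed
        have "length (take (Suc t) ?X) = Suc t" "length (take t ?Y) = t"
          using t n len by auto
        then show ?thesis
          using less count_True_False[of "take (Suc t) ?X"] count_True_False[of "take t ?Y"]
          unfolding ballot_at_def by linarith
      qed
    qed (use len n eqT True in \<open>auto simp: Q_def\<close>)
    also have "(\<forall>t<?m. ballot_at ?X ?Y t) \<longleftrightarrow> (\<forall>t<?m. ballot_at A B t)"
      using len by (simp add: ballot_at_append)
    also have "(\<forall>t<?m. ballot_at (rev ?Y) (rev ?X) t) \<longleftrightarrow> (\<forall>t<?m. ballot_at C D t)"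
      using len by (simp add: ballot_at_append)
    finally show ?thesis using True zz len by (auto simp: Q_def partial_ballots_def)
  next
    case False
    then show ?thesis using z eqT by (auto simp: Q_def partial_ballots_def ballot_pairs_iff)
  qed
qed

text \<open>The middle blocks matter only through their numbers of Trues, which gives the binomial
  coefficients. The coupling is crosswise: Trues among the middle values set the surplus of the
  block before both fixed points, Trues among the middle positions that of the opposite
  block.\<close>

lemma card_two_fixed:
  assumes n: "n = a + b + c + 2"
  shows "card {XY \<in> ballot_pairs n. fixat True XY a \<and> fixat False XY (a + b + 1)} =
    (\<Sum>x\<le>b. \<Sum>y\<le>b. (b choose x) * (b choose y) * of_bool (a + b = c + x + y) *
       walks (a + c) (int b + int x - int y) * walks (a + c) (int b - int x + int y))"
proof -
  let ?S = "{XY \<in> ballot_pairs n. fixat True XY a \<and> fixat False XY (a + b + 1)}"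
  let ?L = "{M :: bool list. length M = b}"
  \<comment> \<open>The middle blocks compatible with both fixed points. Each such pair fixes the
    surplus of both outer blocks, which are otherwise free.\<close>
  define I where "I = {MM \<in> ?L \<times> ?L. a + b = c + count_list (fst MM) True + count_list (snd MM) True}"
  define U where "U x = partial_ballots a c x" for x
  define W where "W MM = U (count_list (snd MM) True) \<times> U (count_list (fst MM) True)" for MM
  let ?f = "\<lambda>((M, M'), ((A, B), (C, D))). (A @ True # M @ False # rev D, B @ False # M' @ True # rev C)"
  have finL: "finite ?L" using finite_bool_lists[of b "\<lambda>_. True"] by simp
  have finI: "finite I" unfolding I_def using finL by simp
  have finW: "finite (W MM)" for MM by (simp add: W_def U_def finite_partial_ballots)
  have fixf: "fixat True (A @ True # M @ False # rev D, B @ False # M' @ True # rev C) a \<longleftrightarrow>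
        count_list A True = count_list B True + count_list M' True"
      "fixat False (A @ True # M @ False # rev D, B @ False # M' @ True # rev C) (a + b + 1) \<longleftrightarrow>
        count_list A False + count_list M False = count_list B False"
    if "length A = a" "length C = a" "length B = c" "length D = c" "length M = b" "length M' = b"
    for A B C D M M'
  proof -
    have i1: "length (A @ True # M @ False # rev D) - 1 - a = c + b + 1"
      "length (A @ True # M @ False # rev D) - 1 - (a + b + 1) = c" using that by auto
    have i2: "(B @ False # M' @ True # rev C) ! (c + b + 1)" "\<not> (B @ False # M' @ True # rev C) ! c"
      "(A @ True # M @ False # rev D) ! a" "\<not> (A @ True # M @ False # rev D) ! (a + b + 1)"
      using that by (simp_all add: nth_append)
    have i3: "take (c + b + 1) (B @ False # M' @ True # rev C) = B @ False # M'"
      "take (a + b + 1) (A @ True # M @ False # rev D) = A @ True # M" using that by simp_all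
    show "fixat True (A @ True # M @ False # rev D, B @ False # M' @ True # rev C) a \<longleftrightarrow>
        count_list A True = count_list B True + count_list M' True"
      unfolding fixat_def prod.case i1 i3 using i2 that by simp
    show "fixat False (A @ True # M @ False # rev D, B @ False # M' @ True # rev C) (a + b + 1) \<longleftrightarrow>
        count_list A False + count_list M False = count_list B False"
      unfolding fixat_def prod.case i1 i3 using i2 that by simp
  qed
  have "?S = ?f ` (SIGMA MM:I. W MM)"
  proof (intro equalityI subsetI)
    fix XY assume XY: "XY \<in> ?S"
    obtain X Y where eq: "XY = (X, Y)" by fastforce
    have len: "length X = n" "length Y = n" using XY eq by (auto simp: ballot_pairs_iff)
    have fx: "X ! a" "Y ! (c + b + 1)" "\<not> X ! (a + b + 1)" "\<not> Y ! c"
    proof -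
      have e: "n - 1 - a = c + b + 1" "n - 1 - (a + b + 1) = c" using n by auto
      show "X ! a" "Y ! (c + b + 1)" "\<not> X ! (a + b + 1)" "\<not> Y ! c"
        using XY unfolding eq mem_Collect_eq fixat_def prod.case len(1) e by blast+
    qed
    define A M D where "A = take a X" "M = take b (drop (Suc a) X)" "D = rev (drop (a + b + 2) X)"
    define B M' C where "B = take c Y" "M' = take b (drop (Suc c) Y)" "C = rev (drop (b + c + 2) Y)"
    note defs = A_M_D_def B_M'_C_def
    have X: "X = A @ True # M @ False # rev D"
    proof -
      have "X = take a X @ True # drop (Suc a) X" using split_at_nth[of a X] fx len n by simp
      also have "drop (Suc a) X = take b (drop (Suc a) X) @ False # drop (a + b + 2) X"
        using split_at_nth[of b "drop (Suc a) X"] fx len n by (simp add: add.commute)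
      finally show ?thesis by (simp add: defs)
    qed
    have Y: "Y = B @ False # M' @ True # rev C"
    proof -
      have "Y = take c Y @ False # drop (Suc c) Y" using split_at_nth[of c Y] fx len n by simp
      also have "drop (Suc c) Y = take b (drop (Suc c) Y) @ True # drop (b + c + 2) Y"
        using split_at_nth[of b "drop (Suc c) Y"] fx len n by (simp add: add.commute)
      finally show ?thesis by (simp add: defs)
    qed
    have l: "length A = a" "length C = a" "length B = c" "length D = c" "length M = b" "length M' = b"
      using len n by (simp_all add: defs)
    have "((M, M'), ((A, B), (C, D))) \<in> (SIGMA MM:I. W MM)"
      using ballot_two_fixed_iff[OF l n] fixf[OF l] XY l unfolding eq X Y I_def W_def U_def by simp
    then show "XY \<in> ?f ` (SIGMA MM:I. W MM)" unfolding eq X Y by force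
  next
    fix XY assume "XY \<in> ?f ` (SIGMA MM:I. W MM)"
    then obtain M M' A B C D where XY: "XY = (A @ True # M @ False # rev D, B @ False # M' @ True # rev C)"
      and *: "(M, M') \<in> I" "(A, B) \<in> U (count_list M' True)" "(C, D) \<in> U (count_list M True)"
      by (auto simp: W_def)
    have l: "length A = a" "length C = a" "length B = c" "length D = c" "length M = b" "length M' = b"
      using * by (auto simp: I_def U_def partial_ballots_def)
    show "XY \<in> ?S"
      using ballot_two_fixed_iff[OF l n] fixf[OF l] * unfolding XY I_def U_def by simp
  qed
  moreover have "inj_on ?f (SIGMA MM:I. W MM)"
  proof (rule inj_on_subset)
    let ?B = "{X :: bool list. length X = a} \<times> {Y :: bool list. length Y = c}"
    show "inj_on ?f ((?L \<times> ?L) \<times> (?B \<times> ?B))"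
      by (rule inj_on_inverseI[where g = "\<lambda>(X, Y).
            ((take b (drop (Suc a) X), take b (drop (Suc c) Y)),
             ((take a X, take c Y), (rev (drop (b + c + 2) Y), rev (drop (a + b + 2) X))))"]) auto
    have "W MM \<subseteq> ?B \<times> ?B" for MM
      unfolding W_def U_def by (intro Sigma_mono partial_ballots_lengths)
    then show "(SIGMA MM:I. W MM) \<subseteq> (?L \<times> ?L) \<times> (?B \<times> ?B)"
      unfolding I_def by (intro Sigma_mono) auto
  qed
  ultimately have "card ?S = card (SIGMA MM:I. W MM)" by (simp add: card_image)
  also have "\<dots> = (\<Sum>MM\<in>I. card (W MM))" using finI finW by (simp add: card_SigmaI)
  also have "\<dots> = (\<Sum>MM\<in>?L \<times> ?L. of_bool (a + b = c + count_list (fst MM) True + count_list (snd MM) True) * card (W MM))"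
    by (rule sum.mono_neutral_cong_left) (use finL in \<open>auto simp: I_def\<close>)
  also have "\<dots> = (\<Sum>M\<in>?L. \<Sum>M'\<in>?L. of_bool (a + b = c + count_list M True + count_list M' True) *
       (card (U (count_list M' True)) * card (U (count_list M True))))"
    unfolding sum.cartesian_product by (simp add: W_def card_cartesian_product case_prod_beta)
  also have "\<dots> = (\<Sum>M\<in>?L. \<Sum>x\<le>b. (b choose x) * (of_bool (a + b = c + count_list M True + x) *
       (card (U x) * card (U (count_list M True)))))"
    by (intro sum.cong refl sum_bool_lists_count)
  also have "\<dots> = (\<Sum>y\<le>b. (b choose y) * (\<Sum>x\<le>b. (b choose x) * (of_bool (a + b = c + y + x) *
       (card (U x) * card (U y)))))"
    by (rule sum_bool_lists_count)
  also have "\<dots> = (\<Sum>y\<le>b. \<Sum>x\<le>b. (b choose x) * (b choose y) * of_bool (a + b = c + x + y) *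
       walks (a + c) (int b + int x - int y) * walks (a + c) (int b - int x + int y))"
    unfolding sum_distrib_left
  proof (intro sum.cong refl)
    fix x y assume xy: "x \<in> {..b}" "y \<in> {..b}"
    show "(b choose y) * ((b choose x) * (of_bool (a + b = c + y + x) * (card (U x) * card (U y)))) =
      (b choose x) * (b choose y) * of_bool (a + b = c + x + y) *
       walks (a + c) (int b + int x - int y) * walks (a + c) (int b - int x + int y)"
    proof (cases "a + b = c + x + y")
      case True
      have "int c - int a + 2 * int x = int b + int x - int y"
        "int c - int a + 2 * int y = int b - int x + int y" using True by linarith+
      moreover have "a \<le> c + x" "a \<le> c + y" using True xy by auto
      ultimately have "card (U x) = walks (a + c) (int b + int x - int y)"
        "card (U y) = walks (a + c) (int b - int x + int y)"
        using card_partial_ballots[of a c x] card_partial_ballots[of a c y] unfolding U_def by metis+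
      then show ?thesis using True by (simp add: ac_simps)
    qed (simp add: ac_simps)
  qed
  also have "\<dots> = (\<Sum>x\<le>b. \<Sum>y\<le>b. (b choose x) * (b choose y) * of_bool (a + b = c + x + y) *
       walks (a + c) (int b + int x - int y) * walks (a + c) (int b - int x + int y))"
    by (rule sum.swap)
  finally show ?thesis .
qed

text \<open>Given \<open>b\<close>, \<open>x\<close> and \<open>y\<close>, the position of the first
  fixed point is forced: \<open>a + c = N - b\<close> and \<open>a + b = c + x + y\<close> give 2 (a
  + b) = N + x + y. When this has no admissible solution, a walk number vanishes by parity or range,
  so the sum over \<open>a\<close> collapses to one term free of \<open>a\<close>.\<close>

lemma card_two_fixed_total:
  "(\<Sum>a<N+2. \<Sum>j\<in>{a<..<N+2}. card {XY \<in> ballot_pairs (N+2). fixat True XY a \<and> fixat False XY j}) =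
   two_fixed N"
proof -
  define F where "F b a x y = (b choose x) * (b choose y) * of_bool (a + b = N - b - a + x + y) *
       walks (N - b) (int b + int x - int y) * walks (N - b) (int b - int x + int y)" for a b x y
  define G where "G b x y = (b choose x) * (b choose y) *
       walks (N - b) (int b + int x - int y) * walks (N - b) (int b - int x + int y)" for b x y
  have "(\<Sum>a<N+2. \<Sum>j\<in>{a<..<N+2}. card {XY \<in> ballot_pairs (N+2). fixat True XY a \<and> fixat False XY j}) =
    (\<Sum>(a, j)\<in>(SIGMA a:{..<N+2}. {a<..<N+2}).
       card {XY \<in> ballot_pairs (N+2). fixat True XY a \<and> fixat False XY j})"
    by (subst sum.Sigma) auto
  also have "\<dots> = (\<Sum>(b, a)\<in>(SIGMA b:{..N}. {..N - b}).
       card {XY \<in> ballot_pairs (N+2). fixat True XY a \<and> fixat False XY (a + b + 1)})"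
    by (rule sum.reindex_bij_witness[of _ "\<lambda>(b, a). (a, a + b + 1)" "\<lambda>(a, j). (j - a - 1, a)"]) auto
  also have "\<dots> = (\<Sum>b\<le>N. \<Sum>a\<le>N - b.
       card {XY \<in> ballot_pairs (N+2). fixat True XY a \<and> fixat False XY (a + b + 1)})"
    by (subst sum.Sigma) auto
  also have "\<dots> = (\<Sum>b\<le>N. \<Sum>a\<le>N - b. \<Sum>x\<le>b. \<Sum>y\<le>b. F b a x y)"
  proof (intro sum.cong refl)
    fix b a assume ab: "b \<in> {..N}" "a \<in> {..N - b}"
    then have "N + 2 = a + b + (N - b - a) + 2" "a + (N - b - a) = N - b" by auto
    from card_two_fixed[OF this(1)] this(2) show
      "card {XY \<in> ballot_pairs (N+2). fixat True XY a \<and> fixat False XY (a + b + 1)} =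
        (\<Sum>x\<le>b. \<Sum>y\<le>b. F b a x y)" by (simp add: F_def)
  qed
  also have "\<dots> = (\<Sum>b\<le>N. \<Sum>x\<le>b. \<Sum>a\<le>N - b. \<Sum>y\<le>b. F b a x y)"
    by (intro sum.cong refl sum.swap)
  also have "\<dots> = (\<Sum>b\<le>N. \<Sum>x\<le>b. \<Sum>y\<le>b. \<Sum>a\<le>N - b. F b a x y)"
    by (intro sum.cong refl sum.swap)
  also have "\<dots> = (\<Sum>b\<le>N. \<Sum>x\<le>b. \<Sum>y\<le>b. G b x y)"
  proof (intro sum.cong refl)
    fix b x y assume *: "b \<in> {..N}" "x \<in> {..b}" "y \<in> {..b}"
    show "(\<Sum>a\<le>N - b. F b a x y) = G b x y"
    proof (cases "walks (N - b) (int b + int x - int y) = 0 \<or> walks (N - b) (int b - int x + int y) = 0")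
      case True
      then show ?thesis by (auto simp: F_def G_def)
    next
      case False
      have "int b + int x - int y \<le> int (N - b)" "int b - int x + int y \<le> int (N - b)"
        "even (int (N - b) - (int b + int x - int y))"
        using False walks_zero by (meson not_le_imp_less)+
      then have le: "b + x \<le> N - b + y" "b + y \<le> N - b + x" and ev: "even (N + x + y)" and "b \<le> N"
        using * by auto
      then obtain k where k: "N + x + y = 2 * k" by blast
      have kb: "b \<le> k" "k - b \<le> N - b" using le k * by auto
      have "(\<Sum>a\<le>N - b. F b a x y) = (\<Sum>a\<le>N - b. if a = k - b then G b x y else 0)"
      proof (intro sum.cong refl)
        fix a assume a: "a \<in> {..N - b}"
        have "a + b = N - b - a + x + y \<longleftrightarrow> a = k - b" using a k kb * by auto
        then show "F b a x y = (if a = k - b then G b x y else 0)"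
          by (simp add: F_def G_def)
      qed
      also have "\<dots> = G b x y" using kb by simp
      finally show ?thesis .
    qed
  qed
  finally show ?thesis by (simp add: two_fixed_def G_def)
qed

lemma card_one_fixed_total:
  "(\<Sum>a<m+1. card {XY \<in> ballot_pairs (m+1). fixat True XY a}) = (\<Sum>h\<in>{0..int m}. walks m h ^ 2)"
proof -
  have "(\<Sum>a<m+1. card {XY \<in> ballot_pairs (m+1). fixat True XY a}) =
    (\<Sum>a<m+1. if 2 * a + 1 \<le> m + 1 then walks m (int m - 2 * int a) ^ 2 else 0)"
    by (intro sum.cong refl) (use card_one_fixed[of _ "m + 1"] in auto)
  also have "\<dots> = (\<Sum>a\<in>{a. 2 * a \<le> m}. walks m (int m - 2 * int a) ^ 2)"
    by (rule sum.mono_neutral_cong_right) auto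
  also have "\<dots> = (\<Sum>h\<in>{h \<in> {0..int m}. even (int m - h)}. walks m h ^ 2)"
    by (rule sum.reindex_bij_witness[of _ "\<lambda>h. nat ((int m - h) div 2)" "\<lambda>a. int m - 2 * int a"]) auto
  also have "\<dots> = (\<Sum>h\<in>{0..int m}. walks m h ^ 2)"
    by (rule sum.mono_neutral_left) (auto simp: walks_zero)
  finally show ?thesis .
qed

section \<open>The crossing identity\<close>

definition W :: "nat \<Rightarrow> int \<Rightarrow> real" where "W m h = real (walks m h)"

text \<open>The lower index is an integer, so that it can be shifted along with the signed
  difference \<open>d\<close> of the two heights.\<close>

definition ibinom :: "nat \<Rightarrow> int \<Rightarrow> real" where
  "ibinom m k = (if k < 0 then 0 else real (m choose nat k))"

lemma ibinom_nonneg [simp]: "0 \<le> ibinom m k" by (simp add: ibinom_def)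

lemma ibinom_eq_0: "k < 0 \<or> int m < k \<Longrightarrow> ibinom m k = 0"
  by (auto simp: ibinom_def nat_less_iff intro!: binomial_eq_0)

lemma ibinom_Suc: "ibinom (Suc m) k = ibinom m k + ibinom m (k - 1)"
proof (cases "k \<le> 0")
  case False
  then have "nat k = Suc (nat (k - 1))" by simp
  then show ?thesis using False by (simp add: ibinom_def)
qed (auto simp: ibinom_def)

lemma ibinom_Suc_Suc: "ibinom (Suc (Suc m)) k = ibinom m k + 2 * ibinom m (k - 1) + ibinom m (k - 2)"
  by (simp add: ibinom_Suc)

lemma W_nonneg [simp]: "0 \<le> W m h" by (simp add: W_def)

lemma W_0: "W 0 h = of_bool (h = 0)" by (simp add: W_def)

lemma W_neg: "h < 0 \<Longrightarrow> W m h = 0"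
  by (simp add: W_def walks_zero)

lemma W_zero: "h < 0 \<or> int m < h \<or> odd (int m - h) \<Longrightarrow> W m h = 0"
  by (simp add: W_def walks_zero)

lemma W_nonzeroD: "W m h \<noteq> 0 \<Longrightarrow> 0 \<le> h \<and> h \<le> int m \<and> even (int m - h)"
  using W_zero[of h m] by linarith

lemma W_Suc: "0 \<le> h \<Longrightarrow> W (Suc m) h = W m (h - 1) + W m (h + 1)"
  by (simp add: W_def)

declare walks.simps [simp del]

lemma sum_int_shift:
  fixes f :: "int \<Rightarrow> real"
  assumes "\<And>d. d \<notin> {-L<..<L} \<Longrightarrow> f d = 0"
  shows "(\<Sum>d\<in>{-L..L}. f (d + 1)) = (\<Sum>d\<in>{-L..L}. f d)"
    and "(\<Sum>d\<in>{-L..L}. f (d - 1)) = (\<Sum>d\<in>{-L..L}. f d)"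
proof -
  have "(\<Sum>d\<in>{-L..L}. f (d + 1)) = (\<Sum>d\<in>{-L+1..L+1}. f d)"
    by (rule sum.reindex_bij_witness[of _ "\<lambda>d. d - 1" "\<lambda>d. d + 1"]) auto
  also have "\<dots> = (\<Sum>d\<in>{-L..L}. f d)"
    by (rule sum.mono_neutral_cong) (use assms in auto)
  finally show "(\<Sum>d\<in>{-L..L}. f (d + 1)) = (\<Sum>d\<in>{-L..L}. f d)" .
  have "(\<Sum>d\<in>{-L..L}. f (d - 1)) = (\<Sum>d\<in>{-L-1..L-1}. f d)"
    by (rule sum.reindex_bij_witness[of _ "\<lambda>d. d + 1" "\<lambda>d. d - 1"]) auto
  also have "\<dots> = (\<Sum>d\<in>{-L..L}. f d)"
    by (rule sum.mono_neutral_cong) (use assms in auto)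
  finally show "(\<Sum>d\<in>{-L..L}. f (d - 1)) = (\<Sum>d\<in>{-L..L}. f d)" .
qed

text \<open>The step operator is self-adjoint, so steps can be moved one at a time from one walk to
  the other. Combinatorially, a nonnegative closed path is cut after \<open>s\<close> steps.\<close>

lemma sum_W_mult:
  assumes "int (s + t) < L"
  shows "(\<Sum>h\<in>{-L..L}. W s h * W t h) = W (s + t) 0"
  using assms
proof (induction s arbitrary: t)
  case 0
  have "(\<Sum>h\<in>{-L..L}. W 0 h * W t h) = (\<Sum>h\<in>{0}. W 0 h * W t h)"
    by (rule sum.mono_neutral_right) (use 0 in \<open>auto simp: W_0\<close>)
  then show ?case by (simp add: W_0)
next
  case (Suc s)
  have "(\<Sum>h\<in>{-L..L}. W (Suc s) h * W t h) =
    (\<Sum>h\<in>{-L..L}. W s (h - 1) * W t (h - 1 + 1)) + (\<Sum>h\<in>{-L..L}. W s (h + 1) * W t (h + 1 - 1))"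
    unfolding sum.distrib[symmetric]
  proof (intro sum.cong refl)
    fix h show "W (Suc s) h * W t h = W s (h - 1) * W t (h - 1 + 1) + W s (h + 1) * W t (h + 1 - 1)"
      by (cases "h < 0") (auto simp: W_neg W_Suc algebra_simps)
  qed
  also have "(\<Sum>h\<in>{-L..L}. W s (h - 1) * W t (h - 1 + 1)) = (\<Sum>h\<in>{-L..L}. W s h * W t (h + 1))"
    by (rule sum_int_shift(2)[where f = "\<lambda>h. W s h * W t (h + 1)"]) (use Suc.prems in \<open>auto simp: W_zero\<close>)
  also have "(\<Sum>h\<in>{-L..L}. W s (h + 1) * W t (h + 1 - 1)) = (\<Sum>h\<in>{-L..L}. W s h * W t (h - 1))"
    by (rule sum_int_shift(1)[where f = "\<lambda>h. W s h * W t (h - 1)"]) (use Suc.prems in \<open>auto simp: W_zero\<close>)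
  also have "(\<Sum>h\<in>{-L..L}. W s h * W t (h + 1)) + (\<Sum>h\<in>{-L..L}. W s h * W t (h - 1)) =
      (\<Sum>h\<in>{-L..L}. W s h * W (Suc t) h)"
    unfolding sum.distrib[symmetric]
  proof (intro sum.cong refl)
    fix h show "W s h * W t (h + 1) + W s h * W t (h - 1) = W s h * W (Suc t) h"
      by (cases "h < 0") (auto simp: W_neg W_Suc algebra_simps)
  qed
  finally show ?case using Suc.IH[of "Suc t"] Suc.prems by simp
qed

lemma sum_W_square: "(\<Sum>h\<in>{0..int m}. W m h ^ 2) = W (2 * m) 0"
proof -
  let ?L = "int (m + m) + 1"
  have "(\<Sum>h\<in>{-?L..?L}. W m h * W m h) = W (m + m) 0"
    by (rule sum_W_mult) simp
  moreover have "(\<Sum>h\<in>{-?L..?L}. W m h * W m h) = (\<Sum>h\<in>{0..int m}. W m h * W m h)"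
    by (rule sum.mono_neutral_right) (auto simp: W_zero)
  ultimately show ?thesis by (simp only: power2_eq_square mult_2)
qed

text \<open>For \<open>s = b\<close> and \<open>M = N - b\<close> this counts the Dyck paths of semilength \<open>N\<close> marked at \<open>b\<close>: two walks end
  at heights \<open>s + d\<close> and \<open>s - d\<close>, and the binomial coefficient counts the \<open>2 b\<close> steps joining them, which are
  nonnegative automatically if \<open>s \<ge> b\<close>. The bound \<open>L\<close> only has to exceed the support of the walks.\<close>

definition pairsum :: "int \<Rightarrow> nat \<Rightarrow> nat \<Rightarrow> int \<Rightarrow> real" where
  "pairsum L b M s = (\<Sum>d\<in>{-L..L}. W M (s + d) * W M (s - d) * ibinom (2 * b) (int b + d))"

text \<open>The part of \<open>pairsum L (Suc b) M s\<close> in which the two additional middle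
  steps go in the same direction; opposite directions give
  \<open>2 * pairsum L b M s\<close>.\<close>

definition pairsum_rest :: "int \<Rightarrow> nat \<Rightarrow> nat \<Rightarrow> int \<Rightarrow> real" where
  "pairsum_rest L b M s = (\<Sum>d\<in>{-L..L}. W M (s + d) * W M (s - d) *
     (ibinom (2 * b) (int b + 1 + d) + ibinom (2 * b) (int b - 1 + d)))"

lemma pairsum_Suc: "pairsum L (Suc b) M s = 2 * pairsum L b M s + pairsum_rest L b M s"
proof -
  have "ibinom (2 * Suc b) (int (Suc b) + d) =
      2 * ibinom (2 * b) (int b + d) + (ibinom (2 * b) (int b + 1 + d) + ibinom (2 * b) (int b - 1 + d))" for d
    using ibinom_Suc_Suc[of "2 * b" "int b + 1 + d"] by (simp add: algebra_simps)
  then show ?thesis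
    unfolding pairsum_def pairsum_rest_def sum_distrib_left sum.distrib[symmetric]
    by (intro sum.cong refl) (simp add: algebra_simps)
qed

lemma W_mult_zero: "int M < \<bar>d\<bar> \<Longrightarrow> W M (s + d) * W M (s - d) = 0"
proof -
  assume "int M < \<bar>d\<bar>"
  then have "\<not> (0 \<le> s + d \<and> s + d \<le> int M \<and> 0 \<le> s - d \<and> s - d \<le> int M)" by linarith
  then show ?thesis using W_nonzeroD[of M "s + d"] W_nonzeroD[of M "s - d"] by auto
qed

text \<open>Split off the last step of both walks. If the two walks move alike, \<open>s\<close>
  changes by one and \<open>d\<close> is kept; if they move oppositely, \<open>d\<close> changes and
  the terms form \<open>pairsum_rest\<close>. By \<open>pairsum_Suc\<close> this rest is also what a
  longer middle part produces, so the difference is a second difference in \<open>s\<close>.\<close>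

lemma pairsum_step:
  assumes s: "int b + 1 \<le> s" and L: "int M < L"
  shows "pairsum L b (Suc M) s - pairsum L (Suc b) M s = pairsum L b M (s - 1) - 2 * pairsum L b M s + pairsum L b M (s + 1)"
proof -
  let ?c = "\<lambda>d. ibinom (2 * b) (int b + d)"
  define F where "F e = W M (s + e) * W M (s - e) * ibinom (2 * b) (int b + 1 + e)" for e
  define G where "G e = W M (s + e) * W M (s - e) * ibinom (2 * b) (int b - 1 + e)" for e
  have "W (Suc M) (s + d) * W (Suc M) (s - d) * ?c d =
      W M (s - 1 + d) * W M (s - 1 - d) * ?c d + W M (s + 1 + d) * W M (s + 1 - d) * ?c d
      + (F (d - 1) + G (d + 1))" for d
  proof (cases "s + d < 0 \<or> s - d < 0")
    case True
    \<comment> \<open>At negative heights, where the recursion of \<open>W\<close> fails, the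
      binomial coefficient vanishes because \<open>s\<close> exceeds \<open>b\<close>.\<close>
    then have "?c d = 0" using s by (intro ibinom_eq_0) auto
    moreover have "ibinom (2 * b) (int b + 1 + (d - 1)) = 0" "ibinom (2 * b) (int b - 1 + (d + 1)) = 0"
      using calculation by simp_all
    ultimately show ?thesis by (simp add: F_def G_def del: add_diff_cancel diff_add_cancel)
  next
    case False
    then show ?thesis by (simp add: W_Suc F_def G_def algebra_simps)
  qed
  then have "pairsum L b (Suc M) s = pairsum L b M (s - 1) + pairsum L b M (s + 1) +
      ((\<Sum>d\<in>{-L..L}. F (d - 1)) + (\<Sum>d\<in>{-L..L}. G (d + 1)))"
    unfolding pairsum_def sum.distrib[symmetric] by simp
  moreover have "(\<Sum>d\<in>{-L..L}. F (d - 1)) = sum F {-L..L}"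
  proof (rule sum_int_shift(2))
    fix d assume "d \<notin> {-L<..<L}"
    then have "int M < \<bar>d\<bar>" using L by auto
    then show "F d = 0" using W_mult_zero[of M d s] by (simp add: F_def)
  qed
  moreover have "(\<Sum>d\<in>{-L..L}. G (d + 1)) = sum G {-L..L}"
  proof (rule sum_int_shift(1))
    fix d assume "d \<notin> {-L<..<L}"
    then have "int M < \<bar>d\<bar>" using L by auto
    then show "G d = 0" using W_mult_zero[of M d s] by (simp add: G_def)
  qed
  moreover have "sum F {-L..L} + sum G {-L..L} = pairsum_rest L b M s"
    unfolding pairsum_rest_def F_def G_def sum.distrib[symmetric] by (simp add: algebra_simps)
  ultimately show ?thesis using pairsum_Suc[of L b M s] by linarith
qed

lemma pairsum_zero: "int M < s \<Longrightarrow> pairsum L b M s = 0"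
  unfolding pairsum_def
proof (intro sum.neutral ballI)
  fix d assume "int M < s" 
  then show "W M (s + d) * W M (s - d) * ibinom (2 * b) (int b + d) = 0"
    by (cases "d \<ge> 0") (auto simp: W_zero)
qed

lemma sum_second_difference:
  fixes f :: "int \<Rightarrow> real"
  assumes "a \<le> K"
  shows "(\<Sum>s\<in>{a+1..K}. f (s - 1) - 2 * f s + f (s + 1)) = f a - f (a + 1) - f K + f (K + 1)"
  using assms
proof (induction K rule: int_ge_induct)
  case (step K)
  then have "{a+1..K+1} = insert (K + 1) {a+1..K}" by auto
  then show ?case using step by simp
qed auto

text \<open>Counts the Dyck paths whose difference walk (see the top of the theory) is still negative at \<open>b\<close>.\<close>

definition tailsum :: "int \<Rightarrow> nat \<Rightarrow> nat \<Rightarrow> real" where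
  "tailsum L N b = (\<Sum>s\<in>{int b + 1..int N + 1}. pairsum L b (N - b) s)"

text \<open>Summed over \<open>s > b\<close>, the second differences of \<open>pairsum_step\<close>
  telescope to the boundary at \<open>s = b\<close>; the other end lies beyond the support. The
  remaining term is \<open>s = b + 1\<close>, which leaves the range of summation when
  \<open>b\<close> grows.\<close>

lemma tailsum_diff:
  assumes "b < N" "int N < L"
  shows "tailsum L N b - tailsum L N (Suc b) =
    pairsum L (Suc b) (N - Suc b) (int (Suc b)) + pairsum L b (N - 1 - b) (int b) - pairsum L b (N - Suc b) (int (Suc b))"
proof -
  let ?M = "N - Suc b"
  have M: "N - b = Suc ?M" "N - 1 - b = ?M" using assms by auto
  have "tailsum L N (Suc b) = (\<Sum>s\<in>{int b + 1..int N + 1}. pairsum L (Suc b) ?M s) - pairsum L (Suc b) ?M (int b + 1)"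
  proof -
    have "{int b + 1..int N + 1} = insert (int b + 1) {int (Suc b) + 1..int N + 1}"
      using assms by auto
    then show ?thesis by (simp add: tailsum_def)
  qed
  then have "tailsum L N b - tailsum L N (Suc b) =
      (\<Sum>s\<in>{int b + 1..int N + 1}. pairsum L b (Suc ?M) s - pairsum L (Suc b) ?M s) + pairsum L (Suc b) ?M (int b + 1)"
    by (simp add: tailsum_def M sum_subtractf)
  also have "(\<Sum>s\<in>{int b + 1..int N + 1}. pairsum L b (Suc ?M) s - pairsum L (Suc b) ?M s) =
      (\<Sum>s\<in>{int b + 1..int N + 1}. pairsum L b ?M (s - 1) - 2 * pairsum L b ?M s + pairsum L b ?M (s + 1))"
    by (intro sum.cong refl pairsum_step) (use assms in auto)
  also have "\<dots> = pairsum L b ?M (int b) - pairsum L b ?M (int b + 1)"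
    using assms by (subst sum_second_difference) (auto simp: pairsum_zero)
  finally show ?thesis by (simp add: M add.commute)
qed

definition diagsum :: "int \<Rightarrow> nat \<Rightarrow> real" where
  "diagsum L N = (\<Sum>b\<le>N. pairsum L b (N - b) (int b))"

definition restsum :: "int \<Rightarrow> nat \<Rightarrow> real" where
  "restsum L N = (\<Sum>b<N. pairsum_rest L b (N - Suc b) (int (Suc b)))"

lemma pairsum_0: "0 \<le> L \<Longrightarrow> pairsum L 0 M s = W M s ^ 2"
proof -
  assume "0 \<le> L"
  have "pairsum L 0 M s = (\<Sum>d\<in>{0}. W M (s + d) * W M (s - d) * ibinom 0 d)"
    unfolding pairsum_def using \<open>0 \<le> L\<close>
    by (intro sum.mono_neutral_cong_right) (auto simp: ibinom_def nat_eq_iff2 binomial_eq_0)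
  then show ?thesis by (simp add: ibinom_def power2_eq_square)
qed

text \<open>Telescoping the tail sums accounts for all Dyck paths with positive height in the
  middle, C_N - w_N(0)^2 of them. The unwanted sum \<open>?z\<close> is half of
  \<open>diagsum L N - W N 0 ^ 2 - restsum L N\<close> by \<open>pairsum_Suc\<close>; eliminating it
  is the origin of the factors 2.\<close>

lemma diagsum_identity:
  assumes "0 < N" "int N < L"
  shows "2 * W (2 * N) 0 = diagsum L N + 2 * diagsum L (N - 1) + W N 0 ^ 2 + restsum L N"
proof -
  let ?z = "\<Sum>b<N. pairsum L b (N - Suc b) (int (Suc b))"
  have "tailsum L N 0 - tailsum L N N = (\<Sum>b<N. tailsum L N b - tailsum L N (Suc b))"
    by (rule sum_lessThan_telescope'[symmetric])
  also have "\<dots> = (\<Sum>b<N. pairsum L (Suc b) (N - Suc b) (int (Suc b)) + pairsum L b (N - 1 - b) (int b) -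
      pairsum L b (N - Suc b) (int (Suc b)))"
    by (intro sum.cong refl tailsum_diff) (use assms in auto)
  also have "\<dots> = (\<Sum>b<N. pairsum L (Suc b) (N - Suc b) (int (Suc b))) + (\<Sum>b<N. pairsum L b (N - 1 - b) (int b)) - ?z"
    by (simp add: sum.distrib sum_subtractf)
  also have "(\<Sum>b<N. pairsum L b (N - 1 - b) (int b)) = diagsum L (N - 1)"
    using assms by (simp add: diagsum_def lessThan_Suc_atMost[symmetric])
  finally have 1: "tailsum L N 0 - tailsum L N N =
      (\<Sum>b<N. pairsum L (Suc b) (N - Suc b) (int (Suc b))) + diagsum L (N - 1) - ?z" .
  have 2: "diagsum L N = W N 0 ^ 2 + (\<Sum>b<N. pairsum L (Suc b) (N - Suc b) (int (Suc b)))"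
    using assms by (simp add: diagsum_def sum.atMost_shift pairsum_0)
  have 3: "(\<Sum>b<N. pairsum L (Suc b) (N - Suc b) (int (Suc b))) = 2 * ?z + restsum L N"
    by (simp add: pairsum_Suc sum.distrib sum_distrib_left restsum_def)
  have 4: "tailsum L N N = 0" by (simp add: tailsum_def pairsum_zero)
  have "tailsum L N 0 = (\<Sum>s\<in>{1..int N + 1}. W N s ^ 2)"
    using assms by (simp add: tailsum_def pairsum_0)
  also have "\<dots> = (\<Sum>s\<in>{0..int N} - {0}. W N s ^ 2)"
    by (rule sum.mono_neutral_right) (auto dest: W_nonzeroD)
  also have "\<dots> = W (2 * N) 0 - W N 0 ^ 2"
    unfolding sum_W_square[symmetric] by (subst sum_diff1) auto
  finally show ?thesis using 1 2 3 4 by linarith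
qed

text \<open>Reflecting \<open>y\<close> to \<open>b - y\<close> turns the difference into a sum, to
  which Vandermonde's convolution applies.\<close>

lemma vandermonde_diff:
  fixes g :: "int \<Rightarrow> real"
  shows "(\<Sum>x\<le>b. \<Sum>y\<le>b. real (b choose x) * real (b choose y) * g (int x - int y)) =
    (\<Sum>k\<le>2 * b. real (2 * b choose k) * g (int k - int b))"
proof -
  have "(\<Sum>x\<le>b. \<Sum>y\<le>b. real (b choose x) * real (b choose y) * g (int x - int y)) =
    (\<Sum>x\<le>b. \<Sum>y\<le>b. real (b choose x) * real (b choose y) * g (int x + int y - int b))"
  proof (rule sum.cong[OF refl])
    fix x
    show "(\<Sum>y\<le>b. real (b choose x) * real (b choose y) * g (int x - int y)) =
      (\<Sum>y\<le>b. real (b choose x) * real (b choose y) * g (int x + int y - int b))"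
      by (rule sum.reindex_bij_witness[of _ "\<lambda>y. b - y" "\<lambda>y. b - y"])
         (auto simp: binomial_symmetric[symmetric] of_nat_diff algebra_simps)
  qed
  also have "\<dots> = (\<Sum>(x, y)\<in>{..b} \<times> {..b}. real (b choose x) * real (b choose y) * g (int x + int y - int b))"
    by (simp add: sum.cartesian_product)
  finally have 1: "(\<Sum>x\<le>b. \<Sum>y\<le>b. real (b choose x) * real (b choose y) * g (int x - int y)) =
    (\<Sum>(x, y)\<in>{..b} \<times> {..b}. real (b choose x) * real (b choose y) * g (int x + int y - int b))" .
  have fin: "finite {(k, x) \<in> (SIGMA k:{..2 * b}. {..k}). b < x \<or> b < k - x}"
    by (rule finite_subset[of _ "SIGMA k:{..2 * b}. {..k}"]) auto
  have "(\<Sum>(x, y)\<in>{..b} \<times> {..b}. real (b choose x) * real (b choose y) * g (int x + int y - int b)) =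
      (\<Sum>(k, x)\<in>(SIGMA k:{..2 * b}. {..k}).
      real (b choose x) * real (b choose (k - x)) * g (int k - int b))"
    by (rule sum.reindex_bij_witness_not_neutral[where S' = "{}" and
          T' = "{(k, x) \<in> (SIGMA k:{..2 * b}. {..k}). b < x \<or> b < k - x}" and
          i = "\<lambda>(k, x). (x, k - x)" and j = "\<lambda>(x, y). (x + y, x)"])
       (use fin in \<open>auto simp: binomial_eq_0\<close>)
  also have "\<dots> = (\<Sum>k\<le>2 * b. \<Sum>x\<le>k. real (b choose x) * real (b choose (k - x)) * g (int k - int b))"
    by (subst sum.Sigma) auto
  also have "\<dots> = (\<Sum>k\<le>2 * b. real (2 * b choose k) * g (int k - int b))"
  proof (rule sum.cong[OF refl])
    fix k
    have "(\<Sum>x\<le>k. real (b choose x) * real (b choose (k - x))) = real ((b + b) choose k)"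
      unfolding vandermonde[of b b k, symmetric] by simp
    then show "(\<Sum>x\<le>k. real (b choose x) * real (b choose (k - x)) * g (int k - int b)) =
        real (2 * b choose k) * g (int k - int b)"
      by (simp add: sum_distrib_right[symmetric] mult_2)
  qed
  finally show ?thesis using 1 by simp
qed

text \<open>The walks in \<open>two_fixed\<close> depend on \<open>x\<close> and \<open>y\<close>
  only through \<open>x - y\<close>, so the two middle blocks merge into one of length
  \<open>2 * b\<close>.\<close>

lemma two_fixed_eq_diagsum:
  assumes "int N \<le> L" shows "real (two_fixed N) = diagsum L N"
proof -
  have "(\<Sum>x\<le>b. \<Sum>y\<le>b. real (b choose x) * real (b choose y) * 
     W (N - b) (int b + int x - int y) * W (N - b) (int b - int x + int y)) = pairsum L b (N - b) (int b)"
    if "b \<le> N" for b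
  proof -
    have "(\<Sum>x\<le>b. \<Sum>y\<le>b. real (b choose x) * real (b choose y) * 
       W (N - b) (int b + int x - int y) * W (N - b) (int b - int x + int y)) =
      (\<Sum>x\<le>b. \<Sum>y\<le>b. real (b choose x) * real (b choose y) * 
       (\<lambda>d. W (N - b) (int b + d) * W (N - b) (int b - d)) (int x - int y))"
      by (intro sum.cong refl) (simp add: algebra_simps)
    also have "\<dots> = (\<Sum>k\<le>2 * b. real (2 * b choose k) *
       (W (N - b) (int b + (int k - int b)) * W (N - b) (int b - (int k - int b))))"
      by (rule vandermonde_diff)
    also have "\<dots> = pairsum L b (N - b) (int b)"
      unfolding pairsum_def using that assms
      by (intro sum.reindex_bij_witness_not_neutral[where S' = "{}" and T' = "{-L..L} - {-int b..int b}" and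
          j = "\<lambda>k. int k - int b" and i = "\<lambda>d. nat (d + int b)"])
         (auto simp: ibinom_eq_0 ibinom_def algebra_simps)
    finally show ?thesis .
  qed
  then show ?thesis by (simp add: two_fixed_def diagsum_def W_def)
qed

section \<open>Upper bounds by comparison with Catalan numbers\<close>

declare binomial_Suc_Suc [simp del]

lemma ibinom_symmetric: "ibinom m k = ibinom m (int m - k)"
proof (cases "0 \<le> k \<and> k \<le> int m")
  case True
  then have "nat (int m - k) = m - nat k" "nat k \<le> m" by auto
  then show ?thesis using True binomial_symmetric[of "nat k" m] by (simp add: ibinom_def)
next
  case False
  then show ?thesis using ibinom_eq_0[of k m] ibinom_eq_0[of "int m - k" m] by auto
qed

lemma W_eq_diff:
  "- 1 \<le> h \<Longrightarrow> int m = 2 * j + h \<Longrightarrow> W m h = ibinom m j - ibinom m (j - 1)"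
proof (induction m arbitrary: h j)
  case 0
  show ?case
  proof (cases "h = 0")
    case True
    then have "j = 0" using 0 by simp
    then show ?thesis using True by (simp add: W_0 ibinom_def)
  next
    case False
    then have "j \<noteq> 0" "j \<noteq> 1" using 0 by auto
    then have "ibinom 0 j = 0" "ibinom 0 (j - 1) = 0" using 0 by (auto intro!: ibinom_eq_0)
    then show ?thesis using False by (simp add: W_0)
  qed
next
  case (Suc m)
  show ?case
  proof (cases "h = -1")
    case True
    then have "int (Suc m) - j = j - 1" using Suc.prems by simp
    then have "ibinom (Suc m) j = ibinom (Suc m) (j - 1)" using ibinom_symmetric[of "Suc m" j] by metis
    then show ?thesis using True by (simp add: W_neg)
  next
    case False
    then have "0 \<le> h" using Suc.prems by simp
    moreover have "W m (h - 1) = ibinom m j - ibinom m (j - 1)"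
      by (rule Suc.IH) (use Suc.prems False in auto)
    moreover have "W m (h + 1) = ibinom m (j - 1) - ibinom m (j - 1 - 1)"
      by (rule Suc.IH) (use Suc.prems False in auto)
    ultimately show ?thesis by (simp add: W_Suc ibinom_Suc)
  qed
qed

text \<open>In this form of the ballot numbers the height enters as a factor and through a single
  binomial coefficient, so walks can be compared by comparing binomial coefficients.\<close>

lemma W_ballot:
  "real (2 * q + h + 1) * W (2 * q + h) (int h) = real (h + 1) * real (2 * q + h + 1 choose q)"
proof -
  let ?m = "2 * q + h"
  have W: "W ?m (int h) = ibinom ?m (int q) - ibinom ?m (int q - 1)"
    by (rule W_eq_diff) auto
  show ?thesis
  proof (cases q)
    case 0
    then show ?thesis using W by (simp add: ibinom_def)
  next
    case (Suc q')
    have 1: "real (Suc q') * real (Suc ?m choose Suc q') = real (Suc ?m) * real (?m choose q')"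
      using Suc_times_binomial_eq[of ?m q'] by (metis of_nat_mult mult.commute)
    have "ibinom ?m (int q) = real (?m choose q)" by (simp add: ibinom_def)
    moreover have "ibinom ?m (int q - 1) = real (?m choose q')" using Suc by (simp add: ibinom_def)
    moreover have "real (Suc ?m choose q) = real (?m choose q') + real (?m choose q)"
      using binomial_Suc_Suc[of ?m q'] Suc by simp
    ultimately have W': "W ?m (int h) = real (Suc ?m choose q) - 2 * real (?m choose q')"
      unfolding W by simp
    have "real (?m + 1) * W ?m (int h) = real (Suc ?m) * real (Suc ?m choose q) - 
        2 * (real (Suc ?m) * real (?m choose q'))"
      unfolding W' by (simp add: algebra_simps)
    also have "\<dots> = (real (Suc ?m) - 2 * real q) * real (Suc ?m choose q)"
      unfolding 1[symmetric] Suc[symmetric] by (simp add: algebra_simps)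
    also have "real (Suc ?m) - 2 * real q = real (h + 1)" by simp
    finally show ?thesis by simp
  qed
qed

section \<open>Catalan numbers and central binomial coefficients\<close>

definition catal :: "nat \<Rightarrow> real" where "catal n = W (2 * n) 0"

text \<open>The maximum of row \<open>N + 1\<close>, because \<open>W_ballot\<close> expresses walks
  of length \<open>N\<close> through that row.\<close>

definition central :: "nat \<Rightarrow> real" where "central N = real (N + 1 choose ((N + 1) div 2))"

text \<open>The factors are the ratios of consecutive terms of \<open>2\<^sup>b w\<^sub>N\<^sub>-\<^sub>b(b) / (b + 1)\<close>.\<close>

definition tau :: "nat \<Rightarrow> nat \<Rightarrow> real" where
  "tau N b = (\<Prod>i<b. (real N - 2 * real i) / (real N - real i))"

lemma catal_eq: "real (2 * n + 1) * catal n = real (2 * n + 1 choose n)"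
  using W_ballot[of n 0] by (simp add: catal_def)

lemma catal_pos: "0 < catal n"
proof -
  have "0 < real (2 * n + 1) * catal n" unfolding catal_eq by simp
  then show ?thesis by (simp add: zero_less_mult_iff)
qed

lemma catal_Suc: "real (n + 2) * catal (Suc n) = real (2 * (2 * n + 1)) * catal n"
proof -
  let ?B = "real (2 * n + 1 choose n)"
  have a: "(2 * n + 2 choose Suc n) * Suc n = (2 * n + 2) * (2 * n + 1 choose n)"
    using Suc_times_binomial_eq[of "2 * n + 1" n] by (simp add: mult.commute)
  have b: "(2 * n + 3 choose Suc n) * (n + 2) = (2 * n + 3) * (2 * n + 2 choose Suc n)"
  proof -
    have "Suc (2 * n + 2 - Suc n) * (Suc (2 * n + 2) choose Suc n) = Suc (2 * n + 2) * (2 * n + 2 choose Suc n)"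
      using Suc_times_binomial_eq[of "2 * n + 2" "n + 1"] binomial_symmetric[of "Suc n" "2 * n + 3"]
        binomial_symmetric[of "Suc n" "2 * n + 2"] by (simp add: eval_nat_numeral)
    then show ?thesis by (simp add: eval_nat_numeral mult.commute)
  qed
  have a': "real (2 * n + 2 choose Suc n) * real (Suc n) = real (2 * n + 2) * ?B"
    using a by (metis of_nat_mult)
  have b': "real (2 * n + 3 choose Suc n) * real (n + 2) = real (2 * n + 3) * real (2 * n + 2 choose Suc n)"
    using b by (metis of_nat_mult)
  have A: "real (2 * n + 2 choose Suc n) = 2 * ?B"
  proof -
    have "x = 2 * y" if "x * real (Suc n) = real (2 * n + 2) * y" for x y :: real
    proof -
      have "(x - 2 * y) * real (Suc n) = 0" using that by (simp add: algebra_simps)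
      then show ?thesis by simp
    qed
    then show ?thesis using a' by blast
  qed
  have c: "real (2 * n + 3) * catal (Suc n) = real (2 * n + 3 choose Suc n)"
    using catal_eq[of "Suc n"] by (simp add: eval_nat_numeral)
  have "real (2 * n + 3) * (real (n + 2) * catal (Suc n)) = real (n + 2) * real (2 * n + 3 choose Suc n)"
    using c by (simp only: mult.left_commute mult.assoc)
  also have "\<dots> = real (2 * n + 3) * (2 * ?B)" using b' A by (simp only: mult.commute)
  finally have "real (n + 2) * catal (Suc n) = 2 * ?B" by simp
  then show ?thesis unfolding catal_eq[symmetric] by simp
qed

text \<open>The step multiplies the left side by 4 (2 n + 1) (2 n + 3) / (n + 1)^2, which is at most
  16 because (2 n + 1) (2 n + 3) is less than (2 n + 2)^2.\<close>

lemma central_binomial_upper: "real (2 * n choose n) ^ 2 * real (2 * n + 1) \<le> 16 ^ n"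
proof (induction n)
  case (Suc n)
  let ?B = "real (2 * n choose n)"
  have "real (Suc n) * real (2 * Suc n choose Suc n) = 2 * real (2 * n + 1) * ?B"
  proof -
    have "Suc n * (2 * Suc n choose Suc n) = (2 * Suc n) * (2 * n + 1 choose n)"
      using Suc_times_binomial_eq[of "2 * n + 1" n] by simp
    moreover have "Suc n * (2 * n + 1 choose n) = (2 * n + 1) * (2 * n choose n)"
      using Suc_times_binomial_eq[of "2 * n" n] binomial_symmetric[of n "2 * n + 1"] by simp
    ultimately have "Suc n * (Suc n * (2 * Suc n choose Suc n)) = Suc n * (2 * (2 * n + 1) * (2 * n choose n))"
      by (metis (no_types, opaque_lifting) mult.assoc mult.left_commute)
    then have "Suc n * (2 * Suc n choose Suc n) = 2 * (2 * n + 1) * (2 * n choose n)"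
      by (simp only: mult_cancel1) simp
    then show ?thesis by (metis of_nat_mult of_nat_numeral)
  qed
  then have "real (2 * Suc n choose Suc n) = 2 * real (2 * n + 1) * ?B / real (Suc n)"
    by (simp add: field_simps)
  moreover have "(2 * u * x / k) ^ 2 * v = (x ^ 2 * u) * (4 * u * v / k ^ 2)" for u v k x :: real
    by (simp add: power2_eq_square)
  moreover have "real (2 * Suc n + 1) = real (2 * n + 3)" by simp
  ultimately have "real (2 * Suc n choose Suc n) ^ 2 * real (2 * Suc n + 1) =
      (?B ^ 2 * real (2 * n + 1)) * (4 * real (2 * n + 1) * real (2 * n + 3) / real (Suc n) ^ 2)"
    by (simp only:)
  also have "\<dots> \<le> 16 ^ n * 16"
  proof (rule mult_mono[OF Suc.IH])
    have "4 * real (2 * n + 1) * real (2 * n + 3) \<le> 16 * real (Suc n) ^ 2"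
      by (simp add: power2_eq_square algebra_simps)
    then show "4 * real (2 * n + 1) * real (2 * n + 3) / real (Suc n) ^ 2 \<le> 16"
      by (simp add: divide_le_eq)
  qed auto
  finally show ?case by simp
qed auto

lemma central_upper: "central N ^ 2 * real (N + 2) \<le> 4 ^ (N + 1)"
proof (cases "even (N + 1)")
  case True
  then obtain n where n: "N + 1 = 2 * n" by blast
  have "central N = real (2 * n choose n)" unfolding central_def n by simp
  moreover have "real (N + 2) = real (2 * n + 1)" using n by simp
  moreover have "(4::real) ^ (N + 1) = 16 ^ n" unfolding n by (simp add: power_mult)
  ultimately show ?thesis using central_binomial_upper[of n] by simp
next
  case False
  then obtain n where n: "N = 2 * n" by auto
  have c: "central N = real (2 * n + 1 choose n)" by (simp add: central_def n)
  have "(2 * Suc n choose Suc n) = 2 * (2 * n + 1 choose n)"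
    using binomial_Suc_Suc[of "2 * n + 1" n] binomial_symmetric[of n "2 * n + 1"] by simp
  then have c2: "2 * central N = real (2 * Suc n choose Suc n)" unfolding c by simp
  have "4 * (central N ^ 2 * real (N + 2)) \<le> (2 * central N) ^ 2 * real (2 * Suc n + 1)"
    by (simp add: n power_mult_distrib mult_left_mono)
  also have "\<dots> \<le> 16 ^ Suc n" unfolding c2 by (rule central_binomial_upper)
  also have "\<dots> = 4 * (4::real) ^ (N + 1)" unfolding n by (simp add: power_mult)
  finally show ?thesis by (rule mult_left_le_imp_le) simp
qed

lemma catal_lower: "0 < N \<Longrightarrow> 4 ^ N \<le> 2 * real N * real (N + 1) * catal N"
proof -
  assume "0 < N"
  have "Suc N * (2 * N + 1 choose N) = (2 * N + 1) * (2 * N choose N)"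
    using Suc_times_binomial_eq[of "2 * N" N] binomial_symmetric[of N "2 * N + 1"] by simp
  then have "real (Suc N) * real (2 * N + 1 choose N) = real (2 * N + 1) * real (2 * N choose N)"
    by (metis of_nat_mult)
  then have "real (2 * N + 1) * (real (N + 1) * catal N) = real (2 * N + 1) * real (2 * N choose N)"
    unfolding catal_eq[symmetric] by simp
  then have "real (N + 1) * catal N = real (2 * N choose N)" by simp
  moreover have "4 ^ N / (2 * real N) \<le> real (2 * N choose N)"
    using central_binomial_lower_bound[OF \<open>0 < N\<close>] by simp
  ultimately have "4 ^ N / (2 * real N) \<le> real (N + 1) * catal N" by simp
  then have "4 ^ N \<le> real (N + 1) * catal N * (2 * real N)"
    using \<open>0 < N\<close> by (subst (asm) pos_divide_le_eq) auto
  then show ?thesis by (simp only: mult_ac)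
qed

text \<open>Makes any fixed number of error terms negligible against \<open>catal N\<close>. The
  true ratio has order N^(-3/2), but the order 1 / N from crude bounds is enough.\<close>

lemma central_small: "0 < N \<Longrightarrow> (central N / real (N + 1)) ^ 2 \<le> 8 / real (N + 1) * catal N"
proof -
  assume N: "0 < N"
  have "central N ^ 2 * real (N + 2) \<le> 4 * (2 * real N * real (N + 1) * catal N)"
    using central_upper[of N] catal_lower[OF N] by simp
  also have "\<dots> = 8 * real N * (real (N + 1) * catal N)" by simp
  also have "\<dots> \<le> 8 * real (N + 2) * (real (N + 1) * catal N)"
    using catal_pos[of N] by (intro mult_right_mono) auto
  finally have "real (N + 2) * central N ^ 2 \<le> real (N + 2) * (8 * real (N + 1) * catal N)"
    by (simp only: mult_ac)
  then have "central N ^ 2 \<le> 8 * real (N + 1) * catal N" by (rule mult_left_le_imp_le) simp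
  then have le: "central N ^ 2 / real (N + 1) ^ 2 \<le> 8 * real (N + 1) * catal N / real (N + 1) ^ 2"
    by (rule divide_right_mono) simp
  have "8 * k * c / k ^ 2 = 8 / k * c" if "0 < k" for k c :: real
    using that by (simp add: power2_eq_square)
  from this[of "real (N + 1)" "catal N"]
  have eq: "8 * real (N + 1) * catal N / real (N + 1) ^ 2 = 8 / real (N + 1) * catal N"
    by linarith
  show ?thesis using le unfolding eq power_divide .
qed

lemma central_max: "real (N + 1 choose k) \<le> central N"
  unfolding central_def by (intro of_nat_mono binomial_maximum)

section \<open>Termwise bounds for products of walks\<close>

lemma tau_Suc: "tau N (Suc b) = tau N b * ((real N - 2 * real b) / (real N - real b))"
  by (simp add: tau_def)

lemma tau_0 [simp]: "tau N 0 = 1" by (simp add: tau_def)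

lemma tau_nonneg: "2 * b \<le> N \<Longrightarrow> 0 \<le> tau N b"
  unfolding tau_def by (intro prod_nonneg ballI divide_nonneg_nonneg) auto

lemma tau_decreasing: "2 * Suc b \<le> N \<Longrightarrow> tau N (Suc b) \<le> tau N b"
  unfolding tau_Suc by (intro mult_left_le tau_nonneg) (auto simp: divide_le_eq)

lemma tau_le_1: "2 * b \<le> N \<Longrightarrow> tau N b \<le> 1"
proof (induction b)
  case (Suc b)
  then show ?case using tau_decreasing[of b N] by simp
qed simp

text \<open>Absorption passes from row \<open>N - b\<close> to row \<open>N - b + 1\<close> at the
  price of (q + 1) (q' + 1). The sum of these factors is \<open>N - 2 * b\<close>, so four times
  their product is at most its square, and the quotient by the square of \<open>N - b\<close> is the
  square of a factor of \<open>tau\<close>. The factor 4 per step is the growth of the row sums of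
  length \<open>2 * b\<close>.\<close>

lemma binomial_mult_tau:
  "q + q' + 2 * b = N \<Longrightarrow>
   4 ^ b * real (N + 1 - b choose q) * real (N + 1 - b choose q') / real (N + 1 - b) ^ 2
     \<le> (tau N b * central N / real (N + 1)) ^ 2"
proof (induction b arbitrary: q q')
  case 0
  have "real (N + 1 choose q) * real (N + 1 choose q') \<le> central N * central N"
    by (intro mult_mono central_max) (auto simp: central_def)
  then show ?case by (simp add: power_divide power2_eq_square divide_right_mono)
next
  case (Suc b)
  define n where "n = N - b"
  have bN: "b < N" "n \<ge> 1" "N + 1 - b = Suc n" "N + 1 - Suc b = n" using Suc.prems by (auto simp: n_def)
  have bin: "real (n choose p) = real (Suc p) * real (Suc n choose Suc p) / real (Suc n)" for p
  proof -
    have "real (Suc p) * real (Suc n choose Suc p) = real (Suc n) * real (n choose p)"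
      using Suc_times_binomial_eq[of n p] by (metis of_nat_mult mult.commute)
    then show ?thesis by (simp add: field_simps)
  qed
  let ?X = "4 ^ b * real (Suc n choose Suc q) * real (Suc n choose Suc q') / real (Suc n) ^ 2"
  have X0: "0 \<le> ?X" by simp
  have IH: "?X \<le> (tau N b * central N / real (N + 1)) ^ 2"
  proof -
    have "Suc q + Suc q' + 2 * b = N" using Suc.prems by presburger
    from Suc.IH[OF this] show ?thesis unfolding bN(3) .
  qed
  have "4 ^ Suc b * real (n choose q) * real (n choose q') / real n ^ 2 =
      4 * (real (Suc q) * real (Suc q')) / real n ^ 2 * ?X"
    unfolding bin by (simp add: power2_eq_square mult_ac)
  also have "\<dots> \<le> (real N - 2 * real b) ^ 2 / real n ^ 2 * ?X"
  proof (intro mult_right_mono divide_right_mono X0)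
    have "real N = real (q + q' + 2 * Suc b)" using Suc.prems by simp
    then have "real N - 2 * real b = real (Suc q) + real (Suc q')" by simp
    moreover have "4 * (x * y) \<le> (x + y) ^ 2" for x y :: real
    proof -
      have "(x + y) ^ 2 - 4 * (x * y) = (x - y) ^ 2" by (simp add: power2_eq_square algebra_simps)
      then show ?thesis using zero_le_power2[of "x - y"] by linarith
    qed
    ultimately show "4 * (real (Suc q) * real (Suc q')) \<le> (real N - 2 * real b) ^ 2" by metis
  qed auto
  also have "\<dots> \<le> (real N - 2 * real b) ^ 2 / real n ^ 2 * (tau N b * central N / real (N + 1)) ^ 2"
    by (intro mult_left_mono IH) simp
  also have "\<dots> = (tau N (Suc b) * central N / real (N + 1)) ^ 2"
    using bN by (simp add: tau_Suc n_def of_nat_diff power_mult_distrib power_divide)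
  finally show ?case unfolding bN(4) .
qed

text \<open>A substitute for the square of \<open>W N b\<close> without its parity restriction: by
  \<open>W_ballot\<close> that square has this form with a binomial coefficient in place of
  \<open>tau N b * central N\<close>.\<close>

definition pair_bound :: "nat \<Rightarrow> nat \<Rightarrow> real" where
  "pair_bound N b = (real (b + 1) * tau N b * central N / real (N + 1)) ^ 2"

lemma pair_bound_nonneg [simp]: "0 \<le> pair_bound N b" by (simp add: pair_bound_def)

text \<open>The heights \<open>h\<close> and \<open>k\<close> add up to \<open>2 * b\<close>, so (h
  + 1) (k + 1) is largest for h = k = b, and \<open>binomial_mult_tau\<close> bounds the binomial
  coefficients. The result does not depend on \<open>d\<close>.\<close>

lemma W_mult_bound:
  assumes "b \<le> N" "W (N - b) (int b + d) * W (N - b) (int b - d) \<noteq> 0"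
  shows "2 * b \<le> N \<and> even (d + int N) \<and>
     4 ^ b * (W (N - b) (int b + d) * W (N - b) (int b - d)) \<le> pair_bound N b"
proof -
  let ?M = "N - b"
  have 1: "0 \<le> int b + d" "int b + d \<le> int ?M" "even (int ?M - (int b + d))"
    and 2: "0 \<le> int b - d" "int b - d \<le> int ?M" "even (int ?M - (int b - d))"
    using assms(2) W_nonzeroD[of ?M "int b + d"] W_nonzeroD[of ?M "int b - d"] by auto
  define h k where "h = nat (int b + d)" and "k = nat (int b - d)"
  define q q' where "q = (?M - h) div 2" and "q' = (?M - k) div 2"
  have hk: "int h = int b + d" "int k = int b - d" using 1 2 by (auto simp: h_def k_def)
  have le: "h \<le> ?M" "k \<le> ?M" using 1(2) 2(2) unfolding hk[symmetric] by simp_all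
  have "int (?M - h) = int ?M - (int b + d)" "int (?M - k) = int ?M - (int b - d)"
    using le hk by (simp_all add: of_nat_diff)
  then have "even (?M - h)" "even (?M - k)" using 1(3) 2(3) by (metis even_of_nat)+
  then have q: "2 * q + h = ?M" "2 * q' + k = ?M" using le by (auto simp: q_def q'_def)
  have hk2: "h + k = 2 * b" using hk by linarith
  have sum: "q + q' + 2 * b = N" using q hk2 assms(1) by linarith
  have par: "even (d + int N)"
  proof -
    have "int N = 2 * int q + 2 * int b + d" using q(1) hk(1) assms(1) by linarith
    then show ?thesis by simp
  qed
  let ?n = "N + 1 - b"
  have n: "?M + 1 = ?n" "0 < ?n" using assms(1) by auto
  have Wh: "W ?M (int h) = real (h + 1) * real (?n choose q) / real ?n"
    using W_ballot[of q h] n unfolding q(1) by (simp add: field_simps)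
  have Wk: "W ?M (int k) = real (k + 1) * real (?n choose q') / real ?n"
    using W_ballot[of q' k] n unfolding q(2) by (simp add: field_simps)
  have "real (h + 1) * real (k + 1) \<le> real (b + 1) ^ 2"
  proof -
    have rk: "real (k + 1) = 2 * real b - real h + 1" using hk2 by linarith
    have "real (b + 1) ^ 2 - real (h + 1) * real (k + 1) = (real b - real h) ^ 2"
      unfolding rk by (simp add: power2_eq_square algebra_simps)
    then show ?thesis using zero_le_power2[of "real b - real h"] by linarith
  qed
  then have "(real (h + 1) * real (k + 1)) * 
      (4 ^ b * real (?n choose q) * real (?n choose q') / real ?n ^ 2) \<le>
     real (b + 1) ^ 2 * (tau N b * central N / real (N + 1)) ^ 2"
    by (intro mult_mono binomial_mult_tau sum) auto
  also have "(real (h + 1) * real (k + 1)) * 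
      (4 ^ b * real (?n choose q) * real (?n choose q') / real ?n ^ 2) =
      4 ^ b * (W ?M (int b + d) * W ?M (int b - d))"
    unfolding hk[symmetric] Wh Wk by (simp add: power2_eq_square)
  also have "real (b + 1) ^ 2 * (tau N b * central N / real (N + 1)) ^ 2 = pair_bound N b"
    by (simp add: pair_bound_def power_mult_distrib power_divide)
  finally show ?thesis using par sum by simp
qed

text \<open>The difference of the two sides grows with \<open>N\<close>, and at
  \<open>N = 2 * b\<close> it is b (b + 2) (b - 1).\<close>

lemma poly_ineq:
  fixes N b :: real
  assumes "0 \<le> b" "b = 0 \<or> 1 \<le> b" "2 * b \<le> N"
  shows "(N - 2 * b) * (N - 2 * b - 2) * (N + b + 2) \<le> (N - b) * (N - b - 1) * (N - b + 2)"
proof -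
  have eq: "(N - b) * (N - b - 1) * (N - b + 2) - (N - 2 * b) * (N - 2 * b - 2) * (N + b + 2) =
     N^2 + N * (3 * b^2 + 4 * b + 2) - 5 * b^3 - 11 * b^2 - 6 * b"
    by (simp add: power2_eq_square power3_eq_cube algebra_simps)
  have "N^2 \<ge> (2 * b)^2" using assms by (intro power_mono) auto
  moreover have "N * (3 * b^2 + 4 * b + 2) \<ge> 2 * b * (3 * b^2 + 4 * b + 2)"
    using assms by (intro mult_right_mono) auto
  moreover have "(2 * b)^2 + 2 * b * (3 * b^2 + 4 * b + 2) - 5 * b^3 - 11 * b^2 - 6 * b = b * (b + 2) * (b - 1)"
    by (simp add: power2_eq_square power3_eq_cube algebra_simps)
  moreover have "b * (b + 2) * (b - 1) \<ge> 0" using assms(2) by auto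
  ultimately show ?thesis using eq by linarith
qed

text \<open>The shift by 2 is what makes this termwise bound true already for small indices; it costs only a factor
  that tends to 1 as the height grows.\<close>

lemma tau_le_binomial:
  assumes "h0 \<le> 1"
  shows "N = 2 * q + (h0 + 2 * c) \<Longrightarrow> 2 * (h0 + 2 * c + 2) \<le> N \<Longrightarrow>
     tau N (h0 + 2 * c + 2) * central N \<le> real (N + 1 choose q)"
proof (induction c arbitrary: q)
  case 0
  show ?case
  proof (cases "h0 = 0")
    case True
    then have "central N = real (N + 1 choose q)" using 0 by (simp add: central_def)
    moreover have "h0 + 2 * 0 + 2 = 2" "2 * 2 \<le> N" using True 0 by auto
    ultimately show ?thesis
      using mult_left_le_one_le[of "central N" "tau N 2"] tau_le_1[of 2 N] tau_nonneg[of 2 N]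
      by (simp add: central_def numeral_2_eq_2)
  next
    case False
    then have h0: "h0 = 1" using assms by simp
    have N: "N = 2 * q + 1" "3 \<le> q" using 0 h0 by auto
    have c: "central N = real (2 * q + 2 choose Suc q)" by (simp add: central_def N)
    have "real (q + 2) * real (2 * q + 2 choose q) = real (q + 1) * real (2 * q + 2 choose Suc q)"
    proof -
      have "(2 * q + 2 choose Suc q) * Suc q = (2 * q + 2 choose q) * (2 * q + 2 - q)"
        using binomial_absorb_comp[of "2 * q + 2" q] binomial_absorption[of q "2 * q + 2"]
        by (metis mult.commute)
      then have "(q + 2) * (2 * q + 2 choose q) = (q + 1) * (2 * q + 2 choose Suc q)"
        by (simp add: mult.commute)
      then show ?thesis by (metis of_nat_mult)
    qed
    then have e: "real (N + 1 choose q) = real (q + 1) / real (q + 2) * central N"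
      unfolding c by (simp add: N field_simps)
    \<comment> \<open>The factors of \<open>tau N 3\<close> telescope to (N - 4) / (N - 1), with
      \<open>N = 2 * q + 1\<close>.\<close>
    have "tau N 3 = (2 * real q - 3) / (2 * real q)"
      using N by (simp add: eval_nat_numeral tau_Suc N(1) field_simps)
    also have "\<dots> \<le> real (q + 1) / real (q + 2)"
      using N(2) by (simp add: field_simps)
    finally have "tau N 3 * central N \<le> real (q + 1) / real (q + 2) * central N"
      by (rule mult_right_mono) (simp add: central_def)
    then show ?thesis unfolding e using h0 by (simp add: eval_nat_numeral)
  qed
next
  case (Suc c)
  define b where "b = h0 + 2 * c + 2"
  have b: "h0 + 2 * Suc c + 2 = Suc (Suc b)" "2 * (b + 2) \<le> N" "b \<ge> 2" "N = 2 * Suc q + (b - 2)"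
    using Suc.prems by (auto simp: b_def)
  have IH: "tau N b * central N \<le> real (N + 1 choose Suc q)"
    unfolding b_def by (rule Suc.IH) (use Suc.prems in auto)
  have bin: "real (N + 1 choose q) = real (Suc q) / real (N + 1 - q) * real (N + 1 choose Suc q)"
  proof -
    have "(N + 1 choose Suc q) * Suc q = (N + 1 choose q) * (N + 1 - q)"
      using binomial_absorb_comp[of "N + 1" q] binomial_absorption[of q "N + 1"] by (metis mult.commute)
    then have "real (N + 1 choose Suc q) * real (Suc q) = real (N + 1 choose q) * real (N + 1 - q)"
      by (metis of_nat_mult)
    moreover have "0 < real (N + 1 - q)" using b by simp
    ultimately show ?thesis by (simp add: field_simps)
  qed
  have N: "real N = 2 * real q + real b" using b by (simp add: of_nat_diff)
  have rq: "real (Suc q) = (real N - real b + 2) / 2" "real (N + 1 - q) = (real N + real b + 2) / 2"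
    using N b by (simp_all add: of_nat_diff)
  have "tau N (Suc (Suc b)) = tau N b * ((real N - 2 * real b) * (real N - 2 * real b - 2) /
      ((real N - real b) * (real N - real b - 1)))"
    unfolding tau_Suc by (simp add: algebra_simps)
  \<comment> \<open>Raising the height by 2 lowers \<open>q\<close> by 1, so two factors of
    \<open>tau\<close> are compared with one ratio of neighbouring binomial coefficients.\<close>
  also have "(real N - 2 * real b) * (real N - 2 * real b - 2) / ((real N - real b) * (real N - real b - 1))
      \<le> (real N - real b + 2) / (real N + real b + 2)"
  proof -
    have pos: "0 < (real N - real b) * (real N - real b - 1)" "0 < real N + real b + 2"
      using b by (auto intro!: mult_pos_pos)
    have "(real N - 2 * real b) * (real N - 2 * real b - 2) * (real N + real b + 2)
        \<le> (real N - real b) * (real N - real b - 1) * (real N - real b + 2)"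
      by (rule poly_ineq) (use b in auto)
    then show ?thesis using pos by (simp only: divide_le_eq le_divide_eq times_divide_eq_left) (simp add: mult_ac)
  qed
  finally have "tau N (Suc (Suc b)) \<le> tau N b * ((real N - real b + 2) / (real N + real b + 2))"
    using tau_nonneg[of b N] b by (simp add: mult_left_mono)
  also have "(real N - real b + 2) / (real N + real b + 2) = real (Suc q) / real (N + 1 - q)"
  proof -
    have "x / y = (x / 2) / (y / 2)" for x y :: real by simp
    then show ?thesis unfolding rq .
  qed
  finally have le: "tau N (Suc (Suc b)) \<le> tau N b * (real (Suc q) / real (N + 1 - q))" .
  have "tau N (Suc (Suc b)) * central N \<le> tau N b * (real (Suc q) / real (N + 1 - q)) * central N"
    by (rule mult_right_mono[OF le]) (simp add: central_def)
  also have "\<dots> = real (Suc q) / real (N + 1 - q) * (tau N b * central N)" by (simp only: mult_ac)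
  also have "\<dots> \<le> real (Suc q) / real (N + 1 - q) * real (N + 1 choose Suc q)"
    by (intro mult_left_mono IH) simp
  finally show ?case unfolding bin b(1) .
qed

section \<open>Half rows of Pascal's triangle and the summed bounds\<close>

lemma sum_ibinom_le: "finite K \<Longrightarrow> (\<Sum>k\<in>K. ibinom m k) \<le> 2 ^ m"
proof -
  assume K: "finite K"
  have "(\<Sum>k\<in>K. ibinom m k) \<le> (\<Sum>k\<in>K \<union> {0..int m}. ibinom m k)"
    by (rule sum_mono2) (use K in auto)
  also have "\<dots> = (\<Sum>k\<in>{0..int m}. ibinom m k)"
    by (rule sum.mono_neutral_right) (use K in \<open>auto simp: ibinom_eq_0\<close>)
  also have "\<dots> = (\<Sum>k\<le>m. real (m choose k))"
    by (rule sum.reindex_bij_witness[of _ int nat]) (auto simp: ibinom_def)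
  also have "\<dots> = 2 ^ m"
    using choose_row_sum[of m] by (simp flip: of_nat_sum)
  finally show ?thesis .
qed

text \<open>Pascal's rule splits each coefficient into two neighbours in the row above. For indices
  of one parity these pairs are disjoint, so the sum is at most that whole row, half of the original
  one.\<close>

lemma sum_ibinom_parity:
  fixes D :: "int set"
  assumes "finite D" shows "(\<Sum>d\<in>{d \<in> D. even (d + e)}. ibinom (Suc m) (j + d)) \<le> 2 ^ m"
proof -
  let ?E = "{d \<in> D. even (d + e)}"
  let ?A = "(\<lambda>d. j + d) ` ?E" and ?B = "(\<lambda>d. j + d - 1) ` ?E"
  have "(\<Sum>d\<in>?E. ibinom (Suc m) (j + d)) = (\<Sum>d\<in>?E. ibinom m (j + d)) + (\<Sum>d\<in>?E. ibinom m (j + d - 1))"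
    by (simp add: ibinom_Suc sum.distrib)
  also have "(\<Sum>d\<in>?E. ibinom m (j + d)) = sum (ibinom m) ?A"
    by (subst sum.reindex) (auto simp: inj_on_def)
  also have "(\<Sum>d\<in>?E. ibinom m (j + d - 1)) = sum (ibinom m) ?B"
    by (subst sum.reindex) (auto simp: inj_on_def)
  also have "sum (ibinom m) ?A + sum (ibinom m) ?B = sum (ibinom m) (?A \<union> ?B)"
  proof (rule sum.union_disjoint[symmetric])
    have "j + d \<noteq> j + d' - 1" if "even (d + e)" "even (d' + e)" for d d'
    proof
      assume "j + d = j + d' - 1"
      then have "d' + e = (d + e) + 1" by simp
      then show False using that by simp
    qed
    then show "?A \<inter> ?B = {}" by blast
  qed (use assms in auto)
  also have "\<dots> \<le> 2 ^ m" by (rule sum_ibinom_le) (use assms in auto)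
  finally show ?thesis .
qed

lemma finite_parity: "finite {d \<in> {-L..L::int}. even (d + e)}"
  by (rule finite_subset[of _ "{-L..L}"]) auto

text \<open>The walks admit only \<open>d\<close> with the parity of \<open>N\<close>, and on these
  their product has a bound free of \<open>d\<close>. So only the mass of the kernel on one parity
  class counts; \<open>\<kappa>\<close> is that mass relative to \<open>4 ^ b\<close>.\<close>

lemma kernel_bound:
  assumes "b \<le> N" and K: "\<And>d. 0 \<le> K d"
    and sumK: "(\<Sum>d\<in>{d \<in> {-L..L}. even (d + int N)}. K d) \<le> \<kappa> * 4 ^ b"
  shows "(\<Sum>d\<in>{-L..L}. W (N - b) (int b + d) * W (N - b) (int b - d) * K d) \<le>
     of_bool (2 * b \<le> N) * (\<kappa> * pair_bound N b)"
proof -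
  let ?w = "\<lambda>d. W (N - b) (int b + d) * W (N - b) (int b - d)"
  have bound: "?w d \<le> of_bool (2 * b \<le> N \<and> even (d + int N)) * (pair_bound N b / 4 ^ b)" for d
  proof (cases "?w d = 0")
    case False
    then show ?thesis using W_mult_bound[OF assms(1) False] by (simp add: field_simps)
  next
    case True
    show ?thesis unfolding True by simp
  qed
  have "(\<Sum>d\<in>{-L..L}. ?w d * K d) \<le>
      (\<Sum>d\<in>{-L..L}. of_bool (2 * b \<le> N \<and> even (d + int N)) * (pair_bound N b / 4 ^ b) * K d)"
    by (intro sum_mono mult_right_mono bound K)
  also have "\<dots> = (\<Sum>d\<in>{-L..L}. if even (d + int N) then of_bool (2 * b \<le> N) * (pair_bound N b / 4 ^ b) * K d else 0)"
    by (intro sum.cong refl) auto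
  also have "\<dots> = (\<Sum>d\<in>{d \<in> {-L..L}. even (d + int N)}. of_bool (2 * b \<le> N) * (pair_bound N b / 4 ^ b) * K d)"
    by (rule sum.inter_filter[symmetric]) simp
  also have "\<dots> = of_bool (2 * b \<le> N) * (pair_bound N b / 4 ^ b) * (\<Sum>d\<in>{d \<in> {-L..L}. even (d + int N)}. K d)"
    by (simp only: sum_distrib_left)
  also have "\<dots> \<le> of_bool (2 * b \<le> N) * (pair_bound N b / 4 ^ b) * (\<kappa> * 4 ^ b)"
    by (intro mult_left_mono sumK) auto
  also have "\<dots> = of_bool (2 * b \<le> N) * (\<kappa> * pair_bound N b)" by simp
  finally show ?thesis .
qed

definition pair_bound_total :: "nat \<Rightarrow> real" where "pair_bound_total N = (\<Sum>b\<le>N. of_bool (2 * b \<le> N) * pair_bound N b)"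

text \<open>One parity class carries half of row \<open>2 * b\<close> for \<open>b > 0\<close>. Row
  0 has a single entry and cannot be halved, hence the extra term.\<close>

lemma diagsum_bound: "diagsum L N \<le> pair_bound_total N / 2 + pair_bound N 0"
proof -
  have "pairsum L b (N - b) (int b) \<le> of_bool (2 * b \<le> N) * (1 / 2 * pair_bound N b) + of_bool (b = 0) * pair_bound N 0"
    if "b \<le> N" for b
  proof (cases b)
    case 0
    have "pairsum L b (N - b) (int b) \<le> of_bool (2 * b \<le> N) * (1 * pair_bound N b)"
      unfolding pairsum_def
    proof (rule kernel_bound[OF that])
      show "(\<Sum>d\<in>{d \<in> {-L..L}. even (d + int N)}. ibinom (2 * b) (int b + d)) \<le> 1 * 4 ^ b"
        using sum_ibinom_le[OF finite_parity, of 0 L "int N"] unfolding 0 by simp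
    qed simp
    then show ?thesis unfolding 0 using pair_bound_nonneg[of N 0] by (simp del: pair_bound_nonneg)
  next
    case (Suc b')
    have "pairsum L b (N - b) (int b) \<le> of_bool (2 * b \<le> N) * (1 / 2 * pair_bound N b)"
      unfolding pairsum_def
    proof (rule kernel_bound[OF that])
      have "(\<Sum>d\<in>{d \<in> {-L..L}. even (d + int N)}. ibinom (Suc (2 * b' + 1)) (int b + d)) \<le> 2 ^ (2 * b' + 1)"
        by (rule sum_ibinom_parity) simp
      also have "(2::real) ^ (2 * b' + 1) = 1 / 2 * 4 ^ b" by (simp add: Suc power_mult)
      finally show "(\<Sum>d\<in>{d \<in> {-L..L}. even (d + int N)}. ibinom (2 * b) (int b + d)) \<le> 1 / 2 * 4 ^ b"
        by (simp add: Suc)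
    qed simp
    then show ?thesis using Suc by simp
  qed
  then have "diagsum L N \<le> (\<Sum>b\<le>N. of_bool (2 * b \<le> N) * (1 / 2 * pair_bound N b) + of_bool (b = 0) * pair_bound N 0)"
    unfolding diagsum_def by (intro sum_mono) auto
  also have "\<dots> = (\<Sum>b\<le>N. of_bool (2 * b \<le> N) * pair_bound N b) / 2 + (\<Sum>b\<le>N. if b = 0 then pair_bound N 0 else 0)"
    unfolding sum.distrib sum_divide_distrib by (intro arg_cong2[where f = "(+)"] sum.cong) auto
  also have "\<dots> = pair_bound_total N / 2 + pair_bound N 0" by (simp add: pair_bound_total_def)
  finally show ?thesis .
qed

lemma pair_bound_le_central: "2 * b \<le> N \<Longrightarrow> pair_bound N b \<le> real (b + 1) ^ 2 * (central N / real (N + 1)) ^ 2"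
proof -
  assume b: "2 * b \<le> N"
  have "pair_bound N b = real (b + 1) ^ 2 * (central N / real (N + 1)) ^ 2 * tau N b ^ 2"
    by (simp add: pair_bound_def power_mult_distrib power_divide)
  also have "\<dots> \<le> real (b + 1) ^ 2 * (central N / real (N + 1)) ^ 2 * 1"
    using tau_nonneg[OF b] tau_le_1[OF b] by (intro mult_left_mono power_le_one) auto
  finally show ?thesis by simp
qed

text \<open>The kernel consists of two half rows of length \<open>2 * b\<close>, together
  \<open>4 ^ b\<close>, while the walks are governed by \<open>pair_bound\<close> at
  \<open>Suc b\<close> with weight \<open>4 ^ Suc b\<close>; this gives 1/4. The exceptional row
  \<open>b = 0\<close> is absorbed by the second summand.\<close>

lemma restsum_bound: "restsum L N \<le> pair_bound_total N / 4 + 4 * (central N / real (N + 1)) ^ 2"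
proof -
  let ?x = "(central N / real (N + 1)) ^ 2"
  have "pairsum_rest L b (N - Suc b) (int (Suc b)) \<le>
      of_bool (2 * Suc b \<le> N) * (1 / 4 * pair_bound N (Suc b)) + of_bool (b = 0) * (4 * ?x)"
    if "b < N" for b
  proof -
    define K where "K d = ibinom (2 * b) (int b + 1 + d) + ibinom (2 * b) (int b - 1 + d)" for d
    have rest: "pairsum_rest L b (N - Suc b) (int (Suc b)) =
      (\<Sum>d\<in>{-L..L}. W (N - Suc b) (int (Suc b) + d) * W (N - Suc b) (int (Suc b) - d) * K d)"
      by (simp add: pairsum_rest_def K_def)
    have K0: "0 \<le> K d" for d by (simp add: K_def)
    have Suc_b: "Suc b \<le> N" using that by simp
    show ?thesis
    proof (cases b)
      case 0
      have "(\<Sum>d\<in>{d \<in> {-L..L}. even (d + int N)}. K d) \<le> 1 / 2 * 4 ^ Suc b"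
      proof -
        have *: "(\<Sum>d\<in>{d \<in> {-L..L}. even (d + int N)}. ibinom 0 (j + d)) \<le> 2 ^ 0" for j
        proof -
          have "(\<Sum>d\<in>{d \<in> {-L..L}. even (d + int N)}. ibinom 0 (j + d)) =
              sum (ibinom 0) ((\<lambda>d. j + d) ` {d \<in> {-L..L}. even (d + int N)})"
            by (subst sum.reindex) (auto simp: inj_on_def)
          also have "\<dots> \<le> 2 ^ 0" by (intro sum_ibinom_le finite_imageI finite_parity)
          finally show ?thesis .
        qed
        show ?thesis using *[of 1] *[of "-1"] by (simp add: K_def 0 sum.distrib)
      qed
      from kernel_bound[where K = K, OF Suc_b K0 this]
      have "pairsum_rest L b (N - Suc b) (int (Suc b)) \<le> of_bool (2 * Suc b \<le> N) * (1 / 2 * pair_bound N (Suc b))"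
        unfolding rest .
      also have "\<dots> \<le> of_bool (2 * Suc b \<le> N) * (1 / 4 * pair_bound N (Suc b)) + 4 * ?x"
        using pair_bound_le_central[of "Suc b" N] 0 pair_bound_nonneg[of N "Suc b"]
        by (cases "2 * Suc b \<le> N") (simp_all del: pair_bound_nonneg)
      finally show ?thesis using 0 by simp
    next
      case (Suc b')
      have *: "(\<Sum>d\<in>{d \<in> {-L..L}. even (d + int N)}. ibinom (2 * b) (j + d)) \<le> 1 / 2 * 4 ^ b" for j
      proof -
        have "(\<Sum>d\<in>{d \<in> {-L..L}. even (d + int N)}. ibinom (Suc (2 * b' + 1)) (j + d)) \<le> 2 ^ (2 * b' + 1)"
          by (rule sum_ibinom_parity) simp
        also have "(2::real) ^ (2 * b' + 1) = 1 / 2 * 4 ^ b" by (simp add: Suc power_mult)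
        finally show ?thesis by (simp add: Suc)
      qed
      have "(\<Sum>d\<in>{d \<in> {-L..L}. even (d + int N)}. K d) \<le> 1 / 4 * 4 ^ Suc b"
        using *[of "int b + 1"] *[of "int b - 1"] by (simp add: K_def sum.distrib)
      from kernel_bound[where K = K, OF Suc_b K0 this]
      have "pairsum_rest L b (N - Suc b) (int (Suc b)) \<le> of_bool (2 * Suc b \<le> N) * (1 / 4 * pair_bound N (Suc b))"
        unfolding rest .
      then show ?thesis using Suc by simp
    qed
  qed
  then have "restsum L N \<le> (\<Sum>b<N. of_bool (2 * Suc b \<le> N) * (1 / 4 * pair_bound N (Suc b)) + of_bool (b = 0) * (4 * ?x))"
    unfolding restsum_def by (intro sum_mono) auto
  also have "\<dots> = (\<Sum>b<N. of_bool (2 * Suc b \<le> N) * pair_bound N (Suc b)) / 4 + (\<Sum>b<N. if b = 0 then 4 * ?x else 0)"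
    unfolding sum.distrib sum_divide_distrib by (intro arg_cong2[where f = "(+)"] sum.cong) auto
  also have "\<dots> \<le> pair_bound_total N / 4 + 4 * ?x"
  proof (intro add_mono divide_right_mono)
    show "(\<Sum>b<N. of_bool (2 * Suc b \<le> N) * pair_bound N (Suc b)) \<le> pair_bound_total N"
      unfolding pair_bound_total_def sum.atMost_shift by simp
  qed auto
  finally show ?thesis .
qed

section \<open>Comparison with the squares of walk numbers\<close>

lemma tau_antimono: "b \<le> b' \<Longrightarrow> 2 * b' \<le> N \<Longrightarrow> tau N b' \<le> tau N b"
proof (induction rule: dec_induct)
  case (step b')
  then show ?case using tau_decreasing[of b' N] by simp
qed simp

text \<open>As \<open>tau\<close> decreases, it may be evaluated at \<open>h + 2\<close>, where
  \<open>tau_le_binomial\<close> replaces \<open>tau * central\<close> by the binomial coefficient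
  belonging to height \<open>h\<close>.\<close>

lemma pair_bound_le_W:
  assumes "even (N - h)" "h + 2 \<le> b" "2 * b \<le> N"
  shows "pair_bound N b \<le> (real (b + 1) / real (h + 1)) ^ 2 * W N (int h) ^ 2"
proof -
  define q where "q = (N - h) div 2"
  have N: "N = 2 * q + h" using assms by (auto simp: q_def)
  have "tau N b * central N \<le> tau N (h + 2) * central N"
    by (intro mult_right_mono tau_antimono assms) (auto simp: central_def)
  also have "\<dots> \<le> real (N + 1 choose q)"
    using tau_le_binomial[of "h mod 2" N q "h div 2"] N assms by simp
  finally have le: "tau N b * central N \<le> real (N + 1 choose q)" .
  have W: "real (N + 1) * W N (int h) = real (h + 1) * real (N + 1 choose q)"
    using W_ballot[of q h] unfolding N[symmetric] .
  have "pair_bound N b = (real (b + 1) / real (N + 1) * (tau N b * central N)) ^ 2"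
    by (simp add: pair_bound_def mult_ac)
  also have "\<dots> \<le> (real (b + 1) / real (N + 1) * real (N + 1 choose q)) ^ 2"
    using tau_nonneg[OF assms(3)] by (intro power_mono mult_left_mono le) (auto simp: central_def)
  also have "real (b + 1) / real (N + 1) * real (N + 1 choose q) = real (b + 1) / real (h + 1) * W N (int h)"
    using W by (simp add: field_simps)
  finally show ?thesis by (simp only: power_mult_distrib)
qed

lemma W_le_central: "W N (int h) \<le> real (h + 1) * (central N / real (N + 1))"
proof (cases "h \<le> N \<and> even (N - h)")
  case True
  define q where "q = (N - h) div 2"
  have N: "N = 2 * q + h" using True by (auto simp: q_def)
  have W: "real (N + 1) * W N (int h) = real (h + 1) * real (N + 1 choose q)"
    using W_ballot[of q h] unfolding N[symmetric] .
  also have "\<dots> \<le> real (h + 1) * central N" by (intro mult_left_mono central_max) simp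
  finally show ?thesis by (simp add: field_simps)
next
  case False
  then have "W N (int h) = 0" by (intro W_zero) auto
  then show ?thesis by (simp add: central_def)
qed

lemma sum_lessThan_split:
  fixes f :: "nat \<Rightarrow> real"
  shows "(\<Sum>b<k + n. f b) = (\<Sum>b<k. f b) + (\<Sum>b<n. f (b + k))"
  by (induction n) (simp_all add: add.commute)

text \<open>The term at \<open>b + 3\<close> is compared with height \<open>b\<close> or
  \<open>b + 1\<close>, whichever has the parity of \<open>N\<close>. Each height is used at most
  twice, hence the factor 2; the first three terms give 14 = 1 + 4 + 9.\<close>

lemma pair_bound_total_bound:
  "pair_bound_total N \<le> 14 * (central N / real (N + 1)) ^ 2 + 2 * (\<Sum>h\<le>N. (real (h + 4) / real (h + 1)) ^ 2 * W N (int h) ^ 2)"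
proof -
  let ?x = "(central N / real (N + 1)) ^ 2"
  define g where "g h = (real (h + 4) / real (h + 1)) ^ 2 * W N (int h) ^ 2" for h
  have g0: "0 \<le> g h" for h by (simp add: g_def)
  have small: "of_bool (2 * b \<le> N) * pair_bound N b \<le> real (b + 1) ^ 2 * ?x" for b
    using pair_bound_le_central[of b N] by (cases "2 * b \<le> N") auto
  have large: "of_bool (2 * (b + 3) \<le> N) * pair_bound N (b + 3) \<le> g (b + 1) + g b" for b
  proof (cases "2 * (b + 3) \<le> N")
    case True
    show ?thesis
    proof (cases "even (N - b)")
      case ev: True
      have "pair_bound N (b + 3) \<le> (real (b + 3 + 1) / real (b + 1)) ^ 2 * W N (int b) ^ 2"
        by (rule pair_bound_le_W) (use True ev in auto)
      also have "\<dots> = g b"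
      proof -
        have "b + 3 + 1 = b + 4" by simp
        then show ?thesis unfolding g_def by metis
      qed
      finally show ?thesis using True g0[of "b + 1"] by simp
    next
      case False
      then have "even (N - (b + 1))" using True by simp
      then have "pair_bound N (b + 3) \<le> (real (b + 3 + 1) / real (b + 1 + 1)) ^ 2 * W N (int (b + 1)) ^ 2"
        by (intro pair_bound_le_W) (use True in auto)
      also have "\<dots> \<le> g (b + 1)"
        unfolding g_def by (intro mult_right_mono power_mono divide_right_mono) auto
      finally show ?thesis using True g0[of b] by simp
    qed
  next
    case False
    then show ?thesis using g0[of "b + 1"] g0[of b] by simp
  qed
  have "pair_bound_total N \<le> (\<Sum>b<3 + N. of_bool (2 * b \<le> N) * pair_bound N b)"
    unfolding pair_bound_total_def by (rule sum_mono2) auto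
  also have "\<dots> = (\<Sum>b<3. of_bool (2 * b \<le> N) * pair_bound N b) + (\<Sum>b<N. of_bool (2 * (b + 3) \<le> N) * pair_bound N (b + 3))"
    by (rule sum_lessThan_split)
  also have "\<dots> \<le> (\<Sum>b<3. real (b + 1) ^ 2 * ?x) + (\<Sum>b<N. g (b + 1) + g b)"
    by (intro add_mono sum_mono small large)
  also have "(\<Sum>b<3. real (b + 1) ^ 2 * ?x) = 14 * ?x" by (simp add: eval_nat_numeral)
  also have "(\<Sum>b<N. g (b + 1) + g b) = (\<Sum>b<N. g (Suc b)) + (\<Sum>b<N. g b)" by (simp add: sum.distrib)
  also have "\<dots> \<le> (\<Sum>h\<le>N. g h) + (\<Sum>h\<le>N. g h)"
  proof (intro add_mono)
    show "(\<Sum>b<N. g (Suc b)) \<le> (\<Sum>h\<le>N. g h)" unfolding sum.atMost_shift using g0 by simp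
    show "(\<Sum>b<N. g b) \<le> (\<Sum>h\<le>N. g h)" by (rule sum_mono2) (use g0 in auto)
  qed
  finally show ?thesis by (simp add: g_def)
qed

lemma sum_W_square_nat: "(\<Sum>h\<le>N. W N (int h) ^ 2) = catal N"
proof -
  have "(\<Sum>h\<le>N. W N (int h) ^ 2) = (\<Sum>h\<in>{0..int N}. W N h ^ 2)"
    by (rule sum.reindex_bij_witness[of _ nat int]) auto
  then show ?thesis by (simp add: sum_W_square catal_def)
qed

text \<open>The quotient (h + 4) / (h + 1) is close to 1 except for finitely many heights, and their
  contribution is negligible by \<open>central_small\<close>. The sum of squares of all walk numbers
  is the Catalan number.\<close>

lemma pair_bound_total_limsup:
  assumes "0 < \<epsilon>" shows "eventually (\<lambda>N. pair_bound_total N \<le> (2 + \<epsilon>) * catal N) sequentially"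
proof -
  have lim: "(\<lambda>h. (real (h + 4) / real (h + 1)) ^ 2) \<longlonglongrightarrow> 1"
  proof -
    have "(\<lambda>h. (1 + 3 * inverse (real (Suc h))) ^ 2) \<longlonglongrightarrow> (1 + 3 * 0) ^ 2"
      by (intro tendsto_intros LIMSEQ_inverse_real_of_nat)
    moreover have "1 + 3 * inverse (real (Suc h)) = real (h + 4) / real (h + 1)" for h
      by (simp add: field_simps)
    ultimately show ?thesis by simp
  qed
  have "eventually (\<lambda>h. (real (h + 4) / real (h + 1)) ^ 2 < 1 + \<epsilon> / 4) sequentially"
    by (rule order_tendstoD(2)[OF lim]) (use assms in simp)
  then obtain H where H: "\<And>h. H \<le> h \<Longrightarrow> (real (h + 4) / real (h + 1)) ^ 2 < 1 + \<epsilon> / 4"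
    by (auto simp: eventually_sequentially)
  \<comment> \<open>14 stems from the first three indices; there are \<open>H\<close> low heights,
    each with squared quotient at most 16 and \<open>h + 1 \<le> H\<close> in
    \<open>W_le_central\<close>.\<close>
  define C where "C = 14 + 2 * (real H * (16 * real H ^ 2))"
  have C0: "0 \<le> C" by (simp add: C_def)
  have bound: "pair_bound_total N \<le> 2 * ((1 + \<epsilon> / 4) * catal N) + C * (central N / real (N + 1)) ^ 2" for N
  proof -
    let ?x = "(central N / real (N + 1)) ^ 2"
    have le: "(real (h + 4) / real (h + 1)) ^ 2 * W N (int h) ^ 2 \<le>
       (1 + \<epsilon> / 4) * W N (int h) ^ 2 + of_bool (h < H) * (16 * real H ^ 2 * ?x)" for h
    proof (cases "h < H")
      case True
      have "real (h + 4) / real (h + 1) \<le> 4" by (simp add: divide_le_eq)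
      then have "(real (h + 4) / real (h + 1)) ^ 2 \<le> 4 ^ 2" by (intro power_mono) auto
      moreover have "W N (int h) ^ 2 \<le> (real H * (central N / real (N + 1))) ^ 2"
      proof (intro power_mono)
        have "W N (int h) \<le> real (h + 1) * (central N / real (N + 1))" by (rule W_le_central)
        also have "\<dots> \<le> real H * (central N / real (N + 1))"
          using True by (intro mult_right_mono) (auto simp: central_def)
        finally show "W N (int h) \<le> real H * (central N / real (N + 1))" .
      qed auto
      ultimately have "(real (h + 4) / real (h + 1)) ^ 2 * W N (int h) ^ 2 \<le>
          4 ^ 2 * (real H * (central N / real (N + 1))) ^ 2"
        by (intro mult_mono) auto
      also have "\<dots> = 16 * real H ^ 2 * ?x" by (simp only: power_mult_distrib) simp
      also have "\<dots> \<le> (1 + \<epsilon> / 4) * W N (int h) ^ 2 + 16 * real H ^ 2 * ?x" using assms by simp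
      finally show ?thesis using True by simp
    next
      case False
      then have "(real (h + 4) / real (h + 1)) ^ 2 \<le> 1 + \<epsilon> / 4" using H[of h] by simp
      then show ?thesis using False by (simp add: mult_right_mono)
    qed
    have "(\<Sum>h\<le>N. (real (h + 4) / real (h + 1)) ^ 2 * W N (int h) ^ 2) \<le>
       (\<Sum>h\<le>N. (1 + \<epsilon> / 4) * W N (int h) ^ 2 + of_bool (h < H) * (16 * real H ^ 2 * ?x))"
      by (intro sum_mono le)
    also have "\<dots> = (1 + \<epsilon> / 4) * catal N + (\<Sum>h\<le>N. of_bool (h < H)) * (16 * real H ^ 2 * ?x)"
      unfolding sum.distrib by (simp only: sum_distrib_left[symmetric] sum_distrib_right[symmetric] sum_W_square_nat)
    also have "\<dots> \<le> (1 + \<epsilon> / 4) * catal N + real H * (16 * real H ^ 2 * ?x)"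
    proof -
      have "(\<Sum>h\<le>N. of_bool (h < H) :: real) = real (card ({..N} \<inter> {h. h < H}))"
        by (simp add: sum_of_bool_eq)
      also have "\<dots> \<le> real (card {..<H})"
        by (intro of_nat_mono card_mono) auto
      finally have "(\<Sum>h\<le>N. of_bool (h < H) :: real) \<le> real H" by simp
      then show ?thesis by (intro add_left_mono mult_right_mono) auto
    qed
    finally have "2 * (\<Sum>h\<le>N. (real (h + 4) / real (h + 1)) ^ 2 * W N (int h) ^ 2) \<le>
      2 * ((1 + \<epsilon> / 4) * catal N + real H * (16 * real H ^ 2 * ?x))" by simp
    then show ?thesis using pair_bound_total_bound[of N] by (simp add: C_def algebra_simps)
  qed
  have "(\<lambda>N. C * (8 * inverse (real (Suc N)))) \<longlonglongrightarrow> C * (8 * 0)"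
    by (intro tendsto_intros LIMSEQ_inverse_real_of_nat)
  then have "eventually (\<lambda>N. C * (8 * inverse (real (Suc N))) < \<epsilon> / 2) sequentially"
    by (rule order_tendstoD(2)) (use assms in simp)
  then show ?thesis using eventually_gt_at_top[of 0]
  proof eventually_elim
    case (elim N)
    have "C * (central N / real (N + 1)) ^ 2 \<le> C * (8 / real (N + 1) * catal N)"
      by (intro mult_left_mono central_small C0) (use elim in simp)
    also have "\<dots> = C * (8 * inverse (real (Suc N))) * catal N" by (simp add: field_simps)
    also have "\<dots> \<le> \<epsilon> / 2 * catal N"
      using elim catal_pos[of N] by (intro mult_right_mono) auto
    finally show ?case using bound[of N] by (simp add: algebra_simps)
  qed
qed

section \<open>Asymptotics of the number of marked paths\<close>

lemma catal_ratio: "(\<lambda>n. catal n / catal (Suc n)) \<longlonglongrightarrow> 1 / 4"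
proof -
  have "(\<lambda>n. (1 + inverse (real (Suc n))) / (4 - 2 * inverse (real (Suc n)))) \<longlonglongrightarrow> (1 + 0) / (4 - 2 * 0)"
    by (intro tendsto_intros LIMSEQ_inverse_real_of_nat) simp
  moreover have "(1 + inverse (real (Suc n))) / (4 - 2 * inverse (real (Suc n))) = catal n / catal (Suc n)" for n
  proof -
    have "catal (Suc n) = real (2 * (2 * n + 1)) * catal n / real (n + 2)"
      using catal_Suc[of n] by (simp add: field_simps)
    then have "catal n / catal (Suc n) = real (n + 2) / real (2 * (2 * n + 1))"
      using catal_pos[of n] by simp
    moreover have "1 + inverse (real (Suc n)) = real (n + 2) / real (Suc n)"
      "4 - 2 * inverse (real (Suc n)) = real (2 * (2 * n + 1)) / real (Suc n)"
      by (simp_all add: field_simps)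
    ultimately show ?thesis by simp
  qed
  ultimately show ?thesis by simp
qed

lemma central_catal_ratio: "(\<lambda>N. (central N / real (N + 1)) ^ 2 / catal N) \<longlonglongrightarrow> 0"
proof (rule tendsto_sandwich[OF _ _ tendsto_const])
  show "(\<lambda>N. 8 * inverse (real (Suc N))) \<longlonglongrightarrow> 0"
    using tendsto_mult[OF tendsto_const LIMSEQ_inverse_real_of_nat, of 8] by simp
  show "eventually (\<lambda>N. (central N / real (N + 1)) ^ 2 / catal N \<le> 8 * inverse (real (Suc N))) sequentially"
    using eventually_gt_at_top[of 0]
  proof eventually_elim
    case (elim N)
    show ?case using central_small[OF elim] catal_pos[of N] by (simp add: divide_le_eq field_simps)
  qed
qed (auto simp: less_imp_le[OF catal_pos])

text \<open>The identity is used as a lower bound for \<open>two_fixed N\<close>: all its other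
  terms, including \<open>two_fixed (N - 1)\<close>, are already bounded above.\<close>

lemma two_fixed_ratio: "(\<lambda>N. real (two_fixed N) / catal N) \<longlonglongrightarrow> 1"
proof -
  define a where "a N = real (two_fixed N) / catal N" for N
  define x where "x N = (central N / real (N + 1)) ^ 2 / catal N" for N
  define \<beta> where "\<beta> N = pair_bound_total N / catal N" for N
  define \<rho> where "\<rho> N = catal (N - 1) / catal N" for N
  have x0: "0 \<le> x N" for N using catal_pos[of N] by (simp add: x_def)
  have upper: "a N \<le> \<beta> N / 2 + x N" for N
  proof -
    have "real (two_fixed N) \<le> pair_bound_total N / 2 + pair_bound N 0"
      using two_fixed_eq_diagsum[of N "int N"] diagsum_bound[of "int N" N] by simp
    also have "pair_bound N 0 = (central N / real (N + 1)) ^ 2" by (simp add: pair_bound_def)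
    finally have "real (two_fixed N) / catal N \<le> (pair_bound_total N / 2 + (central N / real (N + 1)) ^ 2) / catal N"
      using catal_pos[of N] by (intro divide_right_mono) auto
    then show ?thesis by (simp add: a_def \<beta>_def x_def add_divide_distrib)
  qed
  \<comment> \<open>In \<open>5 * x N\<close>, one part bounds \<open>W N 0 ^ 2\<close> and four
    come from \<open>restsum_bound\<close>.\<close>
  have lower: "2 - 2 * (a (N - 1) * \<rho> N) - 5 * x N - \<beta> N / 4 \<le> a N" if "0 < N" for N
  proof -
    have "2 * catal N = real (two_fixed N) + 2 * real (two_fixed (N - 1)) + W N 0 ^ 2 + restsum (int N + 1) N"
      using diagsum_identity[of N "int N + 1"] that
        two_fixed_eq_diagsum[of N "int N + 1"] two_fixed_eq_diagsum[of "N - 1" "int N + 1"]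
      by (simp add: catal_def)
    moreover have "W N 0 ^ 2 \<le> (central N / real (N + 1)) ^ 2"
      using W_le_central[of N 0] by (intro power_mono) auto
    moreover note restsum_bound[of "int N + 1" N]
    ultimately have "2 * catal N - 2 * real (two_fixed (N - 1)) - 5 * (central N / real (N + 1)) ^ 2 - pair_bound_total N / 4
        \<le> real (two_fixed N)" by linarith
    then have "(2 * catal N - 2 * real (two_fixed (N - 1)) - 5 * (central N / real (N + 1)) ^ 2 - pair_bound_total N / 4) / catal N
        \<le> a N" using catal_pos[of N] unfolding a_def by (intro divide_right_mono) auto
    moreover have "real (two_fixed (N - 1)) / catal N = a (N - 1) * \<rho> N"
      using catal_pos[of "N - 1"] by (simp add: a_def \<rho>_def)
    ultimately show ?thesis using catal_pos[of N]
      by (simp add: diff_divide_distrib x_def \<beta>_def)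
  qed
  have "a \<longlonglongrightarrow> 1"
  proof (rule LIMSEQ_I)
    fix \<epsilon> :: real assume "0 < \<epsilon>"
    \<comment> \<open>The errors stay within \<open>2 * e\<close> above and \<open>13 * e\<close>
      below, so 20 is a safe divisor. The minimum with 1 permits bounding \<open>e * e\<close> by
      \<open>e\<close>.\<close>
    define e where "e = min 1 \<epsilon> / 20"
    have e: "0 < e" "e \<le> 1 / 20" "20 * e \<le> \<epsilon>" using \<open>0 < \<epsilon>\<close> by (auto simp: e_def)
    have ev\<beta>: "eventually (\<lambda>N. \<beta> N \<le> 2 + e) sequentially"
      using pair_bound_total_limsup[OF e(1)] by eventually_elim (use catal_pos in \<open>simp add: \<beta>_def divide_le_eq\<close>)
    have evx: "eventually (\<lambda>N. x N < e) sequentially"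
      unfolding x_def by (rule order_tendstoD(2)[OF central_catal_ratio e(1)])
    have "(\<lambda>n. \<rho> (Suc n)) \<longlonglongrightarrow> 1 / 4" using catal_ratio by (simp add: \<rho>_def)
    then have "\<rho> \<longlonglongrightarrow> 1 / 4" by (rule LIMSEQ_imp_Suc)
    then have ev\<rho>: "eventually (\<lambda>N. \<rho> N < 1 / 4 + e) sequentially"
      by (rule order_tendstoD(2)) (use e in simp)
    have eva: "eventually (\<lambda>N. a N \<le> 1 + 2 * e) sequentially"
      using ev\<beta> evx by eventually_elim (use upper in \<open>smt (verit) e(1) field_sum_of_halves\<close>)
    then obtain N0 where N0: "\<And>N. N0 \<le> N \<Longrightarrow> a N \<le> 1 + 2 * e"
      by (auto simp: eventually_sequentially)
    have eva': "eventually (\<lambda>N. a (N - 1) \<le> 1 + 2 * e) sequentially"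
      by (rule eventually_sequentiallyI[of "Suc N0"]) (use N0 in auto)
    have "eventually (\<lambda>N. norm (a N - 1) < \<epsilon>) sequentially"
      using ev\<beta> evx ev\<rho> eva eva' eventually_gt_at_top[of 0]
    proof eventually_elim
      case (elim N)
      have "a (N - 1) * \<rho> N \<le> (1 + 2 * e) * (1 / 4 + e)"
      proof (rule mult_mono)
        show "0 \<le> \<rho> N" using catal_pos[of N] catal_pos[of "N - 1"] by (simp add: \<rho>_def)
      qed (use elim e in auto)
      also have "\<dots> = 1 / 4 + 3 / 2 * e + 2 * (e * e)" by (simp add: algebra_simps)
      also have "e * e \<le> e * 1" using e by (intro mult_left_mono) auto
      finally have "a (N - 1) * \<rho> N \<le> 1 / 4 + 7 / 2 * e" by simp
      then have "1 - 13 * e \<le> a N" using lower[of N] elim by auto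
      then show ?case using elim e by (simp add: abs_less_iff)
    qed
    then show "\<exists>no. \<forall>n\<ge>no. norm (a n - 1) < \<epsilon>" by (simp add: eventually_sequentially)
  qed
  then show ?thesis by (simp add: a_def[abs_def])
qed

section \<open>The limit law\<close>

abbreviation av :: "nat \<Rightarrow> (nat \<Rightarrow> nat) set" where "av n \<equiv> avoiders n 3 pat123"

lemma card_av: "real (card (av n)) = catal n"
  using bij_betw_same_card[OF code123_bij[of n]] by (simp add: card_ballot_pairs catal_def W_def)

definition fixsum :: "bool \<Rightarrow> nat \<Rightarrow> real" where
  "fixsum c n = (\<Sum>\<sigma>\<in>av n. real (card (fixclass n c \<sigma>)))"

definition fixprod :: "nat \<Rightarrow> real" where
  "fixprod n = (\<Sum>\<sigma>\<in>av n. real (card (fixclass n True \<sigma>)) * real (card (fixclass n False \<sigma>)))"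

definition fpcount :: "nat \<Rightarrow> nat \<Rightarrow> real" where
  "fpcount n k = real (card {\<sigma> \<in> av n. fp n \<sigma> = k})"

lemma fixsum_True: "fixsum True (Suc m) = catal m"
proof -
  have "fixsum True (m + 1) = real (\<Sum>h\<in>{0..int m}. walks m h ^ 2)"
    unfolding fixsum_def using sum_card_fixclass[of "m + 1" True, unfolded card_one_fixed_total]
    by (simp only: of_nat_sum[symmetric])
  also have "\<dots> = catal m" using sum_W_square[of m] by (simp add: W_def catal_def)
  finally show ?thesis by simp
qed

text \<open>The loss stems from permutations whose middle entry is a fixed left-to-right minimum;
  for these both walks end at height 0, so there are w_m(0)^2 of them.\<close>

lemma fixsum_False_bounds:
  "fixsum False (Suc m) \<le> catal m" "catal m - (central m / real (m + 1)) ^ 2 \<le> fixsum False (Suc m)"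
proof -
  have "(\<Sum>\<sigma>\<in>av (Suc m). card (fixclass (Suc m) False \<sigma>)) \<le> (\<Sum>\<sigma>\<in>av (Suc m). card (fixclass (Suc m) True \<sigma>))"
    by (rule sum_card_fixclass_False_bounds)
  then have "fixsum False (Suc m) \<le> fixsum True (Suc m)"
    unfolding fixsum_def by (simp flip: of_nat_sum)
  then show "fixsum False (Suc m) \<le> catal m" by (simp add: fixsum_True)
  let ?B = "card {XY \<in> ballot_pairs (Suc m). odd (Suc m) \<and> fixat True XY ((Suc m - 1) div 2)}"
  have "(\<Sum>\<sigma>\<in>av (Suc m). card (fixclass (Suc m) True \<sigma>)) \<le>
      (\<Sum>\<sigma>\<in>av (Suc m). card (fixclass (Suc m) False \<sigma>)) + ?B"
    by (rule sum_card_fixclass_False_bounds)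
  then have "fixsum True (Suc m) \<le> fixsum False (Suc m) + real ?B"
    unfolding fixsum_def by (simp flip: of_nat_sum of_nat_add)
  moreover have "real ?B \<le> (central m / real (m + 1)) ^ 2"
  proof (cases "even m")
    case True
    then have e: "int (Suc m) - 1 - 2 * int (m div 2) = 0" "2 * (m div 2) + 1 \<le> Suc m" "m div 2 < Suc m" by auto
    have "?B = card {XY \<in> ballot_pairs (Suc m). fixat True XY (m div 2)}" using True by simp
    also have "\<dots> = walks m 0 ^ 2"
      unfolding card_one_fixed[OF e(3)] using e by simp
    finally have "real ?B = W m 0 ^ 2" by (simp add: W_def)
    also have "\<dots> \<le> (central m / real (m + 1)) ^ 2"
      using W_le_central[of m 0] by (intro power_mono) auto
    finally show ?thesis .
  next
    case False
    then have "?B = 0" by simp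
    then show ?thesis by simp
  qed
  ultimately show "catal m - (central m / real (m + 1)) ^ 2 \<le> fixsum False (Suc m)"
    by (simp add: fixsum_True)
qed

lemma fixprod_eq: "fixprod (N + 2) = real (two_fixed N)"
  unfolding fixprod_def card_two_fixed_total[symmetric] sum_card_fixclass_mult[symmetric]
  by simp

lemma fp_le_2: "\<sigma> \<in> av n \<Longrightarrow> fp n \<sigma> \<le> 2"
  using card_fixclass_le[of \<sigma> n True] card_fixclass_le[of \<sigma> n False] by (simp add: fp_eq_fixclass)

text \<open>Each decreasing sequence has at most one fixed point, so the two cardinalities are
  indicators and inclusion-exclusion applies.\<close>

lemma fpcount_eq:
  "fpcount n 2 = fixprod n"
  "fpcount n 1 = fixsum True n + fixsum False n - 2 * fixprod n"
  "fpcount n 0 = catal n - fixsum True n - fixsum False n + fixprod n"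
proof -
  have count: "fpcount n k = (\<Sum>\<sigma>\<in>av n. of_bool (fp n \<sigma> = k))" for k
    unfolding fpcount_def using finite_avoiders[of n 3 pat123] by (simp add: sum_of_bool_eq Int_def)
  have c: "card (fixclass n b \<sigma>) \<in> {0, 1}" if "\<sigma> \<in> av n" for b \<sigma>
    using card_fixclass_le[OF that, of b] by auto
  let ?c = "\<lambda>b \<sigma>. real (card (fixclass n b \<sigma>))"
  show "fpcount n 2 = fixprod n"
    unfolding count fixprod_def
  proof (rule sum.cong[OF refl])
    fix \<sigma> assume "\<sigma> \<in> av n"
    then show "of_bool (fp n \<sigma> = 2) = ?c True \<sigma> * ?c False \<sigma>"
      using c[of \<sigma> True] c[of \<sigma> False] by (auto simp: fp_eq_fixclass)
  qed
  have "fpcount n 1 = (\<Sum>\<sigma>\<in>av n. ?c True \<sigma> + ?c False \<sigma> - 2 * (?c True \<sigma> * ?c False \<sigma>))"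
    unfolding count
  proof (rule sum.cong[OF refl])
    fix \<sigma> assume "\<sigma> \<in> av n"
    then show "of_bool (fp n \<sigma> = 1) = ?c True \<sigma> + ?c False \<sigma> - 2 * (?c True \<sigma> * ?c False \<sigma>)"
      using c[of \<sigma> True] c[of \<sigma> False] by (auto simp: fp_eq_fixclass)
  qed
  then show "fpcount n 1 = fixsum True n + fixsum False n - 2 * fixprod n"
    by (simp add: sum.distrib sum_subtractf fixsum_def fixprod_def sum_distrib_left)
  have "fpcount n 0 = (\<Sum>\<sigma>\<in>av n. 1 - ?c True \<sigma> - ?c False \<sigma> + ?c True \<sigma> * ?c False \<sigma>)"
    unfolding count
  proof (rule sum.cong[OF refl])
    fix \<sigma> assume "\<sigma> \<in> av n"
    then show "of_bool (fp n \<sigma> = 0) = 1 - ?c True \<sigma> - ?c False \<sigma> + ?c True \<sigma> * ?c False \<sigma>"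
      using c[of \<sigma> True] c[of \<sigma> False] by (auto simp: fp_eq_fixclass)
  qed
  then show "fpcount n 0 = catal n - fixsum True n - fixsum False n + fixprod n"
    by (simp add: sum.distrib sum_subtractf fixsum_def fixprod_def card_av[symmetric])
qed

lemma fixsum_True_ratio: "(\<lambda>n. fixsum True n / catal n) \<longlonglongrightarrow> 1 / 4"
  by (rule LIMSEQ_imp_Suc) (simp add: fixsum_True catal_ratio)

lemma fixsum_False_ratio: "(\<lambda>n. fixsum False n / catal n) \<longlonglongrightarrow> 1 / 4"
proof (rule LIMSEQ_imp_Suc, rule tendsto_sandwich[OF _ _ _ catal_ratio])
  have "(\<lambda>m. (1 - (central m / real (m + 1)) ^ 2 / catal m) * (catal m / catal (Suc m))) \<longlonglongrightarrow> (1 - 0) * (1 / 4)"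
    by (intro tendsto_mult tendsto_diff tendsto_const catal_ratio central_catal_ratio)
  then show "(\<lambda>m. (1 - (central m / real (m + 1)) ^ 2 / catal m) * (catal m / catal (Suc m))) \<longlonglongrightarrow> 1 / 4"
    by simp
  have "(1 - (central m / real (m + 1)) ^ 2 / catal m) * (catal m / catal (Suc m)) \<le> fixsum False (Suc m) / catal (Suc m)" for m
  proof -
    have "(1 - (central m / real (m + 1)) ^ 2 / catal m) * (catal m / catal (Suc m)) =
       (catal m - (central m / real (m + 1)) ^ 2) / catal (Suc m)"
      using catal_pos[of m] catal_pos[of "Suc m"] by (simp add: left_diff_distrib diff_divide_distrib)
    also have "\<dots> \<le> fixsum False (Suc m) / catal (Suc m)"
      using fixsum_False_bounds(2)[of m] catal_pos[of "Suc m"] by (intro divide_right_mono) auto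
    finally show ?thesis .
  qed
  then show "eventually (\<lambda>m. (1 - (central m / real (m + 1)) ^ 2 / catal m) * (catal m / catal (Suc m)) \<le>
      fixsum False (Suc m) / catal (Suc m)) sequentially" by simp
  have "fixsum False (Suc m) / catal (Suc m) \<le> catal m / catal (Suc m)" for m
    using fixsum_False_bounds(1)[of m] catal_pos[of "Suc m"] by (intro divide_right_mono) auto
  then show "eventually (\<lambda>m. fixsum False (Suc m) / catal (Suc m) \<le> catal m / catal (Suc m)) sequentially"
    by simp
qed

text \<open>The two marked entries reduce the semilength by 2, and each reduction by one costs a
  factor 1/4.\<close>

lemma fixprod_ratio: "(\<lambda>n. fixprod n / catal n) \<longlonglongrightarrow> 1 / 16"
proof -
  have "(\<lambda>N. (real (two_fixed N) / catal N) * ((catal N / catal (Suc N)) * (catal (Suc N) / catal (Suc (Suc N)))))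
      \<longlonglongrightarrow> 1 * (1 / 4 * (1 / 4))"
    by (intro tendsto_mult two_fixed_ratio catal_ratio LIMSEQ_Suc[OF catal_ratio])
  moreover have "(real (two_fixed N) / catal N) * ((catal N / catal (Suc N)) * (catal (Suc N) / catal (Suc (Suc N)))) =
      fixprod (N + 2) / catal (N + 2)" for N
    using catal_pos[of N] catal_pos[of "Suc N"] fixprod_eq[of N] by simp
  ultimately have "(\<lambda>N. fixprod (N + 2) / catal (N + 2)) \<longlonglongrightarrow> 1 / 16" by simp
  then show ?thesis by (rule LIMSEQ_offset)
qed

text \<open>These are the weights for two independent indicators of probability 1/4. Tilting each by
  \<open>q\<close> changes the odds 1 : 3 into q : 3, which is the origin of
  \<open>q / (3 + q)\<close>.\<close>

lemma fpcount_ratio: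
  "(\<lambda>n. fpcount n 0 / catal n) \<longlonglongrightarrow> 9 / 16"
  "(\<lambda>n. fpcount n 1 / catal n) \<longlonglongrightarrow> 6 / 16"
  "(\<lambda>n. fpcount n 2 / catal n) \<longlonglongrightarrow> 1 / 16"
proof -
  have 0: "catal n \<noteq> 0" for n using catal_pos[of n] by simp
  have "(\<lambda>n. 1 - fixsum True n / catal n - fixsum False n / catal n + fixprod n / catal n) \<longlonglongrightarrow> 1 - 1/4 - 1/4 + 1/16"
    by (intro tendsto_intros fixsum_True_ratio fixsum_False_ratio fixprod_ratio)
  then show "(\<lambda>n. fpcount n 0 / catal n) \<longlonglongrightarrow> 9 / 16"
    by (simp add: fpcount_eq add_divide_distrib diff_divide_distrib 0)
  have "(\<lambda>n. fixsum True n / catal n + fixsum False n / catal n - 2 * (fixprod n / catal n)) \<longlonglongrightarrow> 1/4 + 1/4 - 2 * (1/16)"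
    by (intro tendsto_intros fixsum_True_ratio fixsum_False_ratio fixprod_ratio)
  then show "(\<lambda>n. fpcount n 1 / catal n) \<longlonglongrightarrow> 6 / 16"
    by (simp add: fpcount_eq(2)[unfolded One_nat_def] add_divide_distrib diff_divide_distrib)
  show "(\<lambda>n. fpcount n 2 / catal n) \<longlonglongrightarrow> 1 / 16"
    using fixprod_ratio by (simp add: fpcount_eq)
qed

lemma sum_by_fp:
  "(\<Sum>\<sigma>\<in>av n. g (fp n \<sigma>)) = (\<Sum>k\<in>{0,1,2}. g k * fpcount n k)" for g :: "nat \<Rightarrow> real"
proof -
  have im: "fp n ` av n \<subseteq> {0, 1, 2}" using fp_le_2 by (force simp: le_Suc_eq numeral_2_eq_2)
  have "(\<Sum>\<sigma>\<in>av n. g (fp n \<sigma>)) = (\<Sum>k\<in>{0,1,2}. \<Sum>\<sigma>\<in>{\<sigma> \<in> av n. fp n \<sigma> = k}. g (fp n \<sigma>))"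
    by (rule sum.group[symmetric, OF finite_avoiders _ im]) simp
  also have "\<dots> = (\<Sum>k\<in>{0,1,2}. g k * fpcount n k)"
    by (intro sum.cong refl) (simp add: fpcount_def)
  finally show ?thesis .
qed

section \<open>Distribution functions\<close>

lemma Zn_pos: "0 < q \<Longrightarrow> 0 < Zn q n"
proof -
  assume "0 < q"
  have "av n \<noteq> {}" using card_av[of n] catal_pos[of n] by force
  then show ?thesis unfolding Zn_def using \<open>0 < q\<close> by (intro sum_pos finite_avoiders) auto
qed

lemma pmf_Pq123:
  assumes "0 < q"
  shows "pmf (Pq123 q n) \<sigma> = (if \<sigma> \<in> av n then q ^ fp n \<sigma> / Zn q n else 0)"
  unfolding Pq123_def
proof (rule pmf_embed_pmf)
  let ?f = "\<lambda>\<sigma>. if \<sigma> \<in> av n then q ^ fp n \<sigma> / Zn q n else 0"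
  have Z: "0 < Zn q n" using Zn_pos[OF assms] .
  show nn: "0 \<le> ?f \<sigma>" for \<sigma> using Z assms by simp
  have "(\<integral>\<^sup>+\<sigma>. ennreal (?f \<sigma>) \<partial>count_space UNIV) = (\<Sum>\<sigma>\<in>av n. ennreal (?f \<sigma>))"
    by (rule nn_integral_count_space') (use finite_avoiders in auto)
  also have "\<dots> = ennreal (\<Sum>\<sigma>\<in>av n. ?f \<sigma>)" by (rule sum_ennreal) (rule nn)
  also have "(\<Sum>\<sigma>\<in>av n. ?f \<sigma>) = (\<Sum>\<sigma>\<in>av n. q ^ fp n \<sigma>) / Zn q n" by (simp add: sum_divide_distrib)
  also have "\<dots> = 1" using Z by (simp add: Zn_def)
  finally show "(\<integral>\<^sup>+\<sigma>. ennreal (?f \<sigma>) \<partial>count_space UNIV) = 1" by simp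
qed

text \<open>Numerator and normalization are both divided by \<open>catal n\<close>, so that each
  ingredient has a limit.\<close>

lemma cdf_Pq123:
  assumes "0 < q"
  shows "cdf (distr (measure_pmf (Pq123 q n)) borel (\<lambda>\<sigma>. real (fp n \<sigma>))) x =
    (\<Sum>k\<in>{0,1,2}. of_bool (real k \<le> x) * q ^ k * (fpcount n k / catal n)) /
    (\<Sum>k\<in>{0,1,2}. q ^ k * (fpcount n k / catal n))"
proof -
  let ?S = "{\<sigma>. real (fp n \<sigma>) \<le> x}"
  have "cdf (distr (measure_pmf (Pq123 q n)) borel (\<lambda>\<sigma>. real (fp n \<sigma>))) x = measure (measure_pmf (Pq123 q n)) ?S"
    unfolding cdf_def by (subst measure_distr) (auto simp: vimage_def)
  also have "\<dots> = measure (measure_pmf (Pq123 q n)) (?S \<inter> av n)"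
  proof (rule measure_pmf.finite_measure_eq_AE)
    show "AE \<sigma> in measure_pmf (Pq123 q n). \<sigma> \<in> ?S \<longleftrightarrow> \<sigma> \<in> ?S \<inter> av n"
      by (auto simp: AE_measure_pmf_iff set_pmf_iff pmf_Pq123[OF assms] split: if_splits)
  qed auto
  also have "\<dots> = (\<Sum>\<sigma>\<in>?S \<inter> av n. pmf (Pq123 q n) \<sigma>)"
    by (rule measure_measure_pmf_finite) (use finite_avoiders in auto)
  also have "\<dots> = (\<Sum>\<sigma>\<in>av n. of_bool (real (fp n \<sigma>) \<le> x) * q ^ fp n \<sigma> / Zn q n)"
    by (rule sum.mono_neutral_cong_left) (use finite_avoiders in \<open>auto simp: pmf_Pq123[OF assms]\<close>)
  also have "\<dots> = (\<Sum>k\<in>{0,1,2}. of_bool (real k \<le> x) * q ^ k * fpcount n k) / Zn q n"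
    unfolding sum_divide_distrib[symmetric] sum_by_fp[of "\<lambda>k. of_bool (real k \<le> x) * q ^ k" n] ..
  also have "Zn q n = (\<Sum>k\<in>{0,1,2}. q ^ k * fpcount n k)"
    unfolding Zn_def by (rule sum_by_fp)
  also have "(\<Sum>k\<in>{0,1,2}. of_bool (real k \<le> x) * q ^ k * fpcount n k) / (\<Sum>k\<in>{0,1,2}. q ^ k * fpcount n k) =
      ((\<Sum>k\<in>{0,1,2}. of_bool (real k \<le> x) * q ^ k * fpcount n k) / catal n) /
      ((\<Sum>k\<in>{0,1,2}. q ^ k * fpcount n k) / catal n)"
    using catal_pos[of n] by simp
  finally show ?thesis by (simp only: sum_divide_distrib times_divide_eq_right)
qed

lemma cdf_sum_bernoulli:
  assumes "0 \<le> p" "p \<le> 1"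
  shows "cdf (distr (measure_pmf (pair_pmf (bernoulli_pmf p) (bernoulli_pmf p))) borel
      (\<lambda>(a, b). real (of_bool a + of_bool b))) x =
    of_bool (0 \<le> x) * (1 - p) ^ 2 + of_bool (1 \<le> x) * (2 * p * (1 - p)) + of_bool (2 \<le> x) * p ^ 2"
proof -
  let ?M = "pair_pmf (bernoulli_pmf p) (bernoulli_pmf p)"
  let ?S = "{ab. (\<lambda>(a, b). real (of_bool a + of_bool b)) ab \<le> x}"
  have "cdf (distr (measure_pmf ?M) borel (\<lambda>(a, b). real (of_bool a + of_bool b))) x = measure (measure_pmf ?M) ?S"
    unfolding cdf_def by (subst measure_distr) (auto simp: vimage_def)
  also have "\<dots> = (\<Sum>ab\<in>?S. pmf ?M ab)" by (rule measure_measure_pmf_finite) simp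
  also have "\<dots> = (\<Sum>ab\<in>UNIV. of_bool (ab \<in> ?S) * pmf ?M ab)"
    by (rule sum.mono_neutral_cong_left) auto
  also have "\<dots> = (\<Sum>(a, b)\<in>UNIV \<times> UNIV. of_bool ((a, b) \<in> ?S) * pmf ?M (a, b))"
    by (simp add: case_prod_beta)
  also have "\<dots> = (\<Sum>a\<in>UNIV. \<Sum>b\<in>UNIV. of_bool ((a, b) \<in> ?S) * pmf ?M (a, b))"
    by (rule sum.cartesian_product[symmetric])
  also have "\<dots> = of_bool (0 \<le> x) * (1 - p) ^ 2 + of_bool (1 \<le> x) * (2 * p * (1 - p)) + of_bool (2 \<le> x) * p ^ 2"
    using assms by (simp add: UNIV_bool pmf_pair power2_eq_square algebra_simps)
  finally show ?thesis .
qed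

theorem theorem2:
  fixes q :: real
  assumes "q > 0"
  shows "weak_conv_m
           (\<lambda>n. distr (measure_pmf (Pq123 q n)) borel (\<lambda>\<sigma>. real (fp n \<sigma>)))
           (distr (measure_pmf (pair_pmf (bernoulli_pmf (q / (3 + q))) (bernoulli_pmf (q / (3 + q)))))
                  borel (\<lambda>(a, b). real (of_bool a + of_bool b)))"
  unfolding weak_conv_m_def weak_conv_def
proof (intro allI impI)
  fix x :: real
  define g :: "nat \<Rightarrow> real" where "g k = (if k = 0 then 9 / 16 else if k = 1 then 6 / 16 else 1 / 16)" for k
  have g: "(\<lambda>n. fpcount n k / catal n) \<longlonglongrightarrow> g k" if "k \<in> {0, 1, 2}" for k
    using that fpcount_ratio by (auto simp: g_def)
  \<comment> \<open>The limiting normalization 9 + 6 q + q^2 is a perfect square, as it must be for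
    a sum of two independent equal Bernoulli variables.\<close>
  have den: "(\<Sum>k\<in>{0,1,2}. q ^ k * g k) = (3 + q) ^ 2 / 16"
    by (simp add: g_def power2_eq_square field_simps)
  have "(\<lambda>n. cdf (distr (measure_pmf (Pq123 q n)) borel (\<lambda>\<sigma>. real (fp n \<sigma>))) x) \<longlonglongrightarrow>
    (\<Sum>k\<in>{0,1,2}. of_bool (real k \<le> x) * q ^ k * g k) / (\<Sum>k\<in>{0,1,2}. q ^ k * g k)"
    unfolding cdf_Pq123[OF assms]
  proof (intro tendsto_divide tendsto_sum tendsto_mult tendsto_const g)
    show "(\<Sum>k\<in>{0,1,2}. q ^ k * g k) \<noteq> 0" unfolding den using assms by simp
  qed
  also have "(\<Sum>k\<in>{0,1,2}. of_bool (real k \<le> x) * q ^ k * g k) / (\<Sum>k\<in>{0,1,2}. q ^ k * g k) =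
    cdf (distr (measure_pmf (pair_pmf (bernoulli_pmf (q / (3 + q))) (bernoulli_pmf (q / (3 + q)))))
                  borel (\<lambda>(a, b). real (of_bool a + of_bool b))) x"
  proof -
    define p where "p = q / (3 + q)"
    have p: "0 \<le> p" "p \<le> 1" using assms by (auto simp: p_def)
    have s: "3 + q \<noteq> 0" using assms by simp
    have "(1 - p) ^ 2 = 9 / (3 + q) ^ 2" "2 * p * (1 - p) = 6 * q / (3 + q) ^ 2" "p ^ 2 = q ^ 2 / (3 + q) ^ 2"
      using s by (simp_all add: p_def divide_simps power2_eq_square)
    moreover have "(\<Sum>k\<in>{0,1,2}. of_bool (real k \<le> x) * q ^ k * g k) =
      of_bool (0 \<le> x) * (9 / 16) + of_bool (1 \<le> x) * (6 * q / 16) + of_bool (2 \<le> x) * (q ^ 2 / 16)"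
      by (simp add: g_def)
    ultimately show ?thesis
      unfolding den p_def[symmetric] cdf_sum_bernoulli[OF p] by (simp add: add_divide_distrib)
  qed
  finally show "(\<lambda>n. cdf (distr (measure_pmf (Pq123 q n)) borel (\<lambda>\<sigma>. real (fp n \<sigma>))) x) \<longlonglongrightarrow>
    cdf (distr (measure_pmf (pair_pmf (bernoulli_pmf (q / (3 + q))) (bernoulli_pmf (q / (3 + q)))))
                  borel (\<lambda>(a, b). real (of_bool a + of_bool b))) x" .
qed

end
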